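(* The identity-on-objects, dagger compact functor $E\colon\mathbf{zx}\to\|\underline{\mathbf{zx}}\|$ which sends each generating morphism of $\mathbf{zx}$ (the wire; the green spider with $m$ inputs, $n$ outputs and phase $\alpha$; the red spider with $m$ inputs, $n$ outputs and phase $\beta$; the Hadamard node; the diamond node) to the class of the corresponding basic open graph over $S_{\text{zx}}$ (respectively the wire; the green spider with the same $m,n,\alpha$; the red spider with the same $m,n,\beta$; the Hadamard; the diamond) is an equivalence of categories.
   Context: **The category $\mathbf{zx}$.** It is the dagger compact category whose objects are the non-negative integers (tensor is addition on objects, disjoint union on morphisms; composition connects outputs to inputs; every object is self-dual) and whose morphisms are generated by: the wire $1\to1$; green spiders $G^{m,n}(\alpha)\colon m\to n$ and red spiders $R^{m,n}(\alpha)\colon m\to n$ for $m,n\ge0$ and $\alpha\in[-\pi,\pi)$ (phases are added and negated modulo $2\pi$; an omitted phase is $0$); the Hadamard node $H\colon1\to1$; the diamond $\diamond\colon0\to0$. The wire is $\mathrm{id}_1$. Write $\sigma\colon 2\to2$ for the braiding and $\mathrm{ev}\colon2\to0$, $\mathrm{coev}\colon0\to2$ for the evaluation and coevaluation of the object $1$. The dagger satisfies $G^{m,n}(\alpha)^\dagger=G^{n,m}(-\alpha)$, $R^{m,n}(\alpha)^\dagger=R^{n,m}(-\alpha)$, and fixes wire, $H$ and $\diamond$. Diagrams are taken up to ambient isotopy in 4-space (so only the way nodes are connected to each other and to the ordered inputs and outputs matters), and the following basic relations are imposed, together with those obtained by exchanging red and green and by applying the dagger: (Spider) $(\mathrm{id}_n\otimes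 G^{k+p,q}(\beta))\circ(G^{m,n+k}(\alpha)\otimes\mathrm{id}_p)=G^{m+p,n+q}(\alpha+\beta)$ for $k\ge1$; (Bialgebra) $\diamond\otimes\big[(R^{2,1}\otimes R^{2,1})\circ(\mathrm{id}_1\otimes\sigma\otimes\mathrm{id}_1)\circ(G^{1,2}\otimes G^{1,2})\big]=G^{1,2}\circ R^{2,1}$; (Copy) $\diamond\otimes(G^{1,2}\circ R^{0,1})=R^{0,1}\otimes R^{0,1}$; ($\pi$-Copy) $G^{1,2}\circ R^{1,1}(\pi)=(R^{1,1}(\pi)\otimes R^{1,1}(\pi))\circ G^{1,2}$; (Cup) $G^{0,2}=\mathrm{coev}$; (Trivial spider) $G^{1,1}(0)=\mathrm{id}_1$; ($\pi$-Commutation) $G^{1,1}(\alpha)\circ R^{1,1}(\pi)=R^{1,1}(\pi)\circ G^{1,1}(-\alpha)$; (Color change) $H^{\otimes n}\circ G^{m,n}(\alpha)\circ H^{\otimes m}=R^{m,n}(\alpha)$; (Loop) $\mathrm{ev}\circ\mathrm{coev}=\diamond\otimes\diamond$; (Diamond) $R^{1,0}\circ G^{0,1}=\diamond$. **Open graphs over $S_{\text{zx}}$.** $\mathbf{Graph}$ is the category of directed graphs. $S_{\text{zx}}$ is the directed graph with nodes: a white node $\circ$; a green node for each $\alpha\in[-\pi,\pi)$; a red node for each $\beta\in[-\pi,\pi)$; a Hadamard node; a diamond node. Its arrows are: one loop at $\circ$; and, for each green node, each red node and the Hadamard node, exactly one arrow to $\circ$ and exactly one arrow from $\circ$; the diamond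 node has no arrows. $\mathbf{Graph}\downarrow S_{\text{zx}}$ is the slice category. $\mathbf{FinSet}_0$ is a skeleton of the category of finite sets, and $N_{\text{zx}}\colon\mathbf{FinSet}_0\to\mathbf{Graph}\downarrow S_{\text{zx}}$ sends $X$ to the edgeless graph with node set $X$ mapped constantly to $\circ$. An open graph over $S_{\text{zx}}$ is a cospan $N_{\text{zx}}(X)\to G\leftarrow N_{\text{zx}}(Y)$ in $\mathbf{Graph}\downarrow S_{\text{zx}}$, with inputs $X$ and outputs $Y$. **The bicategory $\mathbf{zxRewrite}$.** For a category $\mathbf{C}$ with finite limits and colimits, $\mathbf{Sp}(\mathbf{Csp}(\mathbf{C}))$ is the symmetric monoidal compact closed bicategory (under coproduct) with 0-cells the objects of $\mathbf{C}$; 1-cells the cospans in $\mathbf{C}$, composed by pushout; 2-cells from $x\to y\leftarrow z$ to $x\to y'\leftarrow z$ the spans of cospans, i.e. cospans $x\to s\leftarrow z$ with maps $y\leftarrow s\to y'$ commuting with all the legs, two such being identified when they have the same domain and codomain cospans. Vertical composition is by pullback, horizontal composition by pushout. $\mathbf{zxRewrite}$ is the symmetric monoidal compact closed sub-bicategory of $\mathbf{Sp}(\mathbf{Csp}(\mathbf{Graph}\downarrow S_{\text{zx}}))$ that is 1-full and 2-full on the 0-cells $N_{\text{zx}}(X)$, $X$ a finite set. **Basic 1-cells** (basic open graphs over $S_{\text{zx}}$): the wire (two white nodes $a,b$ and an edge $a\to b$; input $a$, output $b$); the green (resp. red) spider with $m$ inputs, $n$ outputs and phase $\alpha$ (white input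 nodes $a_1,\dots,a_m$, white output nodes $b_1,\dots,b_n$, one node over the green (resp. red) node labelled $\alpha$, an edge from each $a_i$ to it and an edge from it to each $b_j$); the Hadamard (white input $a$, a Hadamard node $h$, white output $b$, edges $a\to h\to b$); the diamond (a single diamond node, no inputs or outputs). **Basic 2-cells**: translate both sides of each basic relation of $\mathbf{zx}$ listed above into open graphs over $S_{\text{zx}}$ by replacing generators by the corresponding basic 1-cells (and braiding, $\mathrm{ev}$, $\mathrm{coev}$ by those of $\mathbf{zxRewrite}$); the basic 2-cell is the class of the span of cospans between the two sides whose apex is the edgeless graph $N_{\text{zx}}$ of the disjoint union of inputs and outputs. Also included are the 2-cells obtained from these by exchanging red and green nodes, by swapping inputs and outputs, and by turning the spans around, and the 2-cell (and its reverse) from the wire to the identity cospan on one white node. **$\underline{\mathbf{zx}}$ and $\|\underline{\mathbf{zx}}\|$.** $\underline{\mathbf{zx}}$ is the symmetric monoidal compact closed sub-bicategory of $\mathbf{zxRewrite}$ generated by the basic 1-cells and basic 2-cells. $\|\underline{\mathbf{zx}}\|$ is the category whose objects are the 0-cells of $\underline{\mathbf{zx}}$ and whose arrows are 1-cells of $\underline{\mathbf{zx}}$ modulo: $f\sim g$ iff there is a 2-cell $f\Rightarrow g$ in $\underline{\mathbf{zx}}$. The integer $n$ is identified with the 0-cell $N_{\text{zx}}(\{1,\dots,n\})$. $\|\underline{\mathbf{zx}}\|$ is dagger compact via the identity-on-objects dagger that exchanges inputs and outputs of spiders and negates their phase, and fixes wire, Hadamard and diamond; its evaluation and coevaluation are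 those of $\underline{\mathbf{zx}}$ (the classes of the cospans $x+x\to x\leftarrow0$ and $0\to x\leftarrow x+x$ with codiagonal legs). *)

theory Defs
  imports Complex_Main "Graph_Theory.Digraph" "HOL-Library.Nat_Bijection" "HOL-Library.Real_Mod"
begin

section \<open>Strict dagger compact categories with self-dual objects\<close>

record ('o, 'a) category_data =
  Obj :: "'o set"
  Hom :: "'o \<Rightarrow> 'o \<Rightarrow> 'a set"
  Ident :: "'o \<Rightarrow> 'a"
  Cmp :: "'a \<Rightarrow> 'a \<Rightarrow> 'a"

text \<open>\<open>Cmp C g f\<close> is the composite of \<open>g\<close> after \<open>f\<close>.\<close>

locale category_laws =
  fixes C :: "('o, 'a, 'm) category_data_scheme"
  assumes hom_disjoint: "\<lbrakk>f \<in> Hom C x y; f \<in> Hom C x' y'\<rbrakk> \<Longrightarrow> x = x' \<and> y = y'"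
    and hom_obj: "f \<in> Hom C x y \<Longrightarrow> x \<in> Obj C \<and> y \<in> Obj C"
    and ident_hom: "x \<in> Obj C \<Longrightarrow> Ident C x \<in> Hom C x x"
    and cmp_hom: "\<lbrakk>f \<in> Hom C x y; g \<in> Hom C y z\<rbrakk> \<Longrightarrow> Cmp C g f \<in> Hom C x z"
    and cmp_ident_right: "f \<in> Hom C x y \<Longrightarrow> Cmp C f (Ident C x) = f"
    and cmp_ident_left: "f \<in> Hom C x y \<Longrightarrow> Cmp C (Ident C y) f = f"
    and cmp_assoc: "\<lbrakk>f \<in> Hom C w x; g \<in> Hom C x y; h \<in> Hom C y z\<rbrakk>
      \<Longrightarrow> Cmp C (Cmp C h g) f = Cmp C h (Cmp C g f)"

record ('o, 'a) dagger_compact_data = "('o, 'a) category_data" +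
  Unit :: 'o
  TObj :: "'o \<Rightarrow> 'o \<Rightarrow> 'o"
  TArr :: "'a \<Rightarrow> 'a \<Rightarrow> 'a"
  Brd :: "'o \<Rightarrow> 'o \<Rightarrow> 'a"
  Eval :: "'o \<Rightarrow> 'a"
  Coev :: "'o \<Rightarrow> 'a"
  Dag :: "'a \<Rightarrow> 'a"

locale dagger_compact = category_laws C
  for C :: "('o, 'a, 'm) dagger_compact_data_scheme" +
  assumes unit_obj: "Unit C \<in> Obj C"
    and tensor_obj: "\<lbrakk>x \<in> Obj C; y \<in> Obj C\<rbrakk> \<Longrightarrow> TObj C x y \<in> Obj C"
    and tensor_obj_assoc: "\<lbrakk>x \<in> Obj C; y \<in> Obj C; z \<in> Obj C\<rbrakk>
      \<Longrightarrow> TObj C (TObj C x y) z = TObj C x (TObj C y z)"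
    and tensor_obj_unit: "x \<in> Obj C \<Longrightarrow> TObj C (Unit C) x = x \<and> TObj C x (Unit C) = x"
    and tensor_hom: "\<lbrakk>f \<in> Hom C x y; g \<in> Hom C x' y'\<rbrakk>
      \<Longrightarrow> TArr C f g \<in> Hom C (TObj C x x') (TObj C y y')"
    and tensor_ident: "\<lbrakk>x \<in> Obj C; y \<in> Obj C\<rbrakk>
      \<Longrightarrow> TArr C (Ident C x) (Ident C y) = Ident C (TObj C x y)"
    and tensor_cmp: "\<lbrakk>f \<in> Hom C x y; g \<in> Hom C y z; f' \<in> Hom C x' y'; g' \<in> Hom C y' z'\<rbrakk>
      \<Longrightarrow> TArr C (Cmp C g f) (Cmp C g' f') = Cmp C (TArr C g g') (TArr C f f')"
    and tensor_assoc: "\<lbrakk>f \<in> Hom C x y; f' \<in> Hom C x' y'; f'' \<in> Hom C x'' y''\<rbrakk>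
      \<Longrightarrow> TArr C (TArr C f f') f'' = TArr C f (TArr C f' f'')"
    and tensor_unit: "f \<in> Hom C x y
      \<Longrightarrow> TArr C (Ident C (Unit C)) f = f \<and> TArr C f (Ident C (Unit C)) = f"
    and braid_hom: "\<lbrakk>x \<in> Obj C; y \<in> Obj C\<rbrakk> \<Longrightarrow> Brd C x y \<in> Hom C (TObj C x y) (TObj C y x)"
    and braid_natural: "\<lbrakk>f \<in> Hom C x y; f' \<in> Hom C x' y'\<rbrakk>
      \<Longrightarrow> Cmp C (Brd C y y') (TArr C f f') = Cmp C (TArr C f' f) (Brd C x x')"
    and braid_braid: "\<lbrakk>x \<in> Obj C; y \<in> Obj C\<rbrakk>
      \<Longrightarrow> Cmp C (Brd C y x) (Brd C x y) = Ident C (TObj C x y)"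
    and hexagon: "\<lbrakk>x \<in> Obj C; y \<in> Obj C; z \<in> Obj C\<rbrakk>
      \<Longrightarrow> Brd C x (TObj C y z) = Cmp C (TArr C (Ident C y) (Brd C x z)) (TArr C (Brd C x y) (Ident C z))"
    and eval_hom: "x \<in> Obj C \<Longrightarrow> Eval C x \<in> Hom C (TObj C x x) (Unit C)"
    and coev_hom: "x \<in> Obj C \<Longrightarrow> Coev C x \<in> Hom C (Unit C) (TObj C x x)"
    and snake: "x \<in> Obj C
      \<Longrightarrow> Cmp C (TArr C (Eval C x) (Ident C x)) (TArr C (Ident C x) (Coev C x)) = Ident C x"
    and snake': "x \<in> Obj C
      \<Longrightarrow> Cmp C (TArr C (Ident C x) (Eval C x)) (TArr C (Coev C x) (Ident C x)) = Ident C x"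
    and eval_braid: "x \<in> Obj C \<Longrightarrow> Cmp C (Eval C x) (Brd C x x) = Eval C x"
    and eval_tensor: "\<lbrakk>x \<in> Obj C; y \<in> Obj C\<rbrakk>
      \<Longrightarrow> Eval C (TObj C x y) =
          Cmp C (TArr C (Eval C x) (Eval C y))
                (TArr C (TArr C (Ident C x) (Brd C y x)) (Ident C y))"
    and dag_hom: "f \<in> Hom C x y \<Longrightarrow> Dag C f \<in> Hom C y x"
    and dag_dag: "f \<in> Hom C x y \<Longrightarrow> Dag C (Dag C f) = f"
    and dag_ident: "x \<in> Obj C \<Longrightarrow> Dag C (Ident C x) = Ident C x"
    and dag_cmp: "\<lbrakk>f \<in> Hom C x y; g \<in> Hom C y z\<rbrakk>
      \<Longrightarrow> Dag C (Cmp C g f) = Cmp C (Dag C f) (Dag C g)"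
    and dag_tensor: "\<lbrakk>f \<in> Hom C x y; f' \<in> Hom C x' y'\<rbrakk>
      \<Longrightarrow> Dag C (TArr C f f') = TArr C (Dag C f) (Dag C f')"
    and dag_braid: "\<lbrakk>x \<in> Obj C; y \<in> Obj C\<rbrakk> \<Longrightarrow> Dag C (Brd C x y) = Brd C y x"
    and dag_eval: "x \<in> Obj C \<Longrightarrow> Dag C (Eval C x) = Coev C x"

definition functor_between ::
  "('o, 'a, 'm) category_data_scheme \<Rightarrow> ('p, 'b, 'n) category_data_scheme
    \<Rightarrow> ('o \<Rightarrow> 'p) \<Rightarrow> ('a \<Rightarrow> 'b) \<Rightarrow> bool" where
  "functor_between C D Fo Fa \<longleftrightarrow>
     category_laws C \<and> category_laws D \<and>
     (\<forall>x\<in>Obj C. Fo x \<in> Obj D) \<and>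
     (\<forall>x y. \<forall>f\<in>Hom C x y. Fa f \<in> Hom D (Fo x) (Fo y)) \<and>
     (\<forall>x\<in>Obj C. Fa (Ident C x) = Ident D (Fo x)) \<and>
     (\<forall>x y z. \<forall>f\<in>Hom C x y. \<forall>g\<in>Hom C y z. Fa (Cmp C g f) = Cmp D (Fa g) (Fa f))"

definition is_iso :: "('o, 'a, 'm) category_data_scheme \<Rightarrow> 'o \<Rightarrow> 'o \<Rightarrow> 'a \<Rightarrow> bool" where
  "is_iso C x y f \<longleftrightarrow>
     f \<in> Hom C x y \<and> (\<exists>g\<in>Hom C y x. Cmp C g f = Ident C x \<and> Cmp C f g = Ident C y)"

definition natural_iso ::
  "('o, 'a, 'm) category_data_scheme \<Rightarrow> ('p, 'b, 'n) category_data_scheme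
    \<Rightarrow> ('o \<Rightarrow> 'p) \<Rightarrow> ('a \<Rightarrow> 'b) \<Rightarrow> ('o \<Rightarrow> 'p) \<Rightarrow> ('a \<Rightarrow> 'b) \<Rightarrow> ('o \<Rightarrow> 'b) \<Rightarrow> bool" where
  "natural_iso C D Fo Fa Go Ga \<eta> \<longleftrightarrow>
     functor_between C D Fo Fa \<and> functor_between C D Go Ga \<and>
     (\<forall>x\<in>Obj C. is_iso D (Fo x) (Go x) (\<eta> x)) \<and>
     (\<forall>x y. \<forall>f\<in>Hom C x y. Cmp D (\<eta> y) (Fa f) = Cmp D (Ga f) (\<eta> x))"

definition equivalence_of_categories ::
  "('o, 'a, 'm) category_data_scheme \<Rightarrow> ('p, 'b, 'n) category_data_scheme
    \<Rightarrow> ('o \<Rightarrow> 'p) \<Rightarrow> ('a \<Rightarrow> 'b) \<Rightarrow> bool" where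
  "equivalence_of_categories C D Fo Fa \<longleftrightarrow>
     functor_between C D Fo Fa \<and>
     (\<exists>Go Ga \<eta> \<epsilon>. functor_between D C Go Ga \<and>
        natural_iso C C id id (Go \<circ> Fo) (Ga \<circ> Fa) \<eta> \<and>
        natural_iso D D (Fo \<circ> Go) (Fa \<circ> Ga) id id \<epsilon>)"

definition dagger_compact_functor ::
  "('o, 'a, 'm) dagger_compact_data_scheme \<Rightarrow> ('p, 'b, 'n) dagger_compact_data_scheme
    \<Rightarrow> ('o \<Rightarrow> 'p) \<Rightarrow> ('a \<Rightarrow> 'b) \<Rightarrow> bool" where
  "dagger_compact_functor C D Fo Fa \<longleftrightarrow>
     dagger_compact C \<and> dagger_compact D \<and> functor_between C D Fo Fa \<and>
     Fo (Unit C) = Unit D \<and>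
     (\<forall>x\<in>Obj C. \<forall>y\<in>Obj C. Fo (TObj C x y) = TObj D (Fo x) (Fo y)) \<and>
     (\<forall>x y x' y'. \<forall>f\<in>Hom C x y. \<forall>g\<in>Hom C x' y'. Fa (TArr C f g) = TArr D (Fa f) (Fa g)) \<and>
     (\<forall>x\<in>Obj C. \<forall>y\<in>Obj C. Fa (Brd C x y) = Brd D (Fo x) (Fo y)) \<and>
     (\<forall>x\<in>Obj C. Fa (Eval C x) = Eval D (Fo x)) \<and>
     (\<forall>x\<in>Obj C. Fa (Coev C x) = Coev D (Fo x)) \<and>
     (\<forall>x y. \<forall>f\<in>Hom C x y. Fa (Dag C f) = Dag D (Fa f))"


section \<open>Phases\<close>

typedef phase = "{-pi..<pi} :: real set"
  morphisms angle Abs_phase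
  by (rule exI[of _ 0]) simp

definition phase_of :: "real \<Rightarrow> phase" where
  "phase_of x = Abs_phase ((x + pi) rmod (2 * pi) - pi)"

lemma angle_phase_of: "angle (phase_of x) = (x + pi) rmod (2 * pi) - pi"
  unfolding phase_of_def
  using rmod_nonneg[of "2 * pi" "x + pi"] rmod_less[of "2 * pi" "x + pi"]
  by (intro Abs_phase_inverse) auto

lemma phase_of_eq_iff: "phase_of x = phase_of y \<longleftrightarrow> [x = y] (rmod (2 * pi))"
proof -
  have "phase_of x = phase_of y \<longleftrightarrow> (x + pi) rmod (2 * pi) = (y + pi) rmod (2 * pi)"
    by (simp add: angle_inject[symmetric] angle_phase_of)
  also have "\<dots> \<longleftrightarrow> [x + pi = y + pi] (rmod (2 * pi))" by (simp add: rcong_def)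
  finally show ?thesis by simp
qed

lemma phase_of_angle [simp]: "phase_of (angle a) = a"
proof -
  have "(angle a + pi) rmod (2 * pi) = angle a + pi"
    using angle[of a] by (intro rmod_idem) auto
  then show ?thesis by (simp add: phase_of_def angle_inverse)
qed

lemma rcong_angle_phase_of: "[angle (phase_of x) = x] (rmod (2 * pi))"
  by (simp add: phase_of_eq_iff[symmetric])

instantiation phase :: ab_group_add
begin

definition "0 = phase_of 0"
definition "a + b = phase_of (angle a + angle b)"
definition "- a = phase_of (- angle a)"
definition "a - b = phase_of (angle a - angle b)" for a b :: phase

instance
proof
  fix a b c :: phase
  note defs = plus_phase_def zero_phase_def uminus_phase_def minus_phase_def phase_of_eq_iff
  note rcong = rcong_angle_phase_of
  have "[angle (phase_of (angle a + angle b)) + angle c = (angle a + angle b) + angle c] (rmod (2 * pi))"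
    by (intro rcong_add rcong rcong_refl)
  moreover have "[angle a + angle (phase_of (angle b + angle c)) = angle a + (angle b + angle c)] (rmod (2 * pi))"
    by (intro rcong_add rcong rcong_refl)
  ultimately show "a + b + c = a + (b + c)"
    by (simp add: defs rcong_def add.assoc)
  show "a + b = b + a" by (simp add: plus_phase_def add.commute)
  have "[angle (phase_of 0) + angle a = 0 + angle a] (rmod (2 * pi))"
    by (intro rcong_add rcong rcong_refl)
  then have "phase_of (angle (phase_of 0) + angle a) = phase_of (angle a)"
    by (simp add: phase_of_eq_iff del: phase_of_angle)
  then show "0 + a = a" by (simp add: plus_phase_def zero_phase_def)
  have "[angle (phase_of (- angle a)) + angle a = - angle a + angle a] (rmod (2 * pi))"
    by (intro rcong_add rcong rcong_refl)
  then show "- a + a = 0" by (simp add: defs)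
  have "[angle a + angle (phase_of (- angle b)) = angle a + - angle b] (rmod (2 * pi))"
    by (intro rcong_add rcong rcong_refl)
  then show "a - b = a + - b" by (simp add: defs rcong_def)
qed

end


section \<open>The category zx\<close>

datatype zx_term =
    Id nat
  | Braid nat nat
  | Ev nat
  | Cv nat
  | Wire
  | Green nat nat phase
  | Red nat nat phase
  | Had
  | Diam
  | Comp zx_term zx_term  (infixr "\<bullet>" 55)
  | Tens zx_term zx_term  (infixr "\<otimes>" 60)

text \<open>\<open>g \<bullet> f\<close> is \<open>g\<close> after \<open>f\<close>. The braiding, evaluation and coevaluation of the object 1
  are \<open>Braid 1 1\<close>, \<open>Ev 1\<close> and \<open>Cv 1\<close>.\<close>

inductive typed :: "zx_term \<Rightarrow> nat \<Rightarrow> nat \<Rightarrow> bool" where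
  "typed (Id n) n n"
| "typed (Braid m n) (m + n) (n + m)"
| "typed (Ev n) (n + n) 0"
| "typed (Cv n) 0 (n + n)"
| "typed Wire 1 1"
| "typed (Green m n a) m n"
| "typed (Red m n a) m n"
| "typed Had 1 1"
| "typed Diam 0 0"
| "typed f m k \<Longrightarrow> typed g k n \<Longrightarrow> typed (g \<bullet> f) m n"
| "typed f m n \<Longrightarrow> typed g m' n' \<Longrightarrow> typed (f \<otimes> g) (m + m') (n + n')"

primrec dag :: "zx_term \<Rightarrow> zx_term" where
  "dag (Id n) = Id n"
| "dag (Braid m n) = Braid n m"
| "dag (Ev n) = Cv n"
| "dag (Cv n) = Ev n"
| "dag Wire = Wire"
| "dag (Green m n a) = Green n m (- a)"
| "dag (Red m n a) = Red n m (- a)"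
| "dag Had = Had"
| "dag Diam = Diam"
| "dag (g \<bullet> f) = dag f \<bullet> dag g"
| "dag (f \<otimes> g) = dag f \<otimes> dag g"

primrec exchange :: "zx_term \<Rightarrow> zx_term" where
  "exchange (Id n) = Id n"
| "exchange (Braid m n) = Braid m n"
| "exchange (Ev n) = Ev n"
| "exchange (Cv n) = Cv n"
| "exchange Wire = Wire"
| "exchange (Green m n a) = Red m n a"
| "exchange (Red m n a) = Green m n a"
| "exchange Had = Had"
| "exchange Diam = Diam"
| "exchange (g \<bullet> f) = exchange g \<bullet> exchange f"
| "exchange (f \<otimes> g) = exchange f \<otimes> exchange g"

primrec hads :: "nat \<Rightarrow> zx_term" where
  "hads 0 = Id 0"
| "hads (Suc n) = Had \<otimes> hads n"

inductive basic_relation :: "zx_term \<Rightarrow> zx_term \<Rightarrow> bool" where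
  spider: "k \<ge> 1 \<Longrightarrow>
    basic_relation ((Id n \<otimes> Green (k + p) q b) \<bullet> (Green m (n + k) a \<otimes> Id p))
                   (Green (m + p) (n + q) (a + b))"
| bialgebra:
    "basic_relation (Diam \<otimes> ((Red 2 1 0 \<otimes> Red 2 1 0) \<bullet> (Id 1 \<otimes> Braid 1 1 \<otimes> Id 1)
                              \<bullet> (Green 1 2 0 \<otimes> Green 1 2 0)))
                   (Green 1 2 0 \<bullet> Red 2 1 0)"
| copy:
    "basic_relation (Diam \<otimes> (Green 1 2 0 \<bullet> Red 0 1 0)) (Red 0 1 0 \<otimes> Red 0 1 0)"
| pi_copy:
    "basic_relation (Green 1 2 0 \<bullet> Red 1 1 (phase_of pi))
                   ((Red 1 1 (phase_of pi) \<otimes> Red 1 1 (phase_of pi)) \<bullet> Green 1 2 0)"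
| cup: "basic_relation (Green 0 2 0) (Cv 1)"
| trivial_spider: "basic_relation (Green 1 1 0) (Id 1)"
| pi_commutation:
    "basic_relation (Green 1 1 a \<bullet> Red 1 1 (phase_of pi)) (Red 1 1 (phase_of pi) \<bullet> Green 1 1 (- a))"
| color_change: "basic_relation (hads n \<bullet> Green m n a \<bullet> hads m) (Red m n a)"
| loop: "basic_relation (Ev 1 \<bullet> Cv 1) (Diam \<otimes> Diam)"
| diamond: "basic_relation (Red 1 0 0 \<bullet> Green 0 1 0) Diam"

text \<open>Ambient isotopy of diagrams in 4-space: besides the axioms of a compact category (in \<open>zx_eq\<close>
  below), the legs of a node carry no order and can be bent from input to output.\<close>

inductive node_isotopy :: "zx_term \<Rightarrow> zx_term \<Rightarrow> bool" where
  permute_legs: "node_isotopy ((Id p \<otimes> Braid 1 1 \<otimes> Id q) \<bullet> Green m (p + (2 + q)) a)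
                              (Green m (p + (2 + q)) a)"
| bend_leg: "node_isotopy ((Green (m + 1) n a \<otimes> Id 1) \<bullet> (Id m \<otimes> Cv 1)) (Green m (n + 1) a)"
| bend_hadamard: "node_isotopy ((Ev 1 \<otimes> Id 1) \<bullet> (Id 1 \<otimes> Had \<otimes> Id 1) \<bullet> (Id 1 \<otimes> Cv 1)) Had"

text \<open>The congruence of strict dagger compact categories with self-dual objects generated by
  the relations above.\<close>

inductive zx_eq :: "zx_term \<Rightarrow> zx_term \<Rightarrow> bool" where
  basic: "basic_relation s t \<Longrightarrow> zx_eq s t"
| isotopy: "node_isotopy s t \<Longrightarrow> zx_eq s t"
| wire: "zx_eq Wire (Id 1)"
| exchange: "zx_eq s t \<Longrightarrow> zx_eq (exchange s) (exchange t)"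
| dagger: "zx_eq s t \<Longrightarrow> zx_eq (dag s) (dag t)"
| refl: "typed t m n \<Longrightarrow> zx_eq t t"
| sym: "zx_eq s t \<Longrightarrow> zx_eq t s"
| trans: "zx_eq s t \<Longrightarrow> zx_eq t u \<Longrightarrow> zx_eq s u"
| comp_cong: "zx_eq f f' \<Longrightarrow> zx_eq g g' \<Longrightarrow> typed f m k \<Longrightarrow> typed g k n
    \<Longrightarrow> zx_eq (g \<bullet> f) (g' \<bullet> f')"
| tens_cong: "zx_eq f f' \<Longrightarrow> zx_eq g g' \<Longrightarrow> zx_eq (f \<otimes> g) (f' \<otimes> g')"
| comp_id_left: "typed f m n \<Longrightarrow> zx_eq (Id n \<bullet> f) f"
| comp_id_right: "typed f m n \<Longrightarrow> zx_eq (f \<bullet> Id m) f"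
| comp_assoc: "typed f m k \<Longrightarrow> typed g k l \<Longrightarrow> typed h l n
    \<Longrightarrow> zx_eq ((h \<bullet> g) \<bullet> f) (h \<bullet> g \<bullet> f)"
| tens_id: "zx_eq (Id m \<otimes> Id n) (Id (m + n))"
| tens_comp: "typed f m k \<Longrightarrow> typed g k n \<Longrightarrow> typed f' m' k' \<Longrightarrow> typed g' k' n'
    \<Longrightarrow> zx_eq ((g \<bullet> f) \<otimes> (g' \<bullet> f')) ((g \<otimes> g') \<bullet> (f \<otimes> f'))"
| tens_assoc: "typed f m n \<Longrightarrow> typed f' m' n' \<Longrightarrow> typed f'' m'' n''
    \<Longrightarrow> zx_eq ((f \<otimes> f') \<otimes> f'') (f \<otimes> f' \<otimes> f'')"
| tens_unit_left: "typed f m n \<Longrightarrow> zx_eq (Id 0 \<otimes> f) f"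
| tens_unit_right: "typed f m n \<Longrightarrow> zx_eq (f \<otimes> Id 0) f"
| braid_natural: "typed f m n \<Longrightarrow> typed f' m' n'
    \<Longrightarrow> zx_eq (Braid n n' \<bullet> (f \<otimes> f')) ((f' \<otimes> f) \<bullet> Braid m m')"
| braid_braid: "zx_eq (Braid n m \<bullet> Braid m n) (Id (m + n))"
| hexagon: "zx_eq (Braid m (n + k)) ((Id n \<otimes> Braid m k) \<bullet> (Braid m n \<otimes> Id k))"
| snake: "zx_eq ((Ev n \<otimes> Id n) \<bullet> (Id n \<otimes> Cv n)) (Id n)"
| ev_braid: "zx_eq (Ev n \<bullet> Braid n n) (Ev n)"
| ev_tens: "zx_eq (Ev (m + n)) ((Ev m \<otimes> Ev n) \<bullet> ((Id m \<otimes> Braid n m) \<otimes> Id n))"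

definition lift1 :: "('s \<Rightarrow> 's set) \<Rightarrow> ('s \<Rightarrow> 's) \<Rightarrow> 's set \<Rightarrow> 's set" where
  "lift1 cls f A = (\<Union>a\<in>A. cls (f a))"

definition lift2 :: "('s \<Rightarrow> 's set) \<Rightarrow> ('s \<Rightarrow> 's \<Rightarrow> 's) \<Rightarrow> 's set \<Rightarrow> 's set \<Rightarrow> 's set" where
  "lift2 cls f A B = (\<Union>a\<in>A. \<Union>b\<in>B. cls (f a b))"

definition zx_class :: "zx_term \<Rightarrow> zx_term set" where
  "zx_class s = {t. zx_eq s t}"

definition zx :: "(nat, zx_term set) dagger_compact_data" where
  "zx = \<lparr> Obj = UNIV,
          Hom = (\<lambda>m n. {zx_class t | t. typed t m n}),
          Ident = (\<lambda>n. zx_class (Id n)),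
          Cmp = lift2 zx_class Comp,
          Unit = 0,
          TObj = (+),
          TArr = lift2 zx_class Tens,
          Brd = (\<lambda>m n. zx_class (Braid m n)),
          Eval = (\<lambda>n. zx_class (Ev n)),
          Coev = (\<lambda>n. zx_class (Cv n)),
          Dag = lift1 zx_class dag \<rparr>"


section \<open>Open graphs over the type graph\<close>

definition digraph_hom ::
  "('a, 'b) pre_digraph \<Rightarrow> ('c, 'd) pre_digraph \<Rightarrow> ('a \<Rightarrow> 'c) \<times> ('b \<Rightarrow> 'd) \<Rightarrow> bool" where
  "digraph_hom G H h \<longleftrightarrow>
     wf_digraph G \<and> wf_digraph H \<and>
     (\<forall>v\<in>verts G. fst h v \<in> verts H) \<and>
     (\<forall>e\<in>arcs G. snd h e \<in> arcs H \<and> tail H (snd h e) = fst h (tail G e)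
                                 \<and> head H (snd h e) = fst h (head G e))"

datatype zx_node = White | GreenN phase | RedN phase | HadN | DiamN

datatype zx_arrow = WhiteLoop | ToWhite zx_node | FromWhite zx_node

definition S_zx :: "(zx_node, zx_arrow) pre_digraph" where
  "S_zx = \<lparr> verts = UNIV,
            arcs = insert WhiteLoop (\<Union>x\<in>UNIV - {White, DiamN}. {ToWhite x, FromWhite x}),
            tail = (\<lambda>e. case e of WhiteLoop \<Rightarrow> White | ToWhite x \<Rightarrow> x | FromWhite x \<Rightarrow> White),
            head = (\<lambda>e. case e of WhiteLoop \<Rightarrow> White | ToWhite x \<Rightarrow> White | FromWhite x \<Rightarrow> x) \<rparr>"

text \<open>Nodes and arcs of all graphs over \<open>S_zx\<close> are drawn from \<open>nat\<close>. Disjoint unions are formed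
  with \<open>sum_encode\<close>, pullbacks with \<open>prod_encode\<close>, and an equivalence class of nodes is
  represented by its least element.\<close>

record sgraph =
  shape :: "(nat, nat) pre_digraph"
  over :: "(nat \<Rightarrow> zx_node) \<times> (nat \<Rightarrow> zx_arrow)"

definition slice_obj :: "sgraph \<Rightarrow> bool" where
  "slice_obj X \<longleftrightarrow> digraph_hom (shape X) S_zx (over X)"

type_synonym smap = "(nat \<Rightarrow> nat) \<times> (nat \<Rightarrow> nat)"

definition slice_hom :: "sgraph \<Rightarrow> sgraph \<Rightarrow> smap \<Rightarrow> bool" where
  "slice_hom X Y h \<longleftrightarrow>
     slice_obj X \<and> slice_obj Y \<and> digraph_hom (shape X) (shape Y) h \<and>
     (\<forall>v\<in>verts (shape X). fst (over Y) (fst h v) = fst (over X) v) \<and>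
     (\<forall>e\<in>arcs (shape X). snd (over Y) (snd h e) = snd (over X) e)"

definition slice_iso :: "sgraph \<Rightarrow> sgraph \<Rightarrow> smap \<Rightarrow> bool" where
  "slice_iso X Y h \<longleftrightarrow>
     slice_hom X Y h \<and> bij_betw (fst h) (verts (shape X)) (verts (shape Y)) \<and>
     bij_betw (snd h) (arcs (shape X)) (arcs (shape Y))"

definition N_zx :: "nat \<Rightarrow> sgraph" where
  "N_zx n = \<lparr> shape = \<lparr> verts = {1..n}, arcs = {}, tail = id, head = id \<rparr>,
              over = (\<lambda>_. White, \<lambda>_. WhiteLoop) \<rparr>"

text \<open>A cospan \<open>N_zx (ins f) \<rightarrow> apex f \<leftarrow> N_zx (outs f)\<close>. A morphism out of an edgeless graph is
  given by its node map, which is what \<open>inp\<close> and \<open>outp\<close> record.\<close>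

record ograph =
  ins :: nat
  outs :: nat
  apex :: sgraph
  inp :: "nat \<Rightarrow> nat"
  outp :: "nat \<Rightarrow> nat"

definition open_graph :: "ograph \<Rightarrow> bool" where
  "open_graph f \<longleftrightarrow>
     slice_hom (N_zx (ins f)) (apex f) (inp f, id) \<and>
     slice_hom (N_zx (outs f)) (apex f) (outp f, id)"

abbreviation inl :: "nat \<Rightarrow> nat" where "inl x \<equiv> sum_encode (Inl x)"
abbreviation inr :: "nat \<Rightarrow> nat" where "inr x \<equiv> sum_encode (Inr x)"

definition sum_map :: "(nat \<Rightarrow> 'c) \<Rightarrow> (nat \<Rightarrow> 'c) \<Rightarrow> nat \<Rightarrow> 'c" where
  "sum_map f g z = case_sum f g (sum_decode z)"

definition disjoint_union :: "sgraph \<Rightarrow> sgraph \<Rightarrow> sgraph" where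
  "disjoint_union X Y =
     \<lparr> shape = \<lparr> verts = inl ` verts (shape X) \<union> inr ` verts (shape Y),
                arcs = inl ` arcs (shape X) \<union> inr ` arcs (shape Y),
                tail = sum_map (\<lambda>e. inl (tail (shape X) e)) (\<lambda>e. inr (tail (shape Y) e)),
                head = sum_map (\<lambda>e. inl (head (shape X) e)) (\<lambda>e. inr (head (shape Y) e)) \<rparr>,
       over = (sum_map (fst (over X)) (fst (over Y)), sum_map (snd (over X)) (snd (over Y))) \<rparr>"

definition glue :: "ograph \<Rightarrow> ograph \<Rightarrow> nat \<Rightarrow> nat" where
  "glue g f z =
     (LEAST w. equivclp (\<lambda>x y. \<exists>i\<in>{1..outs f}. x = inl (outp f i) \<and> y = inr (inp g i)) z w)"

text \<open>Since \<open>N_zx (outs f)\<close> has no arcs, the pushout over it only identifies nodes.\<close>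

definition og_comp :: "ograph \<Rightarrow> ograph \<Rightarrow> ograph" where
  "og_comp g f =
     (let U = disjoint_union (apex f) (apex g) in
      \<lparr> ins = ins f, outs = outs g,
        apex = \<lparr> shape = \<lparr> verts = glue g f ` verts (shape U), arcs = arcs (shape U),
                           tail = glue g f \<circ> tail (shape U), head = glue g f \<circ> head (shape U) \<rparr>,
                 over = over U \<rparr>,
        inp = (\<lambda>i. glue g f (inl (inp f i))), outp = (\<lambda>i. glue g f (inr (outp g i))) \<rparr>)"

definition og_tens :: "ograph \<Rightarrow> ograph \<Rightarrow> ograph" where
  "og_tens f g =
     \<lparr> ins = ins f + ins g, outs = outs f + outs g,
       apex = disjoint_union (apex f) (apex g),
       inp = (\<lambda>i. if i \<le> ins f then inl (inp f i) else inr (inp g (i - ins f))),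
       outp = (\<lambda>i. if i \<le> outs f then inl (outp f i) else inr (outp g (i - outs f))) \<rparr>"

definition og_id :: "nat \<Rightarrow> ograph" where
  "og_id n = \<lparr> ins = n, outs = n, apex = N_zx n, inp = id, outp = id \<rparr>"

definition og_braid :: "nat \<Rightarrow> nat \<Rightarrow> ograph" where
  "og_braid m n = \<lparr> ins = m + n, outs = n + m, apex = N_zx (m + n), inp = id,
                    outp = (\<lambda>i. if i \<le> n then m + i else i - n) \<rparr>"

definition og_ev :: "nat \<Rightarrow> ograph" where
  "og_ev n = \<lparr> ins = n + n, outs = 0, apex = N_zx n,
               inp = (\<lambda>i. if i \<le> n then i else i - n), outp = id \<rparr>"

definition og_coev :: "nat \<Rightarrow> ograph" where
  "og_coev n = \<lparr> ins = 0, outs = n + n, apex = N_zx n,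
                 inp = id, outp = (\<lambda>i. if i \<le> n then i else i - n) \<rparr>"

definition og_wire :: ograph where
  "og_wire = \<lparr> ins = 1, outs = 1,
               apex = \<lparr> shape = \<lparr> verts = {0, 1}, arcs = {0}, tail = (\<lambda>_. 0), head = (\<lambda>_. 1) \<rparr>,
                        over = (\<lambda>_. White, \<lambda>_. WhiteLoop) \<rparr>,
               inp = (\<lambda>_. 0), outp = (\<lambda>_. 1) \<rparr>"

text \<open>One node \<open>0\<close> over \<open>x\<close>, white inputs \<open>1, \<dots>, m\<close>, white outputs \<open>m + 1, \<dots>, m + n\<close>; the arc
  \<open>e\<close> joins the white node \<open>e\<close> to \<open>0\<close>.\<close>

definition og_star :: "zx_node \<Rightarrow> nat \<Rightarrow> nat \<Rightarrow> ograph" where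
  "og_star x m n =
     \<lparr> ins = m, outs = n,
       apex = \<lparr> shape = \<lparr> verts = {0..m + n}, arcs = {1..m + n},
                          tail = (\<lambda>e. if e \<le> m then e else 0),
                          head = (\<lambda>e. if e \<le> m then 0 else e) \<rparr>,
                over = (\<lambda>v. if v = 0 then x else White,
                        \<lambda>e. if e \<le> m then FromWhite x else ToWhite x) \<rparr>,
       inp = id, outp = (\<lambda>j. m + j) \<rparr>"

definition og_green :: "nat \<Rightarrow> nat \<Rightarrow> phase \<Rightarrow> ograph" where
  "og_green m n a = og_star (GreenN a) m n"

definition og_red :: "nat \<Rightarrow> nat \<Rightarrow> phase \<Rightarrow> ograph" where
  "og_red m n a = og_star (RedN a) m n"

definition og_had :: ograph where
  "og_had = og_star HadN 1 1"

definition og_diam :: ograph where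
  "og_diam = og_star DiamN 0 0"

primrec translate :: "zx_term \<Rightarrow> ograph" where
  "translate (Id n) = og_id n"
| "translate (Braid m n) = og_braid m n"
| "translate (Ev n) = og_ev n"
| "translate (Cv n) = og_coev n"
| "translate Wire = og_wire"
| "translate (Green m n a) = og_green m n a"
| "translate (Red m n a) = og_red m n a"
| "translate Had = og_had"
| "translate Diam = og_diam"
| "translate (g \<bullet> f) = og_comp (translate g) (translate f)"
| "translate (f \<otimes> g) = og_tens (translate f) (translate g)"

text \<open>Endomorphisms of \<open>S_zx\<close> induced by a map of nodes fixing \<open>White\<close> and \<open>DiamN\<close>, and its
  arrow-reversing automorphism.\<close>

primrec map_arrow :: "(zx_node \<Rightarrow> zx_node) \<Rightarrow> zx_arrow \<Rightarrow> zx_arrow" where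
  "map_arrow r WhiteLoop = WhiteLoop"
| "map_arrow r (ToWhite x) = ToWhite (r x)"
| "map_arrow r (FromWhite x) = FromWhite (r x)"

primrec reverse_arrow :: "zx_arrow \<Rightarrow> zx_arrow" where
  "reverse_arrow WhiteLoop = WhiteLoop"
| "reverse_arrow (ToWhite x) = FromWhite x"
| "reverse_arrow (FromWhite x) = ToWhite x"

primrec exchange_node :: "zx_node \<Rightarrow> zx_node" where
  "exchange_node White = White"
| "exchange_node (GreenN a) = RedN a"
| "exchange_node (RedN a) = GreenN a"
| "exchange_node HadN = HadN"
| "exchange_node DiamN = DiamN"

primrec negate_node :: "zx_node \<Rightarrow> zx_node" where
  "negate_node White = White"
| "negate_node (GreenN a) = GreenN (- a)"
| "negate_node (RedN a) = RedN (- a)"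
| "negate_node HadN = HadN"
| "negate_node DiamN = DiamN"

definition og_relabel :: "(zx_node \<Rightarrow> zx_node) \<Rightarrow> ograph \<Rightarrow> ograph" where
  "og_relabel r f =
     f \<lparr> apex := \<lparr> shape = shape (apex f),
                  over = (r \<circ> fst (over (apex f)), map_arrow r \<circ> snd (over (apex f))) \<rparr> \<rparr>"

text \<open>Swapping inputs and outputs reverses all arcs as well, so that the swapped
  \<open>m\<close>-to-\<open>n\<close> spider is again a basic open graph, namely the \<open>n\<close>-to-\<open>m\<close> spider.\<close>

definition og_swap :: "ograph \<Rightarrow> ograph" where
  "og_swap f =
     \<lparr> ins = outs f, outs = ins f,
       apex = \<lparr> shape = (shape (apex f)) \<lparr> tail := head (shape (apex f)), head := tail (shape (apex f)) \<rparr>,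
                over = (fst (over (apex f)), reverse_arrow \<circ> snd (over (apex f))) \<rparr>,
       inp = outp f, outp = inp f \<rparr>"

definition og_dag :: "ograph \<Rightarrow> ograph" where
  "og_dag f = og_relabel negate_node (og_swap f)"


section \<open>Spans of cospans\<close>

record span =
  sdom :: ograph
  scod :: ograph
  sapex :: ograph
  sleft :: smap
  sright :: smap

definition cospan_map :: "ograph \<Rightarrow> ograph \<Rightarrow> smap \<Rightarrow> bool" where
  "cospan_map f g h \<longleftrightarrow>
     open_graph f \<and> open_graph g \<and> ins f = ins g \<and> outs f = outs g \<and>
     slice_hom (apex f) (apex g) h \<and>
     (\<forall>i\<in>{1..ins f}. fst h (inp f i) = inp g i) \<and>
     (\<forall>j\<in>{1..outs f}. fst h (outp f j) = outp g j)"

definition cospan_iso :: "ograph \<Rightarrow> ograph \<Rightarrow> smap \<Rightarrow> bool" where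
  "cospan_iso f g h \<longleftrightarrow> cospan_map f g h \<and> slice_iso (apex f) (apex g) h"

definition span_of_cospans :: "span \<Rightarrow> bool" where
  "span_of_cospans S \<longleftrightarrow>
     cospan_map (sapex S) (sdom S) (sleft S) \<and> cospan_map (sapex S) (scod S) (sright S)"

definition pullback :: "sgraph \<Rightarrow> sgraph \<Rightarrow> smap \<Rightarrow> smap \<Rightarrow> sgraph" where
  "pullback X Y h k =
     \<lparr> shape =
         \<lparr> verts = {prod_encode (x, y) | x y. x \<in> verts (shape X) \<and> y \<in> verts (shape Y) \<and> fst h x = fst k y},
           arcs = {prod_encode (d, e) | d e. d \<in> arcs (shape X) \<and> e \<in> arcs (shape Y) \<and> snd h d = snd k e},
           tail = (\<lambda>p. case prod_decode p of (d, e) \<Rightarrow> prod_encode (tail (shape X) d, tail (shape Y) e)),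
           head = (\<lambda>p. case prod_decode p of (d, e) \<Rightarrow> prod_encode (head (shape X) d, head (shape Y) e)) \<rparr>,
       over = (\<lambda>p. fst (over X) (fst (prod_decode p)), \<lambda>p. snd (over X) (fst (prod_decode p))) \<rparr>"

definition vcomp :: "span \<Rightarrow> span \<Rightarrow> span" where
  "vcomp T S =
     \<lparr> sdom = sdom S, scod = scod T,
       sapex = \<lparr> ins = ins (sapex S), outs = outs (sapex S),
                 apex = pullback (apex (sapex S)) (apex (sapex T)) (sright S) (sleft T),
                 inp = (\<lambda>i. prod_encode (inp (sapex S) i, inp (sapex T) i)),
                 outp = (\<lambda>j. prod_encode (outp (sapex S) j, outp (sapex T) j)) \<rparr>,
       sleft = (\<lambda>p. fst (sleft S) (fst (prod_decode p)), \<lambda>p. snd (sleft S) (fst (prod_decode p))),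
       sright = (\<lambda>p. fst (sright T) (snd (prod_decode p)), \<lambda>p. snd (sright T) (snd (prod_decode p))) \<rparr>"

definition sum_smap :: "smap \<Rightarrow> smap \<Rightarrow> smap" where
  "sum_smap h k = (sum_map (\<lambda>x. inl (fst h x)) (\<lambda>y. inr (fst k y)),
                   sum_map (\<lambda>x. inl (snd h x)) (\<lambda>y. inr (snd k y)))"

definition hcomp :: "span \<Rightarrow> span \<Rightarrow> span" where
  "hcomp T S =
     \<lparr> sdom = og_comp (sdom T) (sdom S), scod = og_comp (scod T) (scod S),
       sapex = og_comp (sapex T) (sapex S),
       sleft = (glue (sdom T) (sdom S) \<circ> fst (sum_smap (sleft S) (sleft T)),
                snd (sum_smap (sleft S) (sleft T))),
       sright = (glue (scod T) (scod S) \<circ> fst (sum_smap (sright S) (sright T)),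
                 snd (sum_smap (sright S) (sright T))) \<rparr>"

definition span_tens :: "span \<Rightarrow> span \<Rightarrow> span" where
  "span_tens S T =
     \<lparr> sdom = og_tens (sdom S) (sdom T), scod = og_tens (scod S) (scod T),
       sapex = og_tens (sapex S) (sapex T),
       sleft = sum_smap (sleft S) (sleft T), sright = sum_smap (sright S) (sright T) \<rparr>"

definition basic_span :: "ograph \<Rightarrow> ograph \<Rightarrow> span" where
  "basic_span f g =
     (let m = ins f; n = outs f in
      \<lparr> sdom = f, scod = g,
        sapex = \<lparr> ins = m, outs = n, apex = N_zx (m + n), inp = id, outp = (\<lambda>j. m + j) \<rparr>,
        sleft = (\<lambda>v. if v \<le> m then inp f v else outp f (v - m), id),
        sright = (\<lambda>v. if v \<le> m then inp g v else outp g (v - m), id) \<rparr>)"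

definition span_relabel :: "(zx_node \<Rightarrow> zx_node) \<Rightarrow> span \<Rightarrow> span" where
  "span_relabel r S = S \<lparr> sdom := og_relabel r (sdom S), scod := og_relabel r (scod S),
                          sapex := og_relabel r (sapex S) \<rparr>"

definition span_swap :: "span \<Rightarrow> span" where
  "span_swap S = S \<lparr> sdom := og_swap (sdom S), scod := og_swap (scod S), sapex := og_swap (sapex S) \<rparr>"

definition span_turn :: "span \<Rightarrow> span" where
  "span_turn S = S \<lparr> sdom := scod S, scod := sdom S, sleft := sright S, sright := sleft S \<rparr>"


section \<open>The generated sub-bicategory and its quotient category\<close>

text \<open>Composition by pushout, and the basic open graphs themselves, are only determined up to
  isomorphism of cospans. The sub-bicategory is therefore taken to be closed under isomorphic
  1-cells and to contain the invertible 2-cells between isomorphic 1-cells; these include all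
  structural 2-cells (identities, associators, unitors, those of the symmetric monoidal and
  of the compact structure).\<close>

inductive zx_cell1 :: "ograph \<Rightarrow> bool" where
  wire: "zx_cell1 og_wire"
| green: "zx_cell1 (og_green m n a)"
| red: "zx_cell1 (og_red m n a)"
| had: "zx_cell1 og_had"
| diam: "zx_cell1 og_diam"
| ident: "zx_cell1 (og_id n)"
| braid: "zx_cell1 (og_braid m n)"
| ev: "zx_cell1 (og_ev n)"
| coev: "zx_cell1 (og_coev n)"
| comp: "zx_cell1 f \<Longrightarrow> zx_cell1 g \<Longrightarrow> outs f = ins g \<Longrightarrow> zx_cell1 (og_comp g f)"
| tens: "zx_cell1 f \<Longrightarrow> zx_cell1 g \<Longrightarrow> zx_cell1 (og_tens f g)"
| iso: "zx_cell1 f \<Longrightarrow> cospan_iso f g h \<Longrightarrow> zx_cell1 g"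

inductive basic_cell2 :: "span \<Rightarrow> bool" where
  relation: "basic_relation s t \<Longrightarrow> basic_cell2 (basic_span (translate s) (translate t))"
| wire: "basic_cell2 (basic_span og_wire (og_id 1))"
| exchange: "basic_cell2 S \<Longrightarrow> basic_cell2 (span_relabel exchange_node S)"
| swap: "basic_cell2 S \<Longrightarrow> basic_cell2 (span_swap S)"
| turn: "basic_cell2 S \<Longrightarrow> basic_cell2 (span_turn S)"

text \<open>A 2-cell is a class of spans with the same domain and codomain: rule \<open>same_class\<close> makes
  \<open>zx_cell2\<close> a union of such classes.\<close>

inductive zx_cell2 :: "span \<Rightarrow> bool" where
  basic: "basic_cell2 S \<Longrightarrow> zx_cell2 S"
| iso: "zx_cell1 (sdom S) \<Longrightarrow> zx_cell1 (scod S)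
    \<Longrightarrow> cospan_iso (sapex S) (sdom S) (sleft S) \<Longrightarrow> cospan_iso (sapex S) (scod S) (sright S)
    \<Longrightarrow> zx_cell2 S"
| vertical: "zx_cell2 S \<Longrightarrow> zx_cell2 T \<Longrightarrow> scod S = sdom T \<Longrightarrow> zx_cell2 (vcomp T S)"
| horizontal: "zx_cell2 S \<Longrightarrow> zx_cell2 T \<Longrightarrow> outs (sdom S) = ins (sdom T) \<Longrightarrow> zx_cell2 (hcomp T S)"
| tensor: "zx_cell2 S \<Longrightarrow> zx_cell2 T \<Longrightarrow> zx_cell2 (span_tens S T)"
| same_class: "zx_cell2 S \<Longrightarrow> span_of_cospans T \<Longrightarrow> sdom T = sdom S \<Longrightarrow> scod T = scod S \<Longrightarrow> zx_cell2 T"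

definition cell_class :: "ograph \<Rightarrow> ograph set" where
  "cell_class f = {g. \<exists>S. zx_cell2 S \<and> sdom S = f \<and> scod S = g}"

definition norm_zx :: "(nat, ograph set) dagger_compact_data" where
  "norm_zx = \<lparr> Obj = UNIV,
               Hom = (\<lambda>m n. {cell_class f | f. zx_cell1 f \<and> ins f = m \<and> outs f = n}),
               Ident = (\<lambda>n. cell_class (og_id n)),
               Cmp = lift2 cell_class og_comp,
               Unit = 0,
               TObj = (+),
               TArr = lift2 cell_class og_tens,
               Brd = (\<lambda>m n. cell_class (og_braid m n)),
               Eval = (\<lambda>n. cell_class (og_ev n)),
               Coev = (\<lambda>n. cell_class (og_coev n)),
               Dag = lift1 cell_class og_dag \<rparr>"

definition interprets_generators :: "(zx_term set \<Rightarrow> ograph set) \<Rightarrow> bool" where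
  "interprets_generators E \<longleftrightarrow>
     E (zx_class Wire) = cell_class og_wire \<and>
     (\<forall>m n a. E (zx_class (Green m n a)) = cell_class (og_green m n a)) \<and>
     (\<forall>m n b. E (zx_class (Red m n b)) = cell_class (og_red m n b)) \<and>
     E (zx_class Had) = cell_class og_had \<and>
     E (zx_class Diam) = cell_class og_diam"

end

theory Submission
  imports Defs "HOL-Library.Multiset"
begin

text \<open>The functor is determined on terms, and it is full because every generated open graph is
  isomorphic to the translation of a term. It is well defined since the structural laws of \<open>zx\<close>
  translate to isomorphisms of open graphs; the two bending rules, which reverse arcs, follow from
  the other relations. For faithfulness it suffices that terms with isomorphic translations are
  equal in \<open>zx\<close>. An open graph is read back as a path sum: every vertex becomes a wire, every node
  and every arc a multiplication operator on these wires, and the input and output maps become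
  phase-free green diagrams. The operators commute because the green spiders form a special
  commutative Frobenius algebra, so the path sum is an invariant of the graph; it is compatible
  with gluing because phase-free green diagrams turn pushouts of finite functions into equations.
  Hence the path sum of the translation of a term is the term itself.\<close>

section \<open>The arrows of zx as a quotient of terms\<close>

text \<open>Only transitivity makes faithfulness hard. A chain of 2-cells passes through open
  graphs, and the two steps that meet at one graph may read it as translations of different terms,
  so such terms have to be equal in \<open>zx\<close>. One Frobenius algebra suffices for this,
  since a red spider is a green one with a Hadamard on each leg: the Hadamards go onto the arcs and
  only the green algebra acts on wires. Its spider rule also fuses nodes joined by several legs with
  no diamond left over, so that merging wires along a pushout is exact and produces no scalar.
  Directions are the remaining obstacle. Bending a leg of a spider turns an arc round, hence is no
  isomorphism of open graphs; and swapping inputs and outputs of a graph keeps phases although the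
  dagger negates them. The former is met by the smaller congruence \<open>zx_cong\<close>, the
  latter by closing the relations under negation of all phases.\<close>

inductive zx_cong :: "zx_term \<Rightarrow> zx_term \<Rightarrow> bool" where
  basic: "basic_relation s t \<Longrightarrow> zx_cong s t"
| permute: "zx_cong ((Id p \<otimes> Braid 1 1 \<otimes> Id q) \<bullet> Green m (p + (2 + q)) a) (Green m (p + (2 + q)) a)"
| wire: "zx_cong Wire (Id 1)"
| exchange: "zx_cong s t \<Longrightarrow> zx_cong (exchange s) (exchange t)"
| dagger: "zx_cong s t \<Longrightarrow> zx_cong (dag s) (dag t)"
| refl: "typed t m n \<Longrightarrow> zx_cong t t"
| sym: "zx_cong s t \<Longrightarrow> zx_cong t s"
| trans: "zx_cong s t \<Longrightarrow> zx_cong t u \<Longrightarrow> zx_cong s u"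
| comp_cong: "zx_cong f f' \<Longrightarrow> zx_cong g g' \<Longrightarrow> typed f m k \<Longrightarrow> typed g k n
    \<Longrightarrow> zx_cong (g \<bullet> f) (g' \<bullet> f')"
| tens_cong: "zx_cong f f' \<Longrightarrow> zx_cong g g' \<Longrightarrow> zx_cong (f \<otimes> g) (f' \<otimes> g')"
| comp_id_left: "typed f m n \<Longrightarrow> zx_cong (Id n \<bullet> f) f"
| comp_id_right: "typed f m n \<Longrightarrow> zx_cong (f \<bullet> Id m) f"
| comp_assoc: "typed f m k \<Longrightarrow> typed g k l \<Longrightarrow> typed h l n
    \<Longrightarrow> zx_cong ((h \<bullet> g) \<bullet> f) (h \<bullet> g \<bullet> f)"
| tens_id: "zx_cong (Id m \<otimes> Id n) (Id (m + n))"
| tens_comp: "typed f m k \<Longrightarrow> typed g k n \<Longrightarrow> typed f' m' k' \<Longrightarrow> typed g' k' n'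
    \<Longrightarrow> zx_cong ((g \<bullet> f) \<otimes> (g' \<bullet> f')) ((g \<otimes> g') \<bullet> (f \<otimes> f'))"
| tens_assoc: "typed f m n \<Longrightarrow> typed f' m' n' \<Longrightarrow> typed f'' m'' n''
    \<Longrightarrow> zx_cong ((f \<otimes> f') \<otimes> f'') (f \<otimes> f' \<otimes> f'')"
| tens_unit_left: "typed f m n \<Longrightarrow> zx_cong (Id 0 \<otimes> f) f"
| tens_unit_right: "typed f m n \<Longrightarrow> zx_cong (f \<otimes> Id 0) f"
| braid_natural: "typed f m n \<Longrightarrow> typed f' m' n'
    \<Longrightarrow> zx_cong (Braid n n' \<bullet> (f \<otimes> f')) ((f' \<otimes> f) \<bullet> Braid m m')"
| braid_braid: "zx_cong (Braid n m \<bullet> Braid m n) (Id (m + n))"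
| hexagon: "zx_cong (Braid m (n + k)) ((Id n \<otimes> Braid m k) \<bullet> (Braid m n \<otimes> Id k))"
| snake: "zx_cong ((Ev n \<otimes> Id n) \<bullet> (Id n \<otimes> Cv n)) (Id n)"
| ev_braid: "zx_cong (Ev n \<bullet> Braid n n) (Ev n)"
| ev_tens: "zx_cong (Ev (m + n)) ((Ev m \<otimes> Ev n) \<bullet> ((Id m \<otimes> Braid n m) \<otimes> Id n))"

text \<open>A computed partial type: simplification can evaluate it, and it marks ill-typed terms by
  \<open>None\<close>, which the quotient below needs.\<close>

primrec ty :: "zx_term \<Rightarrow> (nat \<times> nat) option" where
  "ty (Id n) = Some (n, n)"
| "ty (Braid m n) = Some (m + n, n + m)"
| "ty (Ev n) = Some (n + n, 0)"
| "ty (Cv n) = Some (0, n + n)"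
| "ty Wire = Some (1, 1)"
| "ty (Green m n a) = Some (m, n)"
| "ty (Red m n a) = Some (m, n)"
| "ty Had = Some (1, 1)"
| "ty Diam = Some (0, 0)"
| "ty (g \<bullet> f) = (case ty f of None \<Rightarrow> None | Some (m, k) \<Rightarrow>
     (case ty g of None \<Rightarrow> None | Some (k', n) \<Rightarrow> if k = k' then Some (m, n) else None))"
| "ty (f \<otimes> g) = (case ty f of None \<Rightarrow> None | Some (m, n) \<Rightarrow>
     (case ty g of None \<Rightarrow> None | Some (m', n') \<Rightarrow> Some (m + m', n + n')))"

lemma typed_iff_ty: "typed t m n \<longleftrightarrow> ty t = Some (m, n)"
proof
  show "typed t m n \<Longrightarrow> ty t = Some (m, n)" by (induction rule: typed.induct) auto
  have "\<forall>m n. ty t = Some (m, n) \<longrightarrow> typed t m n"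
  proof (induction t)
    case Wire show ?case using typed.intros(5) by auto
  next
    case (Had) show ?case using typed.intros(8) by auto
  qed (auto intro: typed.intros split: option.splits if_splits)
  then show "ty t = Some (m, n) \<Longrightarrow> typed t m n" by blast
qed

lemma ty_dag [simp]: "ty (dag t) = map_option (\<lambda>(m, n). (n, m)) (ty t)"
  by (induction t) (auto split: option.splits)

lemma ty_exchange [simp]: "ty (exchange t) = ty t"
  by (induction t) (auto split: option.splits)

lemma ty_hads [simp]: "ty (hads n) = Some (n, n)"
  by (induction n) auto

lemma ty_basic_relation: "basic_relation s t \<Longrightarrow> \<exists>m n. ty s = Some (m, n) \<and> ty t = Some (m, n)"
  by (induction rule: basic_relation.induct) (auto simp: add.assoc)

lemma ty_zx_cong: "zx_cong s t \<Longrightarrow> \<exists>m n. ty s = Some (m, n) \<and> ty t = Some (m, n)"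
  by (induction rule: zx_cong.induct) (auto dest: ty_basic_relation simp: typed_iff_ty)

definition arr_eq :: "zx_term \<Rightarrow> zx_term \<Rightarrow> bool" where
  "arr_eq s t \<longleftrightarrow> zx_cong s t \<or> ty s = None \<and> ty t = None"

lemma ty_arr_eq: "arr_eq s t \<Longrightarrow> ty s = ty t"
  by (auto simp: arr_eq_def dest: ty_zx_cong)

lemma arr_eqI: "ty s = ty t \<Longrightarrow> (ty s \<noteq> None \<Longrightarrow> zx_cong s t) \<Longrightarrow> arr_eq s t"
  by (auto simp: arr_eq_def)

lemma arr_eq_cong: "arr_eq s t \<Longrightarrow> ty s \<noteq> None \<Longrightarrow> zx_cong s t"
  by (auto simp: arr_eq_def)

text \<open>Ill-typed terms form one extra class, an absorbing error element. This makes
  composition and tensor total and their associativity unconditional.\<close>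

quotient_type arr = zx_term / arr_eq
proof (rule equivpI)
  show "reflp arr_eq"
    by (rule reflpI, rule arr_eqI) (auto simp flip: typed_iff_ty intro: zx_cong.refl)
  show "symp arr_eq" by (auto simp: symp_def arr_eq_def intro: zx_cong.sym)
  show "transp arr_eq"
    by (rule transpI) (auto simp: arr_eq_def dest: ty_zx_cong intro: zx_cong.trans)
qed

lift_definition Ty :: "arr \<Rightarrow> (nat \<times> nat) option" is ty by (rule ty_arr_eq)

lift_definition acomp :: "arr \<Rightarrow> arr \<Rightarrow> arr"  (infixr "\<odot>" 70) is Comp
proof (rule arr_eqI)
  fix g g' f f' assume eq: "arr_eq g g'" "arr_eq f f'"
  show "ty (g \<bullet> f) = ty (g' \<bullet> f')" using eq[THEN ty_arr_eq] by (auto split: option.splits)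
  assume "ty (g \<bullet> f) \<noteq> None"
  then obtain m k n where "ty f = Some (m, k)" "ty g = Some (k, n)"
    by (auto split: option.splits if_splits)
  then show "zx_cong (g \<bullet> f) (g' \<bullet> f')"
    using eq by (intro zx_cong.comp_cong[of f f' g g' m k n] arr_eq_cong) (auto simp: typed_iff_ty)
qed

lift_definition atens :: "arr \<Rightarrow> arr \<Rightarrow> arr"  (infixr "\<oplus>" 75) is Tens
proof (rule arr_eqI)
  fix g g' f f' assume eq: "arr_eq g g'" "arr_eq f f'"
  show "ty (g \<otimes> f) = ty (g' \<otimes> f')" using eq[THEN ty_arr_eq] by (auto split: option.splits)
  assume "ty (g \<otimes> f) \<noteq> None"
  then show "zx_cong (g \<otimes> f) (g' \<otimes> f')"
    using eq by (intro zx_cong.tens_cong arr_eq_cong) (auto split: option.splits)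
qed

lift_definition dg :: "arr \<Rightarrow> arr" is dag
  by (rule arr_eqI) (auto dest: ty_arr_eq intro!: zx_cong.dagger arr_eq_cong)

lift_definition Idt :: "nat \<Rightarrow> arr" is Id .
lift_definition Br :: "nat \<Rightarrow> nat \<Rightarrow> arr" is Braid .
lift_definition Cap :: "nat \<Rightarrow> arr" is Ev .
lift_definition Cup :: "nat \<Rightarrow> arr" is Cv .
lift_definition Gr :: "nat \<Rightarrow> nat \<Rightarrow> phase \<Rightarrow> arr" is Green .
lift_definition Rd :: "nat \<Rightarrow> nat \<Rightarrow> phase \<Rightarrow> arr" is Red .
lift_definition Hd :: arr is Had .
lift_definition Dm :: arr is Diam .
lift_definition Hds :: "nat \<Rightarrow> arr" is hads .

section \<open>Structural laws and basic relations as equations of arrows\<close>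

lemma arr_eq_refl [simp]: "arr_eq t t"
  using arr.abs_eq_iff by blast

lemma Ty_gen [simp]:
  "Ty (Idt n) = Some (n, n)" "Ty (Br m n) = Some (m + n, n + m)" "Ty (Cap n) = Some (n + n, 0)"
  "Ty (Cup n) = Some (0, n + n)" "Ty (Gr m n a) = Some (m, n)" "Ty (Rd m n a) = Some (m, n)"
  "Ty Hd = Some (1, 1)" "Ty Dm = Some (0, 0)" "Ty (Hds n) = Some (n, n)"
  by (transfer, simp)+

lemma Ty_comp [simp]:
  "Ty (g \<odot> f) = (case Ty f of None \<Rightarrow> None | Some (m, k) \<Rightarrow>
     (case Ty g of None \<Rightarrow> None | Some (k', n) \<Rightarrow> if k = k' then Some (m, n) else None))"
  by transfer simp

lemma Ty_tens [simp]:
  "Ty (f \<oplus> g) = (case Ty f of None \<Rightarrow> None | Some (m, n) \<Rightarrow>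
     (case Ty g of None \<Rightarrow> None | Some (m', n') \<Rightarrow> Some (m + m', n + n')))"
  by transfer simp

lemma Ty_dg [simp]: "Ty (dg f) = map_option (\<lambda>(m, n). (n, m)) (Ty f)"
  by transfer simp

lemma dg_simps [simp]:
  "dg (Idt n) = Idt n" "dg (Br m n) = Br n m" "dg (Cap n) = Cup n" "dg (Cup n) = Cap n"
  "dg (Gr m n a) = Gr n m (- a)" "dg (Rd m n a) = Rd n m (- a)" "dg Hd = Hd" "dg Dm = Dm"
  "dg (g \<odot> f) = dg f \<odot> dg g" "dg (f \<oplus> g) = dg f \<oplus> dg g"
  by (transfer, simp)+

lemma dag_dag [simp]: "dag (dag t) = t" by (induction t) auto

lemma dg_dg [simp]: "dg (dg f) = f"
  by transfer simp

lemma acomp_assoc: "(h \<odot> g) \<odot> f = h \<odot> g \<odot> f"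
  by transfer (rule arr_eqI, auto intro!: zx_cong.comp_assoc simp: typed_iff_ty split: option.splits if_splits)

lemma atens_assoc: "(f \<oplus> g) \<oplus> h = f \<oplus> g \<oplus> h"
  by transfer (rule arr_eqI, auto simp flip: typed_iff_ty split: option.splits,
      (rule zx_cong.tens_assoc; assumption))

lemma Idt_comp [simp]: "Ty f = Some (m, n) \<Longrightarrow> Idt n \<odot> f = f"
  by transfer (rule arr_eqI, auto intro!: zx_cong.comp_id_left simp: typed_iff_ty)

lemma comp_Idt [simp]: "Ty f = Some (m, n) \<Longrightarrow> f \<odot> Idt m = f"
  by transfer (rule arr_eqI, auto intro!: zx_cong.comp_id_right simp: typed_iff_ty)

lemma I0_tens [simp]: "Idt 0 \<oplus> f = f"
  by transfer (rule arr_eqI, auto intro!: zx_cong.tens_unit_left simp: typed_iff_ty split: option.splits)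

lemma tens_I0 [simp]: "f \<oplus> Idt 0 = f"
  by transfer (rule arr_eqI, auto intro!: zx_cong.tens_unit_right simp: typed_iff_ty split: option.splits)

lemma Idt_tens_Idt: "Idt m \<oplus> Idt n = Idt (m + n)"
  by transfer (rule arr_eqI, auto intro!: zx_cong.tens_id)

lemma Idt_tens_Idt_left: "Idt m \<oplus> Idt n \<oplus> f = Idt (m + n) \<oplus> f"
  by (simp flip: atens_assoc Idt_tens_Idt)

text \<open>Typing of one pair is enough: if the other pair does not compose, both sides are the
  error class. With no typing at all the left side could be well typed and the right side not,
  because only sums of arities would have to match.\<close>

lemma tens_comp:
  assumes "Ty f = Some (m, k)" "Ty g = Some (k, n)"
  shows "(g \<oplus> g') \<odot> (f \<oplus> f') = (g \<odot> f) \<oplus> (g' \<odot> f')"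
proof (cases "\<exists>m' k' n'. Ty f' = Some (m', k') \<and> Ty g' = Some (k', n')")
  case True
  then obtain m' k' n' where "Ty f' = Some (m', k')" "Ty g' = Some (k', n')" by blast
  with assms show ?thesis
    by transfer (simp add: arr_eq_def zx_cong.tens_comp[THEN zx_cong.sym] typed_iff_ty)
next
  case False
  with assms have "Ty ((g \<oplus> g') \<odot> (f \<oplus> f')) = None" "Ty ((g \<odot> f) \<oplus> (g' \<odot> f')) = None"
    by (auto split: option.splits)
  then show ?thesis by transfer (simp add: arr_eq_def)
qed

text \<open>Both sides are ill-typed together, since \<open>k + n = k' + n\<close> forces
  \<open>k = k'\<close>. It can therefore serve as a rewrite rule without side conditions.\<close>

lemma comp_tens_Idt: "(g \<oplus> Idt n) \<odot> (f \<oplus> Idt n) = (g \<odot> f) \<oplus> Idt n"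
proof -
  have Idt: "Idt n \<odot> Idt n = Idt n" by simp
  show ?thesis
  proof (cases "\<exists>m k l. Ty f = Some (m, k) \<and> Ty g = Some (k, l)")
    case True then show ?thesis using tens_comp Idt by fastforce
  next
    case False
    then have "Ty ((g \<oplus> Idt n) \<odot> (f \<oplus> Idt n)) = None" "Ty ((g \<odot> f) \<oplus> Idt n) = None"
      by (auto split: option.splits)
    then show ?thesis by transfer (simp add: arr_eq_def)
  qed
qed

lemma comp_Idt_tens: "(Idt n \<oplus> g) \<odot> (Idt n \<oplus> f) = Idt n \<oplus> (g \<odot> f)"
  by (subst tens_comp[of _ n n _ n]) simp_all

lemma slide:
  assumes "Ty f = Some (m, n)" "Ty g = Some (m', n')"
  shows "(f \<oplus> Idt n') \<odot> (Idt m \<oplus> g) = f \<oplus> g" "(Idt n \<oplus> g) \<odot> (f \<oplus> Idt m') = f \<oplus> g"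
  using assms by (simp_all add: tens_comp[where k = n] tens_comp[where k = m])

lemma Br_natural:
  "Ty f = Some (m, n) \<Longrightarrow> Ty f' = Some (m', n') \<Longrightarrow> Br n n' \<odot> (f \<oplus> f') = (f' \<oplus> f) \<odot> Br m m'"
  by transfer (rule arr_eqI, auto intro!: zx_cong.braid_natural simp: typed_iff_ty)

lemma Br_Br [simp]: "Br n m \<odot> Br m n = Idt (m + n)"
  by transfer (rule arr_eqI, auto intro!: zx_cong.braid_braid)

lemma Br_hexagon: "Br m (n + k) = (Idt n \<oplus> Br m k) \<odot> (Br m n \<oplus> Idt k)"
  by transfer (rule arr_eqI, auto intro!: zx_cong.hexagon)

lemma Br_hexagon': "Br (n + k) m = (Br n m \<oplus> Idt k) \<odot> (Idt n \<oplus> Br k m)"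
  using arg_cong[OF Br_hexagon[of m n k], of dg] by simp

lemma snake: "(Cap n \<oplus> Idt n) \<odot> (Idt n \<oplus> Cup n) = Idt n"
  by transfer (rule arr_eqI, auto intro!: zx_cong.snake)

lemma snake': "(Idt n \<oplus> Cap n) \<odot> (Cup n \<oplus> Idt n) = Idt n"
  using arg_cong[OF snake[of n], of dg] by simp

lemma Cap_Br: "Cap n \<odot> Br n n = Cap n"
  by transfer (rule arr_eqI, auto intro!: zx_cong.ev_braid)

text \<open>The hexagon with two zero arguments makes \<open>Br m 0\<close> idempotent, and an
  invertible idempotent is an identity.\<close>

lemma Br_0_right [simp]: "Br m 0 = Idt m"
proof -
  have "Br m 0 = Br m 0 \<odot> Br m 0" using Br_hexagon[of m 0 0] by simp
  then have "Br 0 m \<odot> Br m 0 = Br 0 m \<odot> Br m 0 \<odot> Br m 0" by simp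
  also have "\<dots> = (Br 0 m \<odot> Br m 0) \<odot> Br m 0" by (simp only: acomp_assoc)
  finally show ?thesis by simp
qed

lemma Br_0_left [simp]: "Br 0 m = Idt m"
  using arg_cong[OF Br_0_right[of m], of dg] by (simp del: Br_0_right)

lemma spider:
  "k \<ge> 1 \<Longrightarrow> (Idt n \<oplus> Gr (k + p) q b) \<odot> (Gr m (n + k) a \<oplus> Idt p) = Gr (m + p) (n + q) (a + b)"
  by transfer (simp add: arr_eq_def zx_cong.basic basic_relation.spider)

lemma spider':
  assumes "k \<ge> 1"
  shows "(Gr (n + k) m a \<oplus> Idt p) \<odot> (Idt n \<oplus> Gr q (k + p) b) = Gr (n + q) (m + p) (a + b)"
  using arg_cong[OF spider[OF assms, of n p q "- b" m "- a"], of dg] by (simp add: add.commute)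

lemma Gr_Br_out: "(Idt p \<oplus> Br 1 1 \<oplus> Idt q) \<odot> Gr m (p + (2 + q)) a = Gr m (p + (2 + q)) a"
  by transfer (use zx_cong.permute in \<open>simp add: arr_eq_def\<close>)

lemma Gr_Br_in: "Gr (p + (2 + q)) m a \<odot> (Idt p \<oplus> Br 1 1 \<oplus> Idt q) = Gr (p + (2 + q)) m a"
  using arg_cong[OF Gr_Br_out[of p q m "- a"], of dg] by simp

lemma Gr_cup: "Gr 0 2 0 = Cup 1"
  by transfer (use basic_relation.cup zx_cong.basic in \<open>simp add: arr_eq_def\<close>)

lemma Gr_cap: "Gr 2 0 0 = Cap 1"
  using arg_cong[OF Gr_cup, of dg] by simp

lemma Rd_cup: "Rd 0 2 0 = Cup 1"
proof transfer
  show "arr_eq (Red 0 2 0) (Cv 1)"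
    using zx_cong.exchange[OF zx_cong.basic[OF basic_relation.cup]] by (simp add: arr_eq_def)
qed

lemma Gr_Idt: "Gr 1 1 0 = Idt 1"
  by transfer (use basic_relation.trivial_spider zx_cong.basic in \<open>simp add: arr_eq_def\<close>)

lemma Rd_Idt: "Rd 1 1 0 = Idt 1"
proof transfer
  show "arr_eq (Red 1 1 0) (Id 1)"
    using zx_cong.exchange[OF zx_cong.basic[OF basic_relation.trivial_spider]] by (simp add: arr_eq_def)
qed

lemma Hds_simps [simp]: "Hds 0 = Idt 0" "Hds (Suc n) = Hd \<oplus> Hds n"
  by (transfer, simp)+

lemma color_change: "Hds n \<odot> Gr m n a \<odot> Hds m = Rd m n a"
  by transfer (simp add: arr_eq_def zx_cong.basic basic_relation.color_change)

lemma diamond_arr: "Rd 1 0 0 \<odot> Gr 0 1 0 = Dm"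
  by transfer (use basic_relation.diamond zx_cong.basic in \<open>simp add: arr_eq_def\<close>)

lemma diamond_arr': "Gr 1 0 0 \<odot> Rd 0 1 0 = Dm"
  using arg_cong[OF diamond_arr, of dg] by simp

section \<open>Finite functions as phase-free green diagrams\<close>

text \<open>Pushes tensoring with identities into composites, so that diagrams become right-nested
  sequences of layers.\<close>

lemmas layers = comp_tens_Idt[symmetric] comp_Idt_tens[symmetric] atens_assoc acomp_assoc
  Idt_tens_Idt Idt_tens_Idt_left

abbreviation Wr :: arr where "Wr \<equiv> Idt (Suc 0)"
abbreviation Sw :: arr where "Sw \<equiv> Br (Suc 0) (Suc 0)"
abbreviation Mu :: arr where "Mu \<equiv> Gr (Suc (Suc 0)) (Suc 0) 0"
abbreviation Et :: arr where "Et \<equiv> Gr 0 (Suc 0) 0"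

lemma slide':
  assumes "Ty f = Some (m, n)" "Ty g = Some (m', n')"
  shows "(f \<oplus> Idt n') \<odot> (Idt m \<oplus> g) = (Idt n \<oplus> g) \<odot> (f \<oplus> Idt m')"
    "(f \<oplus> Idt n') \<odot> (Idt m \<oplus> g) \<odot> r = (Idt n \<oplus> g) \<odot> (f \<oplus> Idt m') \<odot> r"
  using slide[OF assms] by (simp_all flip: acomp_assoc)

text \<open>For rewriting in a layered diagram, where a local equation appears beside identities and
  in front of a remaining composite \<open>r\<close>.\<close>

lemma in_context:
  assumes "f = g"
  shows "(f \<oplus> Idt b) \<odot> r = (g \<oplus> Idt b) \<odot> r" "(Idt a \<oplus> f) \<odot> r = (Idt a \<oplus> g) \<odot> r"
    "f \<odot> r = g \<odot> r" "Idt a \<oplus> f = Idt a \<oplus> g" "f \<oplus> Idt b = g \<oplus> Idt b"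
  using assms by simp_all

section \<open>The commutative monoid of phase-free green spiders\<close>

lemma Gr_Wr [simp]: "Gr (Suc 0) (Suc 0) 0 = Wr"
  using Gr_Idt by simp

lemma Rd_Wr [simp]: "Rd (Suc 0) (Suc 0) 0 = Wr"
  using Rd_Idt by simp

lemma Mu_Et: "Mu \<odot> (Et \<oplus> Wr) = Wr"
  using spider[of 1 0 1 1 0 0 0] by (simp add: numeral_2_eq_2)

lemma Mu_assoc: "Mu \<odot> (Mu \<oplus> Wr) = Mu \<odot> (Wr \<oplus> Mu)"
  using spider[of 1 0 1 1 0 2 0] spider'[of 1 1 1 0 0 2 0] by (simp add: numeral_2_eq_2)

lemma Mu_Sw: "Mu \<odot> Sw = Mu"
  using Gr_Br_in[of 0 0 1 0] by (simp add: numeral_2_eq_2)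

lemma Sw_Et: "Sw \<odot> (Et \<oplus> Wr) = Wr \<oplus> Et" 
  using Br_natural[of Et 0 1 Wr 1 1] by simp

lemma Sw_Mu: "Sw \<odot> (Idt 1 \<oplus> Mu) = (Mu \<oplus> Wr) \<odot> (Wr \<oplus> Sw) \<odot> (Sw \<oplus> Wr)"
  using Br_natural[of Wr 1 1 Mu 2 1] Br_hexagon[of 1 1 1] by (simp add: numeral_2_eq_2)

lemma Mu_S': "Sw \<odot> (Mu \<oplus> Wr) = (Wr \<oplus> Mu) \<odot> (Sw \<oplus> Wr) \<odot> (Wr \<oplus> Sw)"
  using Br_natural[of Mu 2 1 Wr 1 1] Br_hexagon'[of 1 1 1] by (simp add: numeral_2_eq_2)

text \<open>Naturality of the braiding at \<open>Sw\<close> itself, unfolded by the hexagon.\<close>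

lemma yang_baxter: "(Wr \<oplus> Sw) \<odot> (Sw \<oplus> Wr) \<odot> (Wr \<oplus> Sw) = (Sw \<oplus> Wr) \<odot> (Wr \<oplus> Sw) \<odot> (Sw \<oplus> Wr)"
  using Br_natural[of Wr 1 1 Sw 2 2] Br_hexagon[of 1 1 1] by (simp add: numeral_2_eq_2 acomp_assoc)

text \<open>Multiplies the first of \<open>k + 1\<close> wires into number \<open>x\<close>, counted
  from zero, of the other \<open>k\<close>; swaps carry it there. The equation at width
  \<open>0\<close> is a dummy that makes the recursion total.\<close>

fun Merge :: "nat \<Rightarrow> nat \<Rightarrow> arr" where
  "Merge (Suc k) 0 = Mu \<oplus> Idt k"
| "Merge (Suc k) (Suc j) = (Wr \<oplus> Merge k j) \<odot> (Sw \<oplus> Idt k)"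
| "Merge 0 j = Idt 0"

lemma Ty_Merge [simp]: "x < k \<Longrightarrow> Ty (Merge k x) = Some (Suc k, k)"
  by (induction k x rule: Merge.induct) (auto simp: numeral_2_eq_2)

lemma Merge_unit: "x < k \<Longrightarrow> Merge k x \<odot> (Et \<oplus> Idt k) = Idt k"
proof (induction k x rule: Merge.induct)
  case (1 k)
  show ?case using in_context(5)[OF Mu_Et, of k] by (simp add: layers)
next
  case (2 k j)
  have "Merge (Suc k) (Suc j) \<odot> (Et \<oplus> Idt (Suc k)) = (Wr \<oplus> Merge k j) \<odot> (Wr \<oplus> Et \<oplus> Idt k)"
    using in_context(5)[OF Sw_Et, of k] by (simp add: layers)
  also have "\<dots> = Wr \<oplus> (Merge k j \<odot> (Et \<oplus> Idt k))" by (simp only: comp_Idt_tens)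
  also have "\<dots> = Idt (Suc k)" using 2 by (simp add: Idt_tens_Idt)
  finally show ?case .
qed simp

lemma Merge_assoc: "x < k \<Longrightarrow> Merge k x \<odot> (Mu \<oplus> Idt k) = Merge k x \<odot> (Wr \<oplus> Merge k x)"
proof (induction k x rule: Merge.induct)
  case (1 k)
  show ?case using in_context(5)[OF Mu_assoc, of k] by (simp add: layers)
next
  case (2 k j)
  then have IH: "Merge k j \<odot> (Mu \<oplus> Idt k) = Merge k j \<odot> (Wr \<oplus> Merge k j)" by simp
  have "Merge (Suc k) (Suc j) \<odot> (Mu \<oplus> Idt (Suc k))
    = (Wr \<oplus> Merge k j) \<odot> (Wr \<oplus> Mu \<oplus> Idt k) \<odot> (Sw \<oplus> Idt (Suc k)) \<odot> (Wr \<oplus> Sw \<oplus> Idt k)"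
    using in_context(5)[OF Mu_S', of k] by (simp add: layers)
  also have "\<dots> = (Wr \<oplus> Merge k j) \<odot> (Wr \<oplus> Wr \<oplus> Merge k j) \<odot> (Sw \<oplus> Idt (Suc k)) \<odot> (Wr \<oplus> Sw \<oplus> Idt k)"
    using in_context(2)[OF IH, of "Suc 0" "(Sw \<oplus> Idt (Suc k)) \<odot> (Wr \<oplus> Sw \<oplus> Idt k)"] by (simp add: layers)
  also have "\<dots> = (Wr \<oplus> Merge k j) \<odot> (Sw \<oplus> Idt k) \<odot> (Wr \<oplus> Wr \<oplus> Merge k j) \<odot> (Wr \<oplus> Sw \<oplus> Idt k)"
    using 2 slide'[of Sw 2 2 "Merge k j" "Suc k" k] by (simp add: layers numeral_2_eq_2)
  also have "\<dots> = Merge (Suc k) (Suc j) \<odot> (Wr \<oplus> Merge (Suc k) (Suc j))" by (simp add: layers)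
  finally show ?case .
qed simp

text \<open>Two wires on their way to targets may be exchanged: for equal targets by associativity
  and commutativity of \<open>Mu\<close>, otherwise by sliding past each other. All later
  commutation of operators rests on this.\<close>

lemma Merge_comm: "x < k \<Longrightarrow> y < k \<Longrightarrow> Merge k x \<odot> (Wr \<oplus> Merge k y) \<odot> (Sw \<oplus> Idt k) = Merge k y \<odot> (Wr \<oplus> Merge k x)"
proof (induction k arbitrary: x y)
  case (Suc k)
  \<comment> \<open>One wire lands on the first strand and the other travels on. The mirrored case
    follows from this one by precomposing with the swap.\<close>
  have zero: "Merge (Suc k) 0 \<odot> (Wr \<oplus> Merge (Suc k) (Suc z)) \<odot> (Sw \<oplus> Idt (Suc k))
      = Merge (Suc k) (Suc z) \<odot> (Wr \<oplus> Merge (Suc k) 0)" if z: "z < k" for z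
  proof -
    have "Merge (Suc k) 0 \<odot> (Wr \<oplus> Merge (Suc k) (Suc z)) \<odot> (Sw \<oplus> Idt (Suc k))
      = (Mu \<oplus> Idt k) \<odot> (Idt 2 \<oplus> Merge k z) \<odot> (Wr \<oplus> Sw \<oplus> Idt k) \<odot> (Sw \<oplus> Idt (Suc k))"
      by (simp add: layers numeral_2_eq_2)
    also have "\<dots> = (Wr \<oplus> Merge k z) \<odot> (Mu \<oplus> Idt (Suc k)) \<odot> (Wr \<oplus> Sw \<oplus> Idt k) \<odot> (Sw \<oplus> Idt (Suc k))"
      using z slide'[of Mu 2 1 "Merge k z" "Suc k" k] by (simp add: numeral_2_eq_2)
    also have "\<dots> = (Wr \<oplus> Merge k z) \<odot> (Sw \<oplus> Idt k) \<odot> (Wr \<oplus> Mu \<oplus> Idt k)"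
      using in_context(5)[OF Sw_Mu, of k] by (simp add: layers)
    also have "\<dots> = Merge (Suc k) (Suc z) \<odot> (Wr \<oplus> Merge (Suc k) 0)" by (simp add: layers)
    finally show ?thesis .
  qed
  have SS: "(Sw \<oplus> Idt n) \<odot> (Sw \<oplus> Idt n) = Idt (Suc (Suc n))" for n
    by (simp add: comp_tens_Idt Idt_tens_Idt)
  consider "x = 0" "y = 0" | z where "x = 0" "y = Suc z" "z < k" | z where "x = Suc z" "y = 0" "z < k"
    | x' y' where "x = Suc x'" "y = Suc y'" "x' < k" "y' < k"
    using Suc.prems by (cases x; cases y) auto
  then show ?case
  proof cases
    case 1
    have "Mu \<odot> (Wr \<oplus> Mu) \<odot> (Sw \<oplus> Wr) = Mu \<odot> (Wr \<oplus> Mu)"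
      by (metis Mu_assoc Mu_Sw acomp_assoc comp_tens_Idt)
    from in_context(5)[OF this, of k] 1 show ?thesis by (simp add: layers)
  next
    case 2 then show ?thesis using zero by simp
  next
    case 3
    have "Merge (Suc k) x \<odot> (Wr \<oplus> Merge (Suc k) y) \<odot> (Sw \<oplus> Idt (Suc k))
      = Merge (Suc k) 0 \<odot> (Wr \<oplus> Merge (Suc k) (Suc z)) \<odot> (Sw \<oplus> Idt (Suc k)) \<odot> (Sw \<oplus> Idt (Suc k))"
      using in_context(3)[OF zero[OF 3(3)], of "Sw \<oplus> Idt (Suc k)"] 3 by (simp only: acomp_assoc)
    then show ?thesis using 3 SS[of "Suc k"] by (simp)
  next
    case 4
    have "Merge (Suc k) x \<odot> (Wr \<oplus> Merge (Suc k) y) \<odot> (Sw \<oplus> Idt (Suc k))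
      = (Wr \<oplus> Merge k x') \<odot> (Sw \<oplus> Idt k) \<odot> (Idt 2 \<oplus> Merge k y') \<odot> (Wr \<oplus> Sw \<oplus> Idt k) \<odot> (Sw \<oplus> Idt (Suc k))"
      using 4 by (simp add: layers numeral_2_eq_2)
    also have "\<dots> = (Wr \<oplus> Merge k x') \<odot> (Idt 2 \<oplus> Merge k y') \<odot> (Sw \<oplus> Idt (Suc k)) \<odot> (Wr \<oplus> Sw \<oplus> Idt k) \<odot> (Sw \<oplus> Idt (Suc k))"
      using 4 slide'[of Sw 2 2 "Merge k y'" "Suc k" k] by (simp add: numeral_2_eq_2)
    \<comment> \<open>Both wires cross the first strand; Yang-Baxter moves their mutual swap behind
      it, where the induction hypothesis applies.\<close>
    also have "\<dots> = (Wr \<oplus> Merge k x') \<odot> (Idt 2 \<oplus> Merge k y') \<odot> (Wr \<oplus> Sw \<oplus> Idt k) \<odot> (Sw \<oplus> Idt (Suc k)) \<odot> (Wr \<oplus> Sw \<oplus> Idt k)"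
      using in_context(5)[OF yang_baxter, of k] by (simp add: layers)
    also have "\<dots> = (Wr \<oplus> Merge k y') \<odot> (Idt 2 \<oplus> Merge k x') \<odot> (Sw \<oplus> Idt (Suc k)) \<odot> (Wr \<oplus> Sw \<oplus> Idt k)"
      using in_context(2)[OF Suc.IH[OF 4(3,4)], of "Suc 0" "(Sw \<oplus> Idt (Suc k)) \<odot> (Wr \<oplus> Sw \<oplus> Idt k)"] by (simp add: layers numeral_2_eq_2)
    also have "\<dots> = (Wr \<oplus> Merge k y') \<odot> (Sw \<oplus> Idt k) \<odot> (Idt 2 \<oplus> Merge k x') \<odot> (Wr \<oplus> Sw \<oplus> Idt k)"
      using 4 slide'[of Sw 2 2 "Merge k x'" "Suc k" k] by (simp add: numeral_2_eq_2)
    also have "\<dots> = Merge (Suc k) y \<odot> (Wr \<oplus> Merge (Suc k) x)"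
      using 4 by (simp add: layers numeral_2_eq_2)
    finally show ?thesis .
  qed
qed simp

primrec Units :: "nat \<Rightarrow> arr" where
  "Units 0 = Idt 0"
| "Units (Suc k) = Et \<oplus> Units k"

lemma Ty_Units [simp]: "Ty (Units k) = Some (0, k)"
  by (induction k) auto

lemma Units_add: "Units (k + l) = Units k \<oplus> Units l"
  by (induction k) (simp_all add: atens_assoc)

text \<open>A list with entries below \<open>k\<close> stands for a function from its index set to
  \<open>{0..<k}\<close>. Wire \<open>j\<close> of the result is the product of the inputs that the
  function sends to \<open>j\<close>, a unit if there are none.\<close>

primrec Fuse :: "nat \<Rightarrow> nat list \<Rightarrow> arr" where
  "Fuse k [] = Units k"
| "Fuse k (x # xs) = Merge k x \<odot> (Wr \<oplus> Fuse k xs)"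

lemma Ty_Fuse [simp]: "\<forall>x\<in>set xs. x < k \<Longrightarrow> Ty (Fuse k xs) = Some (length xs, k)"
  by (induction xs) auto

lemma Fuse_Units: "\<forall>y\<in>set ys. y < l \<Longrightarrow> Fuse l ys \<odot> Units (length ys) = Units l"
proof (induction ys)
  case (Cons y ys)
  have "Fuse l (y # ys) \<odot> Units (length (y # ys)) = Merge l y \<odot> (Wr \<oplus> Fuse l ys) \<odot> (Et \<oplus> Units (length ys))"
    by (simp add: acomp_assoc)
  also have "\<dots> = Merge l y \<odot> (Et \<oplus> Units l)"
    using Cons by (simp add: tens_comp[where m = 0 and k = "Suc 0" and n = "Suc 0"])
  also have "\<dots> = Merge l y \<odot> (Et \<oplus> Idt l) \<odot> Units l"
    using slide(1)[of Et 0 1 "Units l" 0 l] by simp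
  also have "\<dots> = Units l"
    using Cons.prems in_context(3)[OF Merge_unit] by (simp add: acomp_assoc)
  finally show ?case .
qed simp

text \<open>If \<open>x\<close> is the head position, associativity of the product applies;
  otherwise commutativity lets the new wire overtake the head wire.\<close>

lemma Fuse_Merge:
  "\<lbrakk>\<forall>y\<in>set ys. y < l; x < length ys\<rbrakk> \<Longrightarrow> Fuse l ys \<odot> Merge (length ys) x = Merge l (ys ! x) \<odot> (Wr \<oplus> Fuse l ys)"
proof (induction ys arbitrary: x)
  case (Cons y ys)
  then have y: "y < l" and ys: "\<forall>y\<in>set ys. y < l" by auto
  let ?k = "length ys"
  have T: "Ty (Fuse l ys) = Some (?k, l)" using ys by simp
  show ?case
  proof (cases x)
    case 0
    have "Fuse l (y # ys) \<odot> Merge (Suc ?k) 0 = Merge l y \<odot> (Wr \<oplus> Fuse l ys) \<odot> (Mu \<oplus> Idt ?k)"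
      by (simp add: acomp_assoc)
    also have "\<dots> = Merge l y \<odot> (Mu \<oplus> Idt l) \<odot> (Idt 2 \<oplus> Fuse l ys)"
      using slide'[OF _ T, of Mu 2 1] by (simp add: numeral_2_eq_2)
    also have "\<dots> = Merge l y \<odot> (Wr \<oplus> Merge l y) \<odot> (Idt 2 \<oplus> Fuse l ys)"
      using in_context(3)[OF Merge_assoc[OF y]] by (simp add: acomp_assoc)
    also have "\<dots> = Merge l y \<odot> (Wr \<oplus> Fuse l (y # ys))" by (simp add: layers numeral_2_eq_2)
    finally show ?thesis using 0 by simp
  next
    case (Suc z)
    then have z: "z < ?k" using Cons.prems by simp
    then have z': "ys ! z < l" using ys by simp
    have "Fuse l (y # ys) \<odot> Merge (Suc ?k) (Suc z) = Merge l y \<odot> (Wr \<oplus> (Fuse l ys \<odot> Merge ?k z)) \<odot> (Sw \<oplus> Idt ?k)"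
      by (simp add: layers)
    also have "\<dots> = Merge l y \<odot> (Wr \<oplus> Merge l (ys ! z)) \<odot> (Idt 2 \<oplus> Fuse l ys) \<odot> (Sw \<oplus> Idt ?k)"
      using Cons.IH[OF ys z] by (simp add: layers numeral_2_eq_2)
    also have "\<dots> = Merge l y \<odot> (Wr \<oplus> Merge l (ys ! z)) \<odot> (Sw \<oplus> Idt l) \<odot> (Idt 2 \<oplus> Fuse l ys)"
      using slide'[OF _ T, of Sw 2 2] by (simp add: numeral_2_eq_2)
    also have "\<dots> = Merge l (ys ! z) \<odot> (Wr \<oplus> Merge l y) \<odot> (Idt 2 \<oplus> Fuse l ys)"
      using in_context(3)[OF Merge_comm[OF y z']] by (simp add: acomp_assoc)
    also have "\<dots> = Merge l (ys ! z) \<odot> (Wr \<oplus> Fuse l (y # ys))" by (simp add: layers numeral_2_eq_2)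
    finally show ?thesis using Suc by simp
  qed
qed simp

text \<open>Functoriality: the list on the right encodes the composite function, and
  \<open>Fuse_Merge\<close> carries one wire at a time through the outer diagram.\<close>

lemma Fuse_Fuse:
  "\<lbrakk>\<forall>y\<in>set ys. y < l; \<forall>x\<in>set xs. x < length ys\<rbrakk> \<Longrightarrow> Fuse l ys \<odot> Fuse (length ys) xs = Fuse l (map ((!) ys) xs)"
proof (induction xs)
  case Nil then show ?case by (simp add: Fuse_Units)
next
  case (Cons x xs)
  then have "Fuse l ys \<odot> Fuse (length ys) (x # xs) = Merge l (ys ! x) \<odot> (Wr \<oplus> Fuse l ys) \<odot> (Wr \<oplus> Fuse (length ys) xs)"
    using in_context(3)[OF Fuse_Merge[of ys l x]] by (simp add: acomp_assoc)
  also have "\<dots> = Fuse l (map ((!) ys) (x # xs))" using Cons by (simp add: comp_Idt_tens)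
  finally show ?case .
qed

lemma Merge_left: "x < k \<Longrightarrow> Merge (k + l) x = Merge k x \<oplus> Idt l"
  by (induction k x rule: Merge.induct) (simp_all add: layers)

text \<open>A wire with its target in the right block first crosses the \<open>k\<close> wires of
  the left block.\<close>

lemma Merge_right: "y < l \<Longrightarrow> Merge (k + l) (k + y) = (Idt k \<oplus> Merge l y) \<odot> (Br (Suc 0) k \<oplus> Idt l)"
proof (induction k)
  case (Suc k)
  have "Merge (Suc k + l) (Suc k + y) = (Wr \<oplus> Idt k \<oplus> Merge l y) \<odot> (Wr \<oplus> Br 1 k \<oplus> Idt l) \<odot> (Sw \<oplus> Idt (k + l))"
    using Suc by (simp add: layers)
  also have "\<dots> = (Idt (Suc k) \<oplus> Merge l y) \<odot> (Br 1 (Suc k) \<oplus> Idt l)"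
    using Br_hexagon[of 1 1 k] by (simp add: layers)
  finally show ?case by simp
qed (simp add: Idt_tens_Idt)

lemma Fuse_right: "\<forall>y\<in>set ys. y < l \<Longrightarrow> Fuse (k + l) (map ((+) k) ys) = Units k \<oplus> Fuse l ys"
proof (induction ys)
  case (Cons y ys)
  have "Fuse (k + l) (map ((+) k) (y # ys)) = (Idt k \<oplus> Merge l y) \<odot> (Br 1 k \<oplus> Idt l) \<odot> (Wr \<oplus> Units k \<oplus> Fuse l ys)"
    using Cons by (simp add: Merge_right acomp_assoc)
  also have "(Br 1 k \<oplus> Idt l) \<odot> (Wr \<oplus> Units k \<oplus> Fuse l ys) = (Br 1 k \<odot> (Wr \<oplus> Units k)) \<oplus> Fuse l ys"
    using Cons.prems tens_comp[of "Wr \<oplus> Units k" 1 "Suc k" "Br 1 k" "Suc k" "Idt l" "Fuse l ys"] by (simp add: atens_assoc)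
  also have "Br 1 k \<odot> (Wr \<oplus> Units k) = Units k \<oplus> Wr"
    using Br_natural[of Wr 1 1 "Units k" 0 k] by simp
  also have "(Idt k \<oplus> Merge l y) \<odot> ((Units k \<oplus> Wr) \<oplus> Fuse l ys) = Units k \<oplus> (Merge l y \<odot> (Wr \<oplus> Fuse l ys))"
    using Cons.prems tens_comp[of "Units k" 0 k "Idt k" k "Merge l y" "Wr \<oplus> Fuse l ys"] by (simp add: atens_assoc)
  finally show ?case by simp
qed (simp add: Units_add)

text \<open>The list on the left encodes the disjoint union of two functions, with the second
  codomain shifted by the size of the first.\<close>

lemma Fuse_append:
  assumes ys: "\<forall>y\<in>set ys. y < l"
  shows "\<forall>x\<in>set xs. x < k \<Longrightarrow> Fuse (k + l) (xs @ map ((+) k) ys) = Fuse k xs \<oplus> Fuse l ys"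
proof (induction xs)
  case Nil then show ?case using Fuse_right[OF ys] by simp
next
  case (Cons x xs)
  then have "Fuse (k + l) ((x # xs) @ map ((+) k) ys) = (Merge k x \<oplus> Idt l) \<odot> ((Wr \<oplus> Fuse k xs) \<oplus> Fuse l ys)"
    by (simp add: Merge_left atens_assoc)
  also have "\<dots> = (Merge k x \<odot> (Wr \<oplus> Fuse k xs)) \<oplus> Fuse l ys"
    using Cons.prems ys tens_comp[of "Wr \<oplus> Fuse k xs" "Suc (length xs)" "Suc k" "Merge k x" k "Idt l" "Fuse l ys"] by simp
  finally show ?case by simp
qed

lemma Fuse_id: "Fuse k [0..<k] = Idt k"
proof (induction k)
  case (Suc k)
  have "Fuse (1 + k) ([0] @ map ((+) 1) [0..<k]) = Fuse 1 [0] \<oplus> Fuse k [0..<k]"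
    by (rule Fuse_append) auto
  moreover have "[0] @ map ((+) 1) [0..<k] = [0..<Suc k]" by (simp add: upt_conv_Cons map_Suc_upt[symmetric] del: upt_Suc)
  moreover have "Fuse 1 [0] = Wr"
    using spider'[of 1 1 1 0 0 0 0] by (simp add: numeral_2_eq_2)
  ultimately show ?case using Suc by (metis Idt_tens_Idt One_nat_def plus_1_eq_Suc)
qed simp

text \<open>Stated for arbitrary functions so that the entries of \<open>xs\<close> can be peeled
  off one by one; the braiding itself is the instance with two identities.\<close>

lemma Fuse_Br_gen:
  assumes ys: "\<forall>y\<in>set ys. y < n"
  shows "\<forall>x\<in>set xs. x < m \<Longrightarrow> Fuse (n + m) (map ((+) n) xs @ ys) = (Fuse n ys \<oplus> Fuse m xs) \<odot> Br (length xs) (length ys)"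
proof (induction xs)
  case Nil
  show ?case using Fuse_append[of "[]" m ys n] ys by simp
next
  case (Cons x xs)
  let ?p = "length xs" and ?q = "length ys"
  have x: "x < m" and xs: "\<forall>x\<in>set xs. x < m" using Cons.prems by auto
  note T = Ty_Fuse[OF xs] Ty_Fuse[OF ys]
  have "Fuse (n + m) (map ((+) n) (x # xs) @ ys)
     = (Idt n \<oplus> Merge m x) \<odot> (Br 1 n \<oplus> Idt m) \<odot> (Wr \<oplus> Fuse n ys \<oplus> Fuse m xs) \<odot> (Wr \<oplus> Br ?p ?q)"
    using Cons x by (simp add: Merge_right acomp_assoc comp_Idt_tens[symmetric])
  also have "(Br 1 n \<oplus> Idt m) \<odot> (Wr \<oplus> Fuse n ys \<oplus> Fuse m xs) \<odot> (Wr \<oplus> Br ?p ?q) = 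
      ((Br 1 n \<odot> (Wr \<oplus> Fuse n ys)) \<oplus> Fuse m xs) \<odot> (Wr \<oplus> Br ?p ?q)"
    using T tens_comp[of "Wr \<oplus> Fuse n ys" "Suc ?q" "Suc n" "Br 1 n" "Suc n" "Idt m" "Fuse m xs"]
    by (simp add: atens_assoc flip: acomp_assoc)
  also have "Br 1 n \<odot> (Wr \<oplus> Fuse n ys) = (Fuse n ys \<oplus> Wr) \<odot> Br 1 ?q"
    using Br_natural[of Wr 1 1 "Fuse n ys" ?q n] T by simp
  also have "((Fuse n ys \<oplus> Wr) \<odot> Br 1 ?q) \<oplus> Fuse m xs = (Fuse n ys \<oplus> Wr \<oplus> Fuse m xs) \<odot> (Br 1 ?q \<oplus> Idt ?p)"
    using T tens_comp[of "Br 1 ?q" "Suc ?q" "Suc ?q" "Fuse n ys \<oplus> Wr" "Suc n" "Fuse m xs" "Idt ?p"] by (simp add: atens_assoc)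
  also have "(Idt n \<oplus> Merge m x) \<odot> ((Fuse n ys \<oplus> Wr \<oplus> Fuse m xs) \<odot> (Br 1 ?q \<oplus> Idt ?p)) \<odot> (Wr \<oplus> Br ?p ?q)
      = (Fuse n ys \<oplus> (Merge m x \<odot> (Wr \<oplus> Fuse m xs))) \<odot> (Br 1 ?q \<oplus> Idt ?p) \<odot> (Wr \<oplus> Br ?p ?q)"
    using T tens_comp[of "Fuse n ys" ?q n "Idt n" n "Merge m x" "Wr \<oplus> Fuse m xs"] by (simp add: acomp_assoc[symmetric])
  also have "(Br 1 ?q \<oplus> Idt ?p) \<odot> (Wr \<oplus> Br ?p ?q) = Br (Suc ?p) ?q"
    using Br_hexagon'[of 1 ?p ?q] by simp
  finally show ?case by simp
qed

lemma Fuse_Br: "Fuse (n + m) (map ((+) n) [0..<m] @ [0..<n]) = Br m n"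
  using Fuse_Br_gen[of "[0..<n]" n "[0..<m]" m] by (simp add: Fuse_id Idt_tens_Idt)

section \<open>Pushouts of finite functions\<close>

abbreviation De :: arr where "De \<equiv> Gr (Suc 0) (Suc (Suc 0)) 0"
abbreviation Cu :: arr where "Cu \<equiv> Cup (Suc 0)"
abbreviation Ca :: arr where "Ca \<equiv> Cap (Suc 0)"

lemma comp_eq_tail:
  "f \<odot> g = h \<Longrightarrow> f \<odot> g \<odot> r = h \<odot> r"
  "f \<odot> g \<odot> g' = h \<Longrightarrow> f \<odot> g \<odot> g' \<odot> r = h \<odot> r"
  by (auto simp flip: acomp_assoc)

lemma De_eq: "De = (Wr \<oplus> Mu) \<odot> (Cu \<oplus> Wr)"
  using spider[of 1 1 1 1 0 0 0] Gr_cup by (simp add: numeral_2_eq_2)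

lemma Sw_Cu: "(Sw \<oplus> Wr) \<odot> (Wr \<oplus> Cu) = (Wr \<oplus> Sw) \<odot> (Cu \<oplus> Wr)"
proof -
  have "(Sw \<oplus> Wr) \<odot> (Wr \<oplus> Sw) \<odot> (Cu \<oplus> Wr) = Wr \<oplus> Cu"
    using Br_natural[of Cu 0 2 Wr 1 1] Br_hexagon'[of 1 1 1] by (simp add: numeral_2_eq_2 acomp_assoc)
  then have "(Sw \<oplus> Wr) \<odot> (Wr \<oplus> Cu) = (Sw \<oplus> Wr) \<odot> (Sw \<oplus> Wr) \<odot> (Wr \<oplus> Sw) \<odot> (Cu \<oplus> Wr)" by simp
  also have "\<dots> = ((Sw \<odot> Sw) \<oplus> Wr) \<odot> (Wr \<oplus> Sw) \<odot> (Cu \<oplus> Wr)" by (simp add: acomp_assoc flip: comp_tens_Idt del: Br_Br)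
  finally show ?thesis by (simp add: Idt_tens_Idt)
qed

text \<open>Copying is multiplication with one leg bent by a cup (\<open>De_eq\<close>, a spider
  fusion); the bend is carried through the swaps of \<open>Merge\<close>.\<close>

lemma dg_Merge: "x < k \<Longrightarrow> dg (Merge k x) = (Wr \<oplus> Merge k x) \<odot> (Cu \<oplus> Idt k)"
proof (induction k x rule: Merge.induct)
  case (1 k)
  show ?case using in_context(5)[OF De_eq, of k] by (simp add: layers)
next
  case (2 k j)
  then have IH: "dg (Merge k j) = (Wr \<oplus> Merge k j) \<odot> (Cu \<oplus> Idt k)" and j: "j < k" by auto
  have "dg (Merge (Suc k) (Suc j)) = (Sw \<oplus> Idt k) \<odot> (Idt 2 \<oplus> Merge k j) \<odot> (Wr \<oplus> Cu \<oplus> Idt k)"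
    using IH by (simp add: layers numeral_2_eq_2)
  also have "\<dots> = (Idt 2 \<oplus> Merge k j) \<odot> (Sw \<oplus> Idt (Suc k)) \<odot> (Wr \<oplus> Cu \<oplus> Idt k)"
    using slide'[of Sw 2 2 "Merge k j" "Suc k" k] j by (simp add: numeral_2_eq_2)
  also have "\<dots> = (Idt 2 \<oplus> Merge k j) \<odot> (Wr \<oplus> Sw \<oplus> Idt k) \<odot> (Cu \<oplus> Idt (Suc k))"
    using in_context(5)[OF Sw_Cu, of k] by (simp add: layers)
  also have "\<dots> = (Wr \<oplus> Merge (Suc k) (Suc j)) \<odot> (Cu \<oplus> Idt (Suc k))"
    by (simp add: layers numeral_2_eq_2)
  finally show ?case .
qed simp

text \<open>The Frobenius law for functions: since copying is a bent multiplication, this is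
  \<open>Fuse_Merge\<close> beside one end of a cup.\<close>

lemma Fuse_dg_Merge:
  assumes ys: "\<forall>y\<in>set ys. y < l" and x: "x < length ys"
  shows "(Wr \<oplus> Fuse l ys) \<odot> dg (Merge (length ys) x) = dg (Merge l (ys ! x)) \<odot> Fuse l ys"
proof -
  let ?k = "length ys"
  have z: "ys ! x < l" using ys x by simp
  have "(Wr \<oplus> Fuse l ys) \<odot> dg (Merge ?k x) = (Wr \<oplus> (Fuse l ys \<odot> Merge ?k x)) \<odot> (Cu \<oplus> Idt ?k)"
    using x by (simp add: dg_Merge layers)
  also have "\<dots> = (Wr \<oplus> Merge l (ys ! x)) \<odot> (Idt 2 \<oplus> Fuse l ys) \<odot> (Cu \<oplus> Idt ?k)"
    using Fuse_Merge[OF ys x] by (simp add: layers numeral_2_eq_2)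
  also have "\<dots> = (Wr \<oplus> Merge l (ys ! x)) \<odot> (Cu \<oplus> Idt l) \<odot> Fuse l ys"
    using slide'[of Cu 0 2 "Fuse l ys" ?k l] ys by simp
  also have "\<dots> = dg (Merge l (ys ! x)) \<odot> Fuse l ys" using z by (simp add: dg_Merge acomp_assoc)
  finally show ?thesis .
qed

lemma Merge_dg_Fuse:
  assumes ys: "\<forall>y\<in>set ys. y < l" and x: "x < length ys"
  shows "Merge (length ys) x \<odot> (Wr \<oplus> dg (Fuse l ys)) = dg (Fuse l ys) \<odot> Merge l (ys ! x)"
  using arg_cong[OF Fuse_dg_Merge[OF assms], of dg] by simp

text \<open>A permutation factors into one that fixes the first point, followed by the cycle that
  carries \<open>0\<close> to its image. The cycle is a braiding, hence unitary, and the other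
  factor is covered by induction.\<close>

lemma Fuse_unitary:
  "\<lbrakk>distinct xs; length xs = k; \<forall>x\<in>set xs. x < k\<rbrakk> \<Longrightarrow>
     dg (Fuse k xs) \<odot> Fuse k xs = Idt k \<and> Fuse k xs \<odot> dg (Fuse k xs) = Idt k"
proof (induction k arbitrary: xs)
  case (Suc k)
  then obtain j ys where xs: "xs = j # ys" by (cases xs) auto
  with Suc.prems have j: "j \<le> k" "j \<notin> set ys" "distinct ys" "length ys = k" "\<forall>y\<in>set ys. y < Suc k" by auto
  \<comment> \<open>The cycle that sends \<open>0\<close> to \<open>j\<close> and
    \<open>i + 1\<close> to \<open>i\<close> for \<open>i < j\<close>, and fixes everything beyond
    \<open>j\<close>.\<close>
  define sk where "sk = (map ((+) j) [0] @ [0..<j]) @ map ((+) (Suc j)) [0..<k - j]"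
  \<comment> \<open>The remaining values of the permutation with the gap at \<open>j\<close>
    closed.\<close>
  define zs where "zs = map (\<lambda>y. if y < j then y else y - 1) ys"
  have len: "length sk = Suc k" using j by (simp add: sk_def)
  have sk0: "sk ! 0 = j" by (simp add: sk_def)
  have sk1: "sk ! Suc i = (if i < j then i else Suc i)" if "i < k" for i
    using that by (auto simp: sk_def nth_append)
  have zs_less: "\<forall>z\<in>set zs. z < k"
  proof
    fix z assume "z \<in> set zs"
    then obtain y where "y \<in> set ys" "z = (if y < j then y else y - 1)" by (auto simp: zs_def)
    moreover have "y < Suc k" "y \<noteq> j" using \<open>y \<in> set ys\<close> j by auto
    ultimately show "z < k" using j(1) by (auto split: if_splits)
  qed
  have "inj_on (\<lambda>y. if y < j then y else y - 1) (set ys)"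
    using j(2) by (auto simp: inj_on_def split: if_splits) (metis Suc_pred less_Suc_eq_0_disj linorder_neqE_nat not_less_eq)+
  then have zs: "distinct zs" "length zs = k" using j by (simp_all add: zs_def distinct_map)
  have C: "Fuse (Suc k) sk = Br 1 j \<oplus> Idt (k - j)"
  proof -
    have "Fuse (Suc j + (k - j)) sk = Fuse (Suc j) (map ((+) j) [0] @ [0..<j]) \<oplus> Fuse (k - j) [0..<k - j]"
      unfolding sk_def by (rule Fuse_append) auto
    moreover have "Fuse (j + 1) (map ((+) j) [0..<1] @ [0..<j]) = Br 1 j" by (rule Fuse_Br)
    ultimately show ?thesis using j by (simp add: Fuse_id)
  qed
  have map_eq: "map ((!) sk) (0 # map Suc zs) = xs"
  proof -
    have "sk ! Suc (if y < j then y else y - 1) = y" if "y \<in> set ys" for y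
    proof -
      have "y \<noteq> j" "y < Suc k" using that j by auto
      then show ?thesis using j(1) by (subst sk1) (auto split: if_splits)
    qed
    then show ?thesis by (simp add: xs sk0 zs_def o_def map_idI)
  qed
  have "Fuse (Suc k) (0 # map Suc zs) = Wr \<oplus> Fuse k zs"
  proof -
    have "0 # map Suc zs = [0..<1] @ map ((+) 1) zs" by simp
    then show ?thesis using Fuse_append[OF zs_less, of "[0..<1]" 1] Fuse_id[of 1] by (simp only:) simp
  qed
  moreover have "Fuse (Suc k) sk \<odot> Fuse (Suc k) (0 # map Suc zs) = Fuse (Suc k) xs"
  proof -
    have "\<forall>y\<in>set sk. y < Suc k" using j by (auto simp: sk_def)
    then have "Fuse (Suc k) sk \<odot> Fuse (length sk) (0 # map Suc zs) = Fuse (Suc k) (map ((!) sk) (0 # map Suc zs))"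
      by (rule Fuse_Fuse) (use len zs_less in auto)
    then show ?thesis unfolding map_eq len .
  qed
  ultimately have Fuse: "Fuse (Suc k) xs = (Br 1 j \<oplus> Idt (k - j)) \<odot> (Wr \<oplus> Fuse k zs)" using C by simp
  note IH = Suc.IH[OF zs zs_less]
  have BB: "(Br j 1 \<oplus> Idt (k - j)) \<odot> (Br 1 j \<oplus> Idt (k - j)) = Idt (Suc k)"
    "(Br 1 j \<oplus> Idt (k - j)) \<odot> (Br j 1 \<oplus> Idt (k - j)) = Idt (Suc k)"
    using j by (simp_all add: comp_tens_Idt Idt_tens_Idt)
  have FF: "(Wr \<oplus> dg (Fuse k zs)) \<odot> (Wr \<oplus> Fuse k zs) = Idt (Suc k)" "(Wr \<oplus> Fuse k zs) \<odot> (Wr \<oplus> dg (Fuse k zs)) = Idt (Suc k)"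
    using IH by (simp_all add: comp_Idt_tens Idt_tens_Idt)
  have T: "Ty (Fuse k zs) = Some (k, k)" using zs_less zs by simp
  show ?case
    using FF comp_eq_tail(1)[OF BB(1)] BB(2) comp_eq_tail(1)[OF FF(2)] T j(1)
    by (simp add: Fuse acomp_assoc)
qed simp

text \<open>Specialness: two spiders joined by two legs fuse without a scalar, which is the spider
  rule with \<open>k = 2\<close>.\<close>

lemma Merge_dg_Merge: "x < k \<Longrightarrow> Merge k x \<odot> dg (Merge k x) = Idt k"
proof (induction k x rule: Merge.induct)
  case (1 k)
  have "Mu \<odot> De = Wr"
    using spider[of 2 0 0 1 0 1 0] by (simp add: numeral_2_eq_2)
  then show ?case by (simp add: comp_tens_Idt Idt_tens_Idt)
next
  case (2 k j)
  have "Merge (Suc k) (Suc j) \<odot> dg (Merge (Suc k) (Suc j)) = (Wr \<oplus> Merge k j) \<odot> ((Sw \<odot> Sw) \<oplus> Idt k) \<odot> (Wr \<oplus> dg (Merge k j))"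
    by (simp add: acomp_assoc flip: comp_tens_Idt del: Br_Br)
  then show ?case using 2 by (simp add: Idt_tens_Idt comp_Idt_tens)
qed simp

text \<open>The Frobenius law at the first two wires: multiplying a copy of one into the other has
  the same effect as merging both and copying the result. Cocommutativity removes the swap.\<close>

lemma Merge_merge_front: "Merge (Suc (Suc k)) (Suc 0) \<odot> dg (Merge (Suc (Suc k)) 0) = dg (Merge (Suc k) 0) \<odot> Merge (Suc k) 0"
proof -
  have 1: "Sw \<odot> De = De"
    using Gr_Br_out[of 0 0 1 0] by (simp add: numeral_2_eq_2)
  have 2: "(Wr \<oplus> Mu) \<odot> (De \<oplus> Wr) = De \<odot> Mu"
    using spider[of 1 1 1 1 0 1 0] spider[of 1 0 0 2 0 2 0] by (simp add: numeral_2_eq_2)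
  have "Merge (Suc (Suc k)) (Suc 0) \<odot> dg (Merge (Suc (Suc k)) 0) = (Wr \<oplus> Mu \<oplus> Idt k) \<odot> ((Sw \<odot> De) \<oplus> Idt (Suc k))"
    by (simp add: layers)
  then show ?thesis using in_context(5)[OF 2, of k] by (simp add: 1 layers)
qed

text \<open>Multiplying a copy of wire \<open>a\<close> into wire \<open>b\<close> amounts to
  identifying both wires by a quotient map and splitting them by its dagger. For
  \<open>a = b\<close> this is specialness; otherwise a permutation brings the wires to positions
  \<open>0\<close> and \<open>1\<close>, where \<open>Merge_merge_front\<close> applies.\<close>

lemma Merge_dg_Merge_merge:
  assumes "a < k" "b < k"
  shows "\<exists>l r. length r = k \<and> set r = {0..<l} \<and>
    (\<forall>x<k. \<forall>y<k. r ! x = r ! y \<longleftrightarrow> x = y \<or> x = a \<and> y = b \<or> x = b \<and> y = a) \<and>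
    Merge k b \<odot> dg (Merge k a) = dg (Fuse l r) \<odot> Fuse l r"
proof (cases "a = b")
  case True
  then show ?thesis using assms Merge_dg_Merge[of a k]
    by (intro exI[of _ k] exI[of _ "[0..<k]"]) (auto simp: Fuse_id)
next
  case False
  then obtain l where k: "k = Suc (Suc l)" using assms by (cases k; cases "k - 1") auto
  \<comment> \<open>\<open>t\<close> exchanges \<open>a\<close> with \<open>0\<close>; then
    \<open>s\<close> exchanges the image of \<open>b\<close> with \<open>1\<close> and leaves
    \<open>0\<close> alone, as \<open>a\<close> and \<open>b\<close> differ.\<close>
  define t where "t x = (if x = a then 0 else if x = 0 then a else x)" for x
  define s where "s x = (if x = t b then 1 else if x = 1 then t b else x)" for x
  define f where "f x = s (t x)" for x
  have inj: "f x = f y \<longleftrightarrow> x = y" for x y by (auto simp: f_def s_def t_def split: if_splits)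
  have f: "f a = 0" "f b = 1" using False by (auto simp: f_def s_def t_def split: if_splits)
  have less: "f x < k" if "x < k" for x using that assms k by (auto simp: f_def s_def t_def)
  have surj: "f ` {0..<k} = {0..<k}"
    by (rule endo_inj_surj) (auto simp: less inj_on_def inj)
  define g where "g = map f [0..<k]"
  have g: "distinct g" "length g = k" "\<forall>x\<in>set g. x < k" by (auto simp: g_def distinct_map inj_on_def inj less)
  have g_nth: "g ! a = 0" "g ! b = 1" using assms f by (auto simp: g_def)
  \<comment> \<open>The list \<open>0 # [0..<Suc l]\<close> sends \<open>0\<close> and
    \<open>1\<close> to \<open>0\<close> and lowers every other index by one. After \<open>g\<close>
    it identifies exactly \<open>a\<close> with \<open>b\<close>.\<close>
  define r where "r = map ((!) (0 # [0..<Suc l])) g"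
  note un = Fuse_unitary[OF g]
  have Tg: "Ty (Fuse k g) = Some (k, k)" using g by simp
  note TA = Ty_Merge[OF assms(1)] Ty_Merge[OF assms(2)]
  have r_nth: "r ! x = (if f x = 0 then 0 else f x - 1)" if "x < k" for x
    using that less[OF that] k by (auto simp: r_def g_def nth_Cons' simp del: upt_Suc)
  have WF: "(Wr \<oplus> Fuse k g) \<odot> (Wr \<oplus> dg (Fuse k g)) = Idt (Suc k)"
    using un by (simp add: comp_Idt_tens Idt_tens_Idt)
  have b: "Merge k b = dg (Fuse k g) \<odot> Merge k 1 \<odot> (Wr \<oplus> Fuse k g)"
  proof -
    have "Fuse k g \<odot> Merge k b = Merge k 1 \<odot> (Wr \<oplus> Fuse k g)"
      using Fuse_Merge[OF g(3), of b] g assms g_nth by simp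
    then have "dg (Fuse k g) \<odot> Fuse k g \<odot> Merge k b = dg (Fuse k g) \<odot> Merge k 1 \<odot> (Wr \<oplus> Fuse k g)" by simp
    then show ?thesis using un TA by (simp flip: acomp_assoc)
  qed
  have a: "dg (Merge k a) = (Wr \<oplus> dg (Fuse k g)) \<odot> dg (Merge k 0) \<odot> Fuse k g"
  proof -
    have "(Wr \<oplus> Fuse k g) \<odot> dg (Merge k a) = dg (Merge k 0) \<odot> Fuse k g"
      using Fuse_dg_Merge[OF g(3), of a] g assms g_nth by simp
    then have "(Wr \<oplus> dg (Fuse k g)) \<odot> (Wr \<oplus> Fuse k g) \<odot> dg (Merge k a) = (Wr \<oplus> dg (Fuse k g)) \<odot> dg (Merge k 0) \<odot> Fuse k g" by simp
    moreover have "(Wr \<oplus> dg (Fuse k g)) \<odot> (Wr \<oplus> Fuse k g) = Idt (Suc k)"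
      using un by (simp add: comp_Idt_tens Idt_tens_Idt)
    ultimately show ?thesis using TA by (simp flip: acomp_assoc)
  qed
  have X: "Merge (Suc l) 0 \<odot> Fuse k g = Fuse (Suc l) r"
  proof -
    have "Merge (Suc l) 0 = Fuse (Suc l) (0 # [0..<Suc l])"
      by (simp add: Fuse_id Idt_tens_Idt del: upt_Suc)
    moreover have "Fuse (Suc l) (0 # [0..<Suc l]) \<odot> Fuse (length (0 # [0..<Suc l])) g = Fuse (Suc l) r"
      unfolding r_def by (rule Fuse_Fuse) (use g k in \<open>auto simp del: upt_Suc\<close>)
    ultimately show ?thesis by (simp add: k del: upt_Suc)
  qed
  have TX: "Ty (dg (Merge k 0) \<odot> Fuse k g) = Some (k, Suc k)" using Tg k by (simp)
  have "Merge k b \<odot> dg (Merge k a) = dg (Fuse k g) \<odot> Merge k 1 \<odot> (Wr \<oplus> Fuse k g) \<odot> (Wr \<oplus> dg (Fuse k g)) \<odot> dg (Merge k 0) \<odot> Fuse k g"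
    by (simp only: a b acomp_assoc)
  also have "\<dots> = dg (Fuse k g) \<odot> Merge k 1 \<odot> dg (Merge k 0) \<odot> Fuse k g"
    using comp_eq_tail(1)[OF WF, of "dg (Merge k 0) \<odot> Fuse k g"] Idt_comp[OF TX] by (simp only: )
  also have "\<dots> = dg (Fuse k g) \<odot> dg (Merge (Suc l) 0) \<odot> Merge (Suc l) 0 \<odot> Fuse k g"
    using comp_eq_tail(1)[OF Merge_merge_front[of l], of "Fuse k g"] k by (simp only: acomp_assoc One_nat_def)
  also have "\<dots> = dg (Fuse (Suc l) r) \<odot> Fuse (Suc l) r"
    unfolding X[symmetric] by (simp only: dg_simps acomp_assoc)
  finally have D: "Merge k b \<odot> dg (Merge k a) = dg (Fuse (Suc l) r) \<odot> Fuse (Suc l) r" .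
  have "set r = (\<lambda>y. if y = 0 then 0 else y - 1) ` {0..<k}"
  proof -
    have "length r = k" using g by (simp add: r_def)
    then have "set r = (\<lambda>x. r ! x) ` {0..<k}" by (auto simp: set_conv_nth)
    also have "\<dots> = (\<lambda>y. if y = 0 then 0 else y - 1) ` f ` {0..<k}" by (auto simp: r_nth image_iff)
    finally show ?thesis by (simp add: surj)
  qed
  also have "\<dots> = {0..<Suc l}"
  proof
    show "{0..<Suc l} \<subseteq> (\<lambda>y. if y = 0 then 0 else y - 1) ` {0..<k}"
      using k by (auto intro!: image_eqI[of _ _ "Suc _"])
  qed (use k in auto)
  finally have "set r = {0..<Suc l}" .
  moreover have "r ! x = r ! y \<longleftrightarrow> x = y \<or> x = a \<and> y = b \<or> x = b \<and> y = a" if "x < k" "y < k" for x y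
  proof -
    have "r ! x = r ! y \<longleftrightarrow> f x = f y \<or> f x = 0 \<and> f y = 1 \<or> f x = 1 \<and> f y = 0"
      using that by (auto simp: r_nth split: if_splits)
    then show ?thesis using inj f by metis
  qed
  ultimately show ?thesis using D g by (intro exI[of _ "Suc l"] exI[of _ r]) (auto simp: r_def)
qed

text \<open>Base change: a backward function followed by a forward one is a forward one followed by
  a backward one, along the pushout. The pushout is expressed by a jointly surjective cocone whose
  kernel lies in the kernel of every other cocone \<open>\<theta>\<close>; kernels are enough, as
  later only the injectivity of an enumeration is derived from them. Induction on the span: the
  empty span gives the disjoint union, and each further pair identifies one point of either
  side.\<close>

lemma Fuse_dg_Fuse_pushout:
  assumes "length us = length vs" "\<forall>u\<in>set us. u < m" "\<forall>v\<in>set vs. v < n"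
  shows "\<exists>w p q. length p = m \<and> length q = n \<and> set p \<union> set q = {0..<w} \<and>
    (\<forall>i<length us. p ! (us ! i) = q ! (vs ! i)) \<and>
    (\<forall>\<theta> :: nat + nat \<Rightarrow> nat. (\<forall>i<length us. \<theta> (Inl (us ! i)) = \<theta> (Inr (vs ! i))) \<longrightarrow>
      (\<forall>x\<in>{..<m} <+> {..<n}. \<forall>y\<in>{..<m} <+> {..<n}.
        case_sum ((!) p) ((!) q) x = case_sum ((!) p) ((!) q) y \<longrightarrow> \<theta> x = \<theta> y)) \<and>
    Fuse n vs \<odot> dg (Fuse m us) = dg (Fuse w q) \<odot> Fuse w p"
  using assms
proof (induction us vs rule: list_induct2)
  case Nil
  let ?p = "[0..<m]" and ?q = "map ((+) m) [0..<n]"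
  have "Fuse (m + n) ?p = Idt m \<oplus> Units n" using Fuse_append[of "[]" n ?p m] by (simp add: Fuse_id)
  moreover have "Fuse (m + n) ?q = Units m \<oplus> Idt n" using Fuse_append[of "[0..<n]" n "[]" m] by (simp add: Fuse_id)
  moreover have "dg (Units m \<oplus> Idt n) \<odot> (Idt m \<oplus> Units n) = Units n \<odot> dg (Units m)"
    using slide[of "dg (Units m)" m 0 "Units n" 0 n] by simp
  moreover have "set ?p \<union> set ?q = {0..<m + n}"
    by (auto simp: image_iff)
  ultimately show ?case
    by (intro exI[of _ "m + n"] exI[of _ ?p] exI[of _ ?q]) (auto simp: )
next
  case (Cons u us v vs)
  then obtain w p q where len: "length p = m" "length q = n" and set: "set p \<union> set q = {0..<w}"
    and eq: "\<forall>i<length us. p ! (us ! i) = q ! (vs ! i)"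
    and univ: "\<And>\<theta> :: nat + nat \<Rightarrow> nat. \<lbrakk>\<forall>i<length us. \<theta> (Inl (us ! i)) = \<theta> (Inr (vs ! i))\<rbrakk> \<Longrightarrow>
      \<forall>x\<in>{..<m} <+> {..<n}. \<forall>y\<in>{..<m} <+> {..<n}.
        case_sum ((!) p) ((!) q) x = case_sum ((!) p) ((!) q) y \<longrightarrow> \<theta> x = \<theta> y"
    and Fuse: "Fuse n vs \<odot> dg (Fuse m us) = dg (Fuse w q) \<odot> Fuse w p" by auto
  have uv: "u < m" "v < n" and uvs: "\<forall>u\<in>set us. u < m" "\<forall>v\<in>set vs. v < n" using Cons.prems by auto
  have pq: "\<forall>x\<in>set p. x < w" "\<forall>x\<in>set q. x < w" using set by auto
  define a where "a = p ! u"
  define b where "b = q ! v"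
  have ab: "a < w" "b < w" using pq uv len by (auto simp: a_def b_def)
  obtain l r where r: "length r = w" "set r = {0..<l}"
    "\<And>x y. x < w \<Longrightarrow> y < w \<Longrightarrow> r ! x = r ! y \<longleftrightarrow> x = y \<or> x = a \<and> y = b \<or> x = b \<and> y = a"
    "Merge w b \<odot> dg (Merge w a) = dg (Fuse l r) \<odot> Fuse l r"
    using Merge_dg_Merge_merge[OF ab] by blast
  let ?p = "map ((!) r) p" and ?q = "map ((!) r) q"
  let ?Q = "case_sum ((!) p) ((!) q)"
  have rl: "\<forall>x\<in>set r. x < l" using r by simp
  have "Fuse n (v # vs) \<odot> dg (Fuse m (u # us)) = Merge n v \<odot> (Wr \<oplus> (Fuse n vs \<odot> dg (Fuse m us))) \<odot> dg (Merge m u)"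
    by (simp add: layers)
  also have "\<dots> = Merge n v \<odot> (Wr \<oplus> dg (Fuse w q)) \<odot> (Wr \<oplus> Fuse w p) \<odot> dg (Merge m u)"
    by (simp add: Fuse layers)
  \<comment> \<open>In the pushout found so far the copy of wire \<open>u\<close> is a copy of wire
    \<open>a\<close>, and it will be multiplied into wire \<open>b\<close>: these two points have to
    be identified.\<close>
  also have "\<dots> = Merge n v \<odot> (Wr \<oplus> dg (Fuse w q)) \<odot> dg (Merge w a) \<odot> Fuse w p"
    using Fuse_dg_Merge[OF pq(1), of u] uv len by (simp add: a_def)
  also have "\<dots> = dg (Fuse w q) \<odot> Merge w b \<odot> dg (Merge w a) \<odot> Fuse w p"
    using comp_eq_tail(1)[OF Merge_dg_Fuse[OF pq(2), of v]] uv len by (simp add: b_def acomp_assoc)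
  also have "\<dots> = dg (Fuse w q) \<odot> dg (Fuse l r) \<odot> Fuse l r \<odot> Fuse w p"
    using comp_eq_tail(1)[OF r(4), of "Fuse w p"] by (simp add: acomp_assoc)
  also have "\<dots> = dg (Fuse l r \<odot> Fuse w q) \<odot> Fuse l r \<odot> Fuse w p" by (simp add: acomp_assoc)
  also have "Fuse l r \<odot> Fuse w q = Fuse l ?q" using Fuse_Fuse[OF rl, of q] r pq by simp
  also have "Fuse l r \<odot> Fuse w p = Fuse l ?p" using Fuse_Fuse[OF rl, of p] r pq by simp
  finally have FF: "Fuse n (v # vs) \<odot> dg (Fuse m (u # us)) = dg (Fuse l ?q) \<odot> Fuse l ?p" .
  have set': "set ?p \<union> set ?q = {0..<l}"
  proof -
    have "set ?p \<union> set ?q = (!) r ` {0..<w}" using set by auto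
    also have "\<dots> = set r" using r(1) by (auto simp: set_conv_nth)
    finally show ?thesis using r by simp
  qed
  have eq': "\<forall>i<length (u # us). ?p ! ((u # us) ! i) = ?q ! ((v # vs) ! i)"
  proof (intro allI impI)
    fix i assume i: "i < length (u # us)"
    show "?p ! ((u # us) ! i) = ?q ! ((v # vs) ! i)"
    proof (cases i)
      case 0 then show ?thesis using uv len r(3)[OF ab] by (simp add: a_def b_def)
    next
      case (Suc i')
      then have i': "i' < length us" using i by simp
      then have "us ! i' < m" "vs ! i' < n" using uvs Cons.hyps by auto
      then show ?thesis using Suc i' eq len by simp
    qed
  qed
  have univ': "\<theta> x = \<theta> y" if \<theta>: "\<forall>i<length (u # us). \<theta> (Inl ((u # us) ! i)) = \<theta> (Inr ((v # vs) ! i))"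
    and x: "x \<in> {..<m} <+> {..<n}" and y: "y \<in> {..<m} <+> {..<n}"
    and Q: "case_sum ((!) ?p) ((!) ?q) x = case_sum ((!) ?p) ((!) ?q) y" for \<theta> :: "nat + nat \<Rightarrow> nat" and x y
  proof -
    have 0: "\<theta> (Inl u) = \<theta> (Inr v)" and "\<forall>i<length us. \<theta> (Inl (us ! i)) = \<theta> (Inr (vs ! i))"
      using \<theta> by (auto simp: nth_Cons' dest: spec[of _ 0] spec[of _ "Suc _"])
    note un = univ[OF this(2)]
    have *: "case_sum ((!) ?p) ((!) ?q) z = r ! ?Q z" "?Q z < w" if "z \<in> {..<m} <+> {..<n}" for z
      using that len pq by auto
    have uv': "Inl u \<in> {..<m} <+> {..<n}" "Inr v \<in> {..<m} <+> {..<n}" using uv by auto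
    from Q have "r ! ?Q x = r ! ?Q y" using * x y by simp
    then consider "?Q x = ?Q y" | "?Q x = ?Q (Inl u)" "?Q y = ?Q (Inr v)" | "?Q x = ?Q (Inr v)" "?Q y = ?Q (Inl u)"
      using r(3)[OF *(2)[OF x] *(2)[OF y]] by (auto simp: a_def b_def)
    then show ?thesis
    proof cases
      case 1 then show ?thesis using un x y by blast
    next
      case 2 then show ?thesis using un x y uv' 0 by metis
    next
      case 3 then show ?thesis using un x y uv' 0 by metis
    qed
  qed
  show ?case
    by (intro exI[of _ l] exI[of _ ?p] exI[of _ ?q] conjI FF set' eq')
      (use len univ' in \<open>simp_all only: length_map, blast\<close>)
qed

section \<open>Path sums\<close>

primrec Merges :: "nat \<Rightarrow> nat list \<Rightarrow> arr" where
  "Merges k [] = Idt k"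
| "Merges k (x # xs) = Merge k x \<odot> (Wr \<oplus> Merges k xs)"

lemma Ty_Merges [simp]: "\<forall>x\<in>set xs. x < k \<Longrightarrow> Ty (Merges k xs) = Some (length xs + k, k)"
  by (induction xs) auto

text \<open>\<open>Merge_comm\<close> iterated: one wire overtakes a whole block of wires that are
  being multiplied in.\<close>

lemma Merge_Merges:
  assumes x: "x < k"
  shows "\<forall>y\<in>set l. y < k \<Longrightarrow> Merge k x \<odot> (Wr \<oplus> Merges k l) \<odot> (Br (length l) (Suc 0) \<oplus> Idt k) = Merges k l \<odot> (Idt (length l) \<oplus> Merge k x)"
proof (induction l)
  case Nil then show ?case using x by (simp add: Idt_tens_Idt)
next
  case (Cons y l)
  let ?p = "length l"
  have y: "y < k" and l: "\<forall>y\<in>set l. y < k" using Cons.prems by auto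
  have "Merge k x \<odot> (Wr \<oplus> Merges k (y # l)) \<odot> (Br (length (y # l)) (Suc 0) \<oplus> Idt k)
      = Merge k x \<odot> (Wr \<oplus> Merge k y) \<odot> (Idt 2 \<oplus> Merges k l) \<odot> (Sw \<oplus> Idt (?p + k)) \<odot> (Wr \<oplus> Br ?p 1 \<oplus> Idt k)"
    using Br_hexagon'[of 1 ?p 1] by (simp add: layers numeral_2_eq_2)
  also have "\<dots> = Merge k x \<odot> (Wr \<oplus> Merge k y) \<odot> (Sw \<oplus> Idt k) \<odot> (Idt 2 \<oplus> Merges k l) \<odot> (Wr \<oplus> Br ?p 1 \<oplus> Idt k)"
    using slide'[of Sw 2 2 "Merges k l" "?p + k" k] l by (simp add: numeral_2_eq_2)
  also have "\<dots> = Merge k y \<odot> (Wr \<oplus> Merge k x) \<odot> (Idt 2 \<oplus> Merges k l) \<odot> (Wr \<oplus> Br ?p 1 \<oplus> Idt k)"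
    using comp_eq_tail(2)[OF Merge_comm[OF x y]] by (simp add: acomp_assoc)
  also have "\<dots> = Merge k y \<odot> (Wr \<oplus> (Merges k l \<odot> (Idt ?p \<oplus> Merge k x)))"
    using Cons.IH[OF l, symmetric] by (simp add: layers numeral_2_eq_2)
  also have "\<dots> = Merges k (y # l) \<odot> (Idt (length (y # l)) \<oplus> Merge k x)" by (simp add: layers)
  finally show ?case .
qed

section \<open>Multiplication operators\<close>

type_synonym gate = "arr \<times> nat list"

definition gate_ok :: "nat \<Rightarrow> gate \<Rightarrow> bool" where
  "gate_ok k g \<longleftrightarrow> Ty (fst g) = Some (0, length (snd g)) \<and> (\<forall>x\<in>set (snd g). x < k)"

text \<open>The state is prepared on fresh wires, which are multiplied into the listed positions. An
  ill-formed gate acts as the identity, so that \<open>gate_comm\<close> holds for all pairs, as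
  folding over a multiset demands.\<close>

definition gate :: "nat \<Rightarrow> gate \<Rightarrow> arr" where
  "gate k g = (if gate_ok k g then Merges k (snd g) \<odot> (fst g \<oplus> Idt k) else Idt k)"

lemma Ty_gate [simp]: "Ty (gate k g) = Some (k, k)"
  by (auto simp: gate_def gate_ok_def)

text \<open>The state has no inputs, so it slides past the extra wire, and
  \<open>Merge_Merges\<close> exchanges the products.\<close>

lemma Merge_gate:
  assumes x: "x < k"
  shows "Merge k x \<odot> (Wr \<oplus> gate k g) = gate k g \<odot> Merge k x"
proof (cases "gate_ok k g")
  case True
  obtain b l where g: "g = (b, l)" by (cases g)
  let ?p = "length l"
  have b: "Ty b = Some (0, ?p)" and l: "\<forall>y\<in>set l. y < k" using True by (auto simp: gate_ok_def g)
  have Wb: "Wr \<oplus> b = Br ?p 1 \<odot> (b \<oplus> Wr)" using Br_natural[OF b, of Wr 1 1] b by simp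
  have "Merge k x \<odot> (Wr \<oplus> gate k g) = Merge k x \<odot> (Wr \<oplus> Merges k l) \<odot> ((Wr \<oplus> b) \<oplus> Idt k)"
    using True by (simp add: gate_def g layers)
  also have "\<dots> = Merge k x \<odot> (Wr \<oplus> Merges k l) \<odot> (Br ?p (Suc 0) \<oplus> Idt k) \<odot> (b \<oplus> Idt (Suc k))"
    unfolding Wb by (simp add: layers)
  also have "\<dots> = Merges k l \<odot> (Idt ?p \<oplus> Merge k x) \<odot> (b \<oplus> Idt (Suc k))"
    using comp_eq_tail(2)[OF Merge_Merges[OF x l]] by (simp add: acomp_assoc)
  also have "\<dots> = Merges k l \<odot> (b \<oplus> Idt k) \<odot> Merge k x"
    using slide'[OF b, of "Merge k x" "Suc k" k] x by simp
  finally show ?thesis using True by (simp add: gate_def g acomp_assoc)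
next
  case False then show ?thesis using x by (simp add: gate_def Idt_tens_Idt)
qed

lemma gate_Merges: "\<forall>y\<in>set l. y < k \<Longrightarrow> gate k g \<odot> Merges k l = Merges k l \<odot> (Idt (length l) \<oplus> gate k g)"
proof (induction l)
  case Nil then show ?case by (simp add: comp_Idt[of _ k k] Idt_comp[of _ k k])
next
  case (Cons y l)
  then have "gate k g \<odot> Merges k (y # l) = Merge k y \<odot> (Wr \<oplus> gate k g) \<odot> (Wr \<oplus> Merges k l)"
    using comp_eq_tail(1)[OF Merge_gate[symmetric]] by (simp add: acomp_assoc)
  also have "\<dots> = Merge k y \<odot> (Wr \<oplus> (Merges k l \<odot> (Idt (length l) \<oplus> gate k g)))"
    using Cons by (simp add: comp_Idt_tens)
  finally show ?case by (simp add: layers)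
qed

lemma gate_comm: "gate k g \<odot> gate k h = gate k h \<odot> gate k g"
proof (cases "gate_ok k h")
  case True
  obtain b l where h: "h = (b, l)" by (cases h)
  have b: "Ty b = Some (0, length l)" and l: "\<forall>y\<in>set l. y < k" using True by (auto simp: gate_ok_def h)
  have "gate k g \<odot> gate k h = Merges k l \<odot> (Idt (length l) \<oplus> gate k g) \<odot> (b \<oplus> Idt k)"
    using True comp_eq_tail(1)[OF gate_Merges[OF l]] by (simp add: gate_def[of k "(b, l)"] h acomp_assoc)
  also have "\<dots> = Merges k l \<odot> (b \<oplus> Idt k) \<odot> gate k g"
    using slide'(1)[OF b, of "gate k g" k k] by simp
  finally show ?thesis using True by (simp add: gate_def[of k "(b, l)"] h acomp_assoc)
next
  case False then show ?thesis by (simp add: gate_def[of k h] comp_Idt[of _ k k] Idt_comp[of _ k k])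
qed

lemma Fuse_Merges:
  assumes ys: "\<forall>y\<in>set ys. y < l"
  shows "\<forall>x\<in>set xs. x < length ys \<Longrightarrow>
    Fuse l ys \<odot> Merges (length ys) xs = Merges l (map ((!) ys) xs) \<odot> (Idt (length xs) \<oplus> Fuse l ys)"
proof (induction xs)
  case Nil then show ?case using ys by simp
next
  case (Cons x xs)
  have "Fuse l ys \<odot> Merges (length ys) (x # xs) = Merge l (ys ! x) \<odot> (Wr \<oplus> (Fuse l ys \<odot> Merges (length ys) xs))"
    using Cons.prems comp_eq_tail(1)[OF Fuse_Merge[OF ys, of x]] by (simp add: layers)
  also have "Fuse l ys \<odot> Merges (length ys) xs = Merges l (map ((!) ys) xs) \<odot> (Idt (length xs) \<oplus> Fuse l ys)"
    using Cons by simp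
  finally show ?case by (simp add: layers)
qed

lemma Merges_dg_Fuse:
  assumes ys: "\<forall>y\<in>set ys. y < l"
  shows "\<forall>x\<in>set xs. x < length ys \<Longrightarrow>
    Merges (length ys) xs \<odot> (Idt (length xs) \<oplus> dg (Fuse l ys)) = dg (Fuse l ys) \<odot> Merges l (map ((!) ys) xs)"
proof (induction xs)
  case Nil then show ?case using ys by simp
next
  case (Cons x xs)
  have "Merges (length ys) (x # xs) \<odot> (Idt (length (x # xs)) \<oplus> dg (Fuse l ys))
    = Merge (length ys) x \<odot> (Wr \<oplus> (Merges (length ys) xs \<odot> (Idt (length xs) \<oplus> dg (Fuse l ys))))"
    by (simp add: layers)
  also have "Merges (length ys) xs \<odot> (Idt (length xs) \<oplus> dg (Fuse l ys)) = dg (Fuse l ys) \<odot> Merges l (map ((!) ys) xs)"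
    using Cons by simp
  also have "Merge (length ys) x \<odot> (Wr \<oplus> \<dots>) = Merge (length ys) x \<odot> (Wr \<oplus> dg (Fuse l ys)) \<odot> (Wr \<oplus> Merges l (map ((!) ys) xs))"
    by (simp add: layers)
  also have "\<dots> = dg (Fuse l ys) \<odot> Merge l (ys ! x) \<odot> (Wr \<oplus> Merges l (map ((!) ys) xs))"
    using Cons.prems comp_eq_tail(1)[OF Merge_dg_Fuse[OF ys, of x]] by (simp add: acomp_assoc)
  finally show ?case by simp
qed

abbreviation gmap :: "(nat \<Rightarrow> nat) \<Rightarrow> gate \<Rightarrow> gate" where "gmap f \<equiv> apsnd (map f)"

lemma gate_ok_gmap: "gate_ok k g \<Longrightarrow> (\<And>x. x < k \<Longrightarrow> f x < l) \<Longrightarrow> gate_ok l (gmap f g)"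
  by (auto simp: gate_ok_def)

text \<open>An operator is transported along a function by relabelling its positions, while its
  state stays untouched; \<open>gate_dg_Fuse\<close> does the same against the direction of the
  function.\<close>

lemma Fuse_gate:
  assumes ys: "\<forall>y\<in>set ys. y < l" and g: "gate_ok (length ys) g"
  shows "Fuse l ys \<odot> gate (length ys) g = gate l (gmap ((!) ys) g) \<odot> Fuse l ys"
proof -
  obtain b xs where gb: "g = (b, xs)" by (cases g)
  have b: "Ty b = Some (0, length xs)" and xs: "\<forall>y\<in>set xs. y < length ys" using g by (auto simp: gate_ok_def gb)
  have g': "gate_ok l (gmap ((!) ys) g)" using g ys by (auto intro: gate_ok_gmap)
  have "Fuse l ys \<odot> gate (length ys) g = Merges l (map ((!) ys) xs) \<odot> (Idt (length xs) \<oplus> Fuse l ys) \<odot> (b \<oplus> Idt (length ys))"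
    using g comp_eq_tail(1)[OF Fuse_Merges[OF ys xs]] by (simp add: gate_def gb acomp_assoc)
  also have "\<dots> = Merges l (map ((!) ys) xs) \<odot> (b \<oplus> Idt l) \<odot> Fuse l ys"
    using slide'[OF b, of "Fuse l ys" "length ys" l] ys by simp
  finally show ?thesis using g' by (simp add: gate_def gb acomp_assoc)
qed

lemma gate_dg_Fuse:
  assumes ys: "\<forall>y\<in>set ys. y < l" and g: "gate_ok (length ys) g"
  shows "gate (length ys) g \<odot> dg (Fuse l ys) = dg (Fuse l ys) \<odot> gate l (gmap ((!) ys) g)"
proof -
  obtain b xs where gb: "g = (b, xs)" by (cases g)
  have b: "Ty b = Some (0, length xs)" and xs: "\<forall>y\<in>set xs. y < length ys" using g by (auto simp: gate_ok_def gb)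
  have g': "gate_ok l (gmap ((!) ys) g)" using g ys by (auto intro: gate_ok_gmap)
  have "gate (length ys) g \<odot> dg (Fuse l ys) = Merges (length ys) xs \<odot> (Idt (length xs) \<oplus> dg (Fuse l ys)) \<odot> (b \<oplus> Idt l)"
    using g slide'[OF b, of "dg (Fuse l ys)" l "length ys"] ys by (simp add: gate_def gb acomp_assoc)
  also have "\<dots> = dg (Fuse l ys) \<odot> Merges l (map ((!) ys) xs) \<odot> (b \<oplus> Idt l)"
    using comp_eq_tail(1)[OF Merges_dg_Fuse[OF ys xs]] by (simp add: acomp_assoc)
  finally show ?thesis using g' by (simp add: gate_def gb)
qed

text \<open>A fold over a multiset, since a graph gives no order to its nodes and arcs and the
  operators commute.\<close>

definition Gates :: "nat \<Rightarrow> gate multiset \<Rightarrow> arr" where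
  "Gates k M = fold_mset (\<lambda>g X. gate k g \<odot> X) (Idt k) M"

interpretation gate_fold: comp_fun_commute "\<lambda>g X. gate k g \<odot> X" for k
proof
  fix g h show "(\<odot>) (gate k h) \<circ> (\<odot>) (gate k g) = (\<odot>) (gate k g) \<circ> (\<odot>) (gate k h)"
    using comp_eq_tail(1)[OF gate_comm[of k g h]] by (intro ext) (simp add: acomp_assoc)
qed

lemma Gates_empty [simp]: "Gates k {#} = Idt k" by (simp add: Gates_def)

lemma Gates_add [simp]: "Gates k (add_mset g M) = gate k g \<odot> Gates k M"
  by (simp add: Gates_def gate_fold.fold_mset_add_mset)

lemma Ty_Gates [simp]: "Ty (Gates k M) = Some (k, k)"
  by (induction M) auto

lemma Gates_plus: "Gates k (M + N) = Gates k M \<odot> Gates k N"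
  by (induction M) (simp_all add: acomp_assoc Idt_comp[of _ k k])

lemma Fuse_Gates:
  assumes ys: "\<forall>y\<in>set ys. y < l"
  shows "\<forall>g\<in>#M. gate_ok (length ys) g \<Longrightarrow>
    Fuse l ys \<odot> Gates (length ys) M = Gates l (image_mset (gmap ((!) ys)) M) \<odot> Fuse l ys"
proof (induction M)
  case empty then show ?case using ys by simp
next
  case (add g M)
  then have "Fuse l ys \<odot> Gates (length ys) (add_mset g M) = gate l (gmap ((!) ys) g) \<odot> Fuse l ys \<odot> Gates (length ys) M"
    using comp_eq_tail(1)[OF Fuse_gate[OF ys, of g]] by (simp add: acomp_assoc)
  then show ?case using add by (simp add: acomp_assoc)
qed

lemma Gates_dg_Fuse:
  assumes ys: "\<forall>y\<in>set ys. y < l"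
  shows "\<forall>g\<in>#M. gate_ok (length ys) g \<Longrightarrow>
    Gates (length ys) M \<odot> dg (Fuse l ys) = dg (Fuse l ys) \<odot> Gates l (image_mset (gmap ((!) ys)) M)"
proof (induction M)
  case empty then show ?case using ys by simp
next
  case (add g M)
  then have "Gates (length ys) (add_mset g M) \<odot> dg (Fuse l ys)
      = gate (length ys) g \<odot> dg (Fuse l ys) \<odot> Gates l (image_mset (gmap ((!) ys)) M)"
    by (simp add: acomp_assoc)
  then show ?case using add comp_eq_tail(1)[OF gate_dg_Fuse[OF ys, of g]] by (simp add: acomp_assoc)
qed

lemma Merges_left: "\<forall>x\<in>set xs. x < k \<Longrightarrow> Merges (k + l) xs = Merges k xs \<oplus> Idt l"
  by (induction xs) (simp_all add: Merge_left layers)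

lemma Merges_right: "\<forall>x\<in>set xs. x < l \<Longrightarrow>
  Merges (k + l) (map ((+) k) xs) = (Idt k \<oplus> Merges l xs) \<odot> (Br (length xs) k \<oplus> Idt l)"
proof (induction xs)
  case Nil then show ?case by (simp add: Idt_tens_Idt)
next
  case (Cons x xs)
  let ?p = "length xs"
  have x: "x < l" and xs: "\<forall>x\<in>set xs. x < l" using Cons.prems by auto
  have "Merges (k + l) (map ((+) k) (x # xs))
    = (Idt k \<oplus> Merge l x) \<odot> (Br 1 k \<oplus> Idt l) \<odot> (Idt (Suc k) \<oplus> Merges l xs) \<odot> (Wr \<oplus> Br ?p k \<oplus> Idt l)"
    using x Cons.IH[OF xs] by (simp add: Merge_right layers)
  also have "\<dots> = (Idt k \<oplus> Merge l x) \<odot> (Idt (Suc k) \<oplus> Merges l xs) \<odot> (Br 1 k \<oplus> Idt (?p + l)) \<odot> (Wr \<oplus> Br ?p k \<oplus> Idt l)"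
    using slide'[of "Br 1 k" "Suc k" "Suc k" "Merges l xs" "?p + l" l] xs by simp
  also have "\<dots> = (Idt k \<oplus> Merge l x) \<odot> (Idt (Suc k) \<oplus> Merges l xs) \<odot> (Br (Suc ?p) k \<oplus> Idt l)"
    using Br_hexagon'[of 1 ?p k] by (simp add: layers)
  also have "\<dots> = (Idt k \<oplus> Merges l (x # xs)) \<odot> (Br (length (x # xs)) k \<oplus> Idt l)" by (simp add: layers)
  finally show ?case .
qed

lemma gate_left: "gate_ok k g \<Longrightarrow> gate (k + l) g = gate k g \<oplus> Idt l"
  using gate_ok_gmap[of k g id "k + l"]
  by (simp add: gate_def gate_ok_def Merges_left layers)

lemma gate_right:
  assumes g: "gate_ok l g"
  shows "gate (k + l) (gmap ((+) k) g) = Idt k \<oplus> gate l g"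
proof -
  obtain b xs where gb: "g = (b, xs)" by (cases g)
  have b: "Ty b = Some (0, length xs)" and xs: "\<forall>y\<in>set xs. y < l" using g by (auto simp: gate_ok_def gb)
  have "gate_ok (k + l) (gmap ((+) k) g)" using g by (auto intro: gate_ok_gmap)
  then have "gate (k + l) (gmap ((+) k) g) = (Idt k \<oplus> Merges l xs) \<odot> ((Br (length xs) k \<odot> (b \<oplus> Idt k)) \<oplus> Idt l)"
    using xs by (simp add: gate_def gb Merges_right layers)
  also have "Br (length xs) k \<odot> (b \<oplus> Idt k) = Idt k \<oplus> b"
    using Br_natural[OF b, of "Idt k" k k] b by simp
  finally show ?thesis using g by (simp add: gate_def gb layers)
qed

lemma Gates_left: "\<forall>g\<in>#M. gate_ok k g \<Longrightarrow> Gates (k + l) M = Gates k M \<oplus> Idt l"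
  by (induction M) (simp_all add: Idt_tens_Idt gate_left comp_tens_Idt)

lemma Gates_right: "\<forall>g\<in>#M. gate_ok l g \<Longrightarrow> Gates (k + l) (image_mset (gmap ((+) k)) M) = Idt k \<oplus> Gates l M"
  by (induction M) (simp_all add: Idt_tens_Idt gate_right comp_Idt_tens)

text \<open>A path sum over \<open>k\<close> wires: inputs enter along \<open>xs\<close>, all
  operators act, and outputs are read off along \<open>ys\<close>. A wire that \<open>ys\<close>
  misses is closed by a counit, hence summed over.\<close>

definition read :: "nat \<Rightarrow> nat list \<Rightarrow> nat list \<Rightarrow> gate multiset \<Rightarrow> arr" where
  "read k xs ys M = dg (Fuse k ys) \<odot> Gates k M \<odot> Fuse k xs"

text \<open>Conjugation with the unitary diagram of a permutation.\<close>

lemma read_renumber: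
  assumes s: "distinct s" "length s = k" "\<forall>x\<in>set s. x < k"
    and ok: "\<forall>x\<in>set xs. x < k" "\<forall>x\<in>set ys. x < k" "\<forall>g\<in>#M. gate_ok k g"
  shows "read k (map ((!) s) xs) (map ((!) s) ys) (image_mset (gmap ((!) s)) M) = read k xs ys M"
proof -
  have Fuse: "Fuse k (map ((!) s) zs) = Fuse k s \<odot> Fuse k zs" if "\<forall>x\<in>set zs. x < k" for zs
    using Fuse_Fuse[OF s(3), of zs] s that by simp
  have G: "Gates k (image_mset (gmap ((!) s)) M) \<odot> Fuse k s = Fuse k s \<odot> Gates k M"
    using Fuse_Gates[OF s(3), of M] s ok by simp
  have un: "dg (Fuse k s) \<odot> Fuse k s = Idt k" using Fuse_unitary[OF s] by simp
  have "read k (map ((!) s) xs) (map ((!) s) ys) (image_mset (gmap ((!) s)) M)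
    = dg (Fuse k ys) \<odot> dg (Fuse k s) \<odot> Gates k (image_mset (gmap ((!) s)) M) \<odot> Fuse k s \<odot> Fuse k xs"
    using ok by (simp add: read_def Fuse acomp_assoc)
  also have "\<dots> = dg (Fuse k ys) \<odot> (dg (Fuse k s) \<odot> Fuse k s) \<odot> Gates k M \<odot> Fuse k xs"
    using comp_eq_tail(1)[OF G] by (simp add: acomp_assoc)
  finally show ?thesis unfolding un using ok by (simp add: read_def)
qed

text \<open>The two path sums meet in \<open>Fuse n vs \<odot> dg (Fuse m us)\<close>. Base change
  replaces this by a pushout, and the operators of both factors move along its legs onto the merged
  wires. The cocone is exported because it has to be compared with the gluing of graphs.\<close>

lemma read_comp:
  assumes len: "length us = length vs"
    and m: "\<forall>x\<in>set xs. x < m" "\<forall>u\<in>set us. u < m" "\<forall>g\<in>#M. gate_ok m g"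
    and n: "\<forall>v\<in>set vs. v < n" "\<forall>y\<in>set ys. y < n" "\<forall>g\<in>#N. gate_ok n g"
  shows "\<exists>w p q. length p = m \<and> length q = n \<and> set p \<union> set q = {0..<w} \<and>
    (\<forall>i<length us. p ! (us ! i) = q ! (vs ! i)) \<and>
    (\<forall>\<theta> :: nat + nat \<Rightarrow> nat. (\<forall>i<length us. \<theta> (Inl (us ! i)) = \<theta> (Inr (vs ! i))) \<longrightarrow>
      (\<forall>x\<in>{..<m} <+> {..<n}. \<forall>y\<in>{..<m} <+> {..<n}.
        case_sum ((!) p) ((!) q) x = case_sum ((!) p) ((!) q) y \<longrightarrow> \<theta> x = \<theta> y)) \<and>
    read n vs ys N \<odot> read m xs us M = read w (map ((!) p) xs) (map ((!) q) ys)
      (image_mset (gmap ((!) q)) N + image_mset (gmap ((!) p)) M)"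
proof -
  obtain w p q where len: "length p = m" "length q = n" and set: "set p \<union> set q = {0..<w}"
    and eq: "\<forall>i<length us. p ! (us ! i) = q ! (vs ! i)"
    and univ: "(\<forall>\<theta> :: nat + nat \<Rightarrow> nat. (\<forall>i<length us. \<theta> (Inl (us ! i)) = \<theta> (Inr (vs ! i))) \<longrightarrow>
      (\<forall>x\<in>{..<m} <+> {..<n}. \<forall>y\<in>{..<m} <+> {..<n}.
        case_sum ((!) p) ((!) q) x = case_sum ((!) p) ((!) q) y \<longrightarrow> \<theta> x = \<theta> y))"
    and Fuse: "Fuse n vs \<odot> dg (Fuse m us) = dg (Fuse w q) \<odot> Fuse w p"
    using Fuse_dg_Fuse_pushout[OF assms(1) m(2) n(1)] by blast
  have pq: "\<forall>x\<in>set p. x < w" "\<forall>x\<in>set q. x < w" using set by auto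
  let ?M = "image_mset (gmap ((!) p)) M" and ?N = "image_mset (gmap ((!) q)) N"
  have GM: "Fuse w p \<odot> Gates m M = Gates w ?M \<odot> Fuse w p" using Fuse_Gates[OF pq(1), of M] len m by simp
  have GN: "Gates n N \<odot> dg (Fuse w q) = dg (Fuse w q) \<odot> Gates w ?N" using Gates_dg_Fuse[OF pq(2), of N] len n by simp
  have Fx: "Fuse w p \<odot> Fuse m xs = Fuse w (map ((!) p) xs)" using Fuse_Fuse[OF pq(1), of xs] len m by simp
  have Fy: "dg (Fuse n ys) \<odot> dg (Fuse w q) = dg (Fuse w (map ((!) q) ys))"
    using Fuse_Fuse[OF pq(2), of ys] len n by (simp flip: dg_simps)
  have "read n vs ys N \<odot> read m xs us M
    = dg (Fuse n ys) \<odot> Gates n N \<odot> (Fuse n vs \<odot> dg (Fuse m us)) \<odot> Gates m M \<odot> Fuse m xs"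
    by (simp add: read_def acomp_assoc)
  also have "\<dots> = dg (Fuse n ys) \<odot> (Gates n N \<odot> dg (Fuse w q)) \<odot> (Fuse w p \<odot> Gates m M) \<odot> Fuse m xs"
    by (simp only: Fuse acomp_assoc)
  also have "\<dots> = (dg (Fuse n ys) \<odot> dg (Fuse w q)) \<odot> (Gates w ?N \<odot> Gates w ?M) \<odot> (Fuse w p \<odot> Fuse m xs)"
    by (simp only: GM GN acomp_assoc)
  also have "\<dots> = read w (map ((!) p) xs) (map ((!) q) ys) (?N + ?M)"
    by (simp only: Fx Fy read_def Gates_plus)
  finally show ?thesis using len set eq univ
    by (intro exI[of _ w] exI[of _ p] exI[of _ q] conjI)
qed

lemma read_tens:
  assumes m: "\<forall>x\<in>set xs. x < m" "\<forall>u\<in>set us. u < m" "\<forall>g\<in>#M. gate_ok m g"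
    and n: "\<forall>v\<in>set vs. v < n" "\<forall>y\<in>set ys. y < n" "\<forall>g\<in>#N. gate_ok n g"
  shows "read (m + n) (xs @ map ((+) m) vs) (us @ map ((+) m) ys) (M + image_mset (gmap ((+) m)) N)
    = read m xs us M \<oplus> read n vs ys N"
proof -
  have G: "Gates (m + n) (M + image_mset (gmap ((+) m)) N) = Gates m M \<oplus> Gates n N"
    using m n slide[of "Gates m M" m m "Gates n N" n n] by (simp add: Gates_plus Gates_left Gates_right)
  have "read (m + n) (xs @ map ((+) m) vs) (us @ map ((+) m) ys) (M + image_mset (gmap ((+) m)) N)
    = (dg (Fuse m us) \<oplus> dg (Fuse n ys)) \<odot> (Gates m M \<oplus> Gates n N) \<odot> (Fuse m xs \<oplus> Fuse n vs)"
    unfolding read_def G using m n by (simp add: Fuse_append)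
  also have "(Gates m M \<oplus> Gates n N) \<odot> (Fuse m xs \<oplus> Fuse n vs) = (Gates m M \<odot> Fuse m xs) \<oplus> (Gates n N \<odot> Fuse n vs)"
    using m n by (simp add: tens_comp[where k = m])
  also have "(dg (Fuse m us) \<oplus> dg (Fuse n ys)) \<odot> \<dots> = read m xs us M \<oplus> read n vs ys N"
    using m n by (simp add: tens_comp[where k = m] read_def)
  finally show ?thesis .
qed

section \<open>The path sum of a star\<close>

definition edge :: "arr \<Rightarrow> arr" where "edge h = (h \<oplus> Wr) \<odot> Cu"

lemma Ty_edge [simp]: "Ty h = Some (Suc 0, Suc 0) \<Longrightarrow> Ty (edge h) = Some (0, Suc (Suc 0))"
  by (simp add: edge_def)

primrec pow :: "arr \<Rightarrow> nat \<Rightarrow> arr" where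
  "pow h 0 = Idt 0"
| "pow h (Suc n) = h \<oplus> pow h n"

lemma Ty_pow [simp]: "Ty h = Some (Suc 0, Suc 0) \<Longrightarrow> Ty (pow h n) = Some (n, n)"
  by (induction n) auto

lemma Mu_Et': "Mu \<odot> (Wr \<oplus> Et) = Wr"
  using spider'[of 1 1 1 0 0 0 0] by (simp add: numeral_2_eq_2)

lemma gate_leaf:
  assumes h: "Ty h = Some (Suc 0, Suc 0)" and w: "w < k"
  shows "gate (Suc k) (edge h, [0, Suc w]) = (Mu \<oplus> Idt k) \<odot> (Idt 2 \<oplus> Merge k w) \<odot> (Wr \<oplus> Sw \<oplus> Idt k) \<odot> (edge h \<oplus> Idt (Suc k))"
  using assms by (simp add: gate_def gate_ok_def layers numeral_2_eq_2)

lemma edge_Merge: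
  assumes h: "Ty h = Some (Suc 0, Suc 0)" and w: "w < k"
  shows "(Wr \<oplus> Merge k w) \<odot> (edge h \<oplus> Idt k) = (h \<oplus> Idt k) \<odot> dg (Merge k w)"
proof -
  have "(Wr \<oplus> Merge k w) \<odot> (edge h \<oplus> Idt k) = (Wr \<oplus> Merge k w) \<odot> (h \<oplus> Idt (Suc k)) \<odot> (Cu \<oplus> Idt k)"
    by (simp add: edge_def layers)
  also have "\<dots> = (h \<oplus> Idt k) \<odot> (Wr \<oplus> Merge k w) \<odot> (Cu \<oplus> Idt k)"
    using slide'[OF h, of "Merge k w" "Suc k" k] w by simp
  finally show ?thesis using w by (simp add: dg_Merge)
qed

text \<open>A unit wire tied to wire \<open>w\<close> by an edge becomes \<open>h\<close> applied to
  a copy of \<open>w\<close>: this is an output leg.\<close>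

lemma gate_leaf_Et:
  assumes h: "Ty h = Some (Suc 0, Suc 0)" and w: "w < k"
  shows "gate (Suc k) (edge h, [0, Suc w]) \<odot> (Et \<oplus> Idt k) = (h \<oplus> Idt k) \<odot> dg (Merge k w)"
proof -
  let ?b = "edge h"
  have b: "Ty ?b = Some (0, 2)" using h by (simp add: numeral_2_eq_2)
  have Sw: "Sw \<odot> (Wr \<oplus> Et) = Et \<oplus> Wr" using Br_natural[of Wr 1 1 Et 0 1] by simp
  have 1: "(Wr \<oplus> Sw) \<odot> (?b \<oplus> Et) = (Wr \<oplus> Et \<oplus> Wr) \<odot> ?b"
  proof -
    have "(Wr \<oplus> Sw) \<odot> (?b \<oplus> Et) = (Wr \<oplus> (Sw \<odot> (Wr \<oplus> Et))) \<odot> ?b"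
      using slide(2)[OF b, of Et 0 1] b by (simp add: layers numeral_2_eq_2)
    then show ?thesis using Sw by simp
  qed
  have "gate (Suc k) (?b, [0, Suc w]) \<odot> (Et \<oplus> Idt k)
    = (Mu \<oplus> Idt k) \<odot> (Idt 2 \<oplus> Merge k w) \<odot> (((Wr \<oplus> Sw) \<odot> (?b \<oplus> Et)) \<oplus> Idt k)"
    using tens_comp[of Et 0 1 Wr 1 "Idt k" "Idt k"] slide(1)[OF b, of "Et \<oplus> Idt k" k "Suc k"]
    by (simp add: gate_leaf[OF h w] layers)
  also have "\<dots> = (Mu \<oplus> Idt k) \<odot> (Idt 2 \<oplus> Merge k w) \<odot> (Wr \<oplus> Et \<oplus> Idt (Suc k)) \<odot> (?b \<oplus> Idt k)"
    by (simp only: 1) (simp add: layers)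
  also have "\<dots> = (Wr \<oplus> Merge k w) \<odot> ((Mu \<odot> (Wr \<oplus> Et)) \<oplus> Idt (Suc k)) \<odot> (?b \<oplus> Idt k)"
    using slide'[of Mu 2 1 "Merge k w" "Suc k" k] w by (simp add: layers numeral_2_eq_2)
  also have "\<dots> = (h \<oplus> Idt k) \<odot> dg (Merge k w)"
    using edge_Merge[OF h w] b by (simp add: Mu_Et' Idt_tens_Idt numeral_2_eq_2)
  finally show ?thesis .
qed

text \<open>\<open>h\<close> is its own transpose with respect to the cup. An input leaf enters the
  edge at the end that carries \<open>h\<close>, hence passes through the transpose of
  \<open>h\<close>.\<close>

definition edge_sym :: "arr \<Rightarrow> bool" where
  "edge_sym h \<longleftrightarrow> Ty h = Some (Suc 0, Suc 0) \<and> (Ca \<oplus> Wr) \<odot> (Wr \<oplus> Sw) \<odot> (edge h \<oplus> Wr) = h"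

lemma Et_gate_leaf:
  assumes h: "edge_sym h" and w: "w < k"
  shows "(dg Et \<oplus> Idt k) \<odot> gate (Suc k) (edge h, [0, Suc w]) = Merge k w \<odot> (h \<oplus> Idt k)"
proof -
  have Th: "Ty h = Some (Suc 0, Suc 0)" and hs: "(Ca \<oplus> Wr) \<odot> (Wr \<oplus> Sw) \<odot> (edge h \<oplus> Wr) = h"
    using h by (auto simp: edge_sym_def)
  have c: "dg Et \<odot> Mu = Ca" using spider[of 1 0 0 0 0 2 0] Gr_cap by (simp add: numeral_2_eq_2)
  have "(dg Et \<oplus> Idt k) \<odot> gate (Suc k) (edge h, [0, Suc w])
    = ((dg Et \<odot> Mu) \<oplus> Idt k) \<odot> (Idt 2 \<oplus> Merge k w) \<odot> (Wr \<oplus> Sw \<oplus> Idt k) \<odot> (edge h \<oplus> Idt (Suc k))"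
    by (simp add: gate_leaf[OF Th w] layers)
  also have "\<dots> = Merge k w \<odot> (Ca \<oplus> Idt (Suc k)) \<odot> (Wr \<oplus> Sw \<oplus> Idt k) \<odot> (edge h \<oplus> Idt (Suc k))"
    using slide'[of Ca 2 0 "Merge k w" "Suc k" k] w unfolding c by (simp add: numeral_2_eq_2)
  also have "\<dots> = Merge k w \<odot> (h \<oplus> Idt k)"
    using in_context(5)[OF hs, of k] by (simp add: layers)
  finally show ?thesis .
qed

text \<open>Arcs from the leaf wires \<open>0..<n\<close> to a single hub, which is number
  \<open>w\<close> among the wires that follow the leaves.\<close>

definition leaves :: "arr \<Rightarrow> nat \<Rightarrow> nat \<Rightarrow> gate multiset" where
  "leaves h n w = image_mset (\<lambda>j. (edge h, [j, n + w])) (mset [0..<n])"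

lemma leaves_0 [simp]: "leaves h 0 w = {#}" by (simp add: leaves_def)

lemma leaves_Suc: "leaves h (Suc n) w = add_mset (edge h, [0, Suc (n + w)]) (image_mset (gmap ((+) (Suc 0))) (leaves h n w))"
proof -
  have "mset [0..<Suc n] = add_mset 0 (image_mset Suc (mset [0..<n]))"
    by (simp add: upt_conv_Cons map_Suc_upt[symmetric] del: upt_Suc)
  then show ?thesis by (simp add: leaves_def multiset.map_comp o_def del: upt_Suc mset_upt)
qed

lemma leaves_ok:
  "Ty h = Some (Suc 0, Suc 0) \<Longrightarrow> w < k \<Longrightarrow> \<forall>g\<in>#leaves h n w. gate_ok (n + k) g"
  by (auto simp: leaves_def gate_ok_def)

text \<open>Leaf by leaf with \<open>gate_leaf_Et\<close>. The copy for the newest leaf emerges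
  behind the other leaves and has to be braided to the front; \<open>Merge_Merges\<close> absorbs
  this braiding by commutativity.\<close>

lemma leaves_out:
  assumes h: "Ty h = Some (Suc 0, Suc 0)" and w: "w < k"
  shows "Gates (n + k) (leaves h n w) \<odot> (Units n \<oplus> Idt k) = (pow h n \<oplus> Idt k) \<odot> dg (Merges k (replicate n w))"
proof (induction n)
  case 0 then show ?case by simp
next
  case (Suc n)
  let ?Merge = "Merges k (replicate n w)"
  have TA: "Ty ?Merge = Some (n + k, k)" using w by simp
  note ok = leaves_ok[OF h w, of n]
  have "Gates (Suc n + k) (leaves h (Suc n) w) \<odot> (Units (Suc n) \<oplus> Idt k)
    = gate (Suc (n + k)) (edge h, [0, Suc (n + w)]) \<odot> (Wr \<oplus> Gates (n + k) (leaves h n w)) \<odot> (Et \<oplus> Units n \<oplus> Idt k)"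
    using Gates_right[OF ok, of "Suc 0"] by (simp add: leaves_Suc layers)
  also have "(Wr \<oplus> Gates (n + k) (leaves h n w)) \<odot> (Et \<oplus> Units n \<oplus> Idt k) = (Et \<oplus> Idt (n + k)) \<odot> (pow h n \<oplus> Idt k) \<odot> dg ?Merge"
    using slide'(1)[of Et 0 1 "(pow h n \<oplus> Idt k) \<odot> dg ?Merge" k "n + k"] TA h Suc.IH
      tens_comp[of Et 0 1 Wr 1 "Gates (n + k) (leaves h n w)" "Units n \<oplus> Idt k"] 
      slide(1)[of Et 0 1 "(pow h n \<oplus> Idt k) \<odot> dg ?Merge" k "n + k"]
    by simp
  also have "gate (Suc (n + k)) (edge h, [0, Suc (n + w)]) \<odot> \<dots>
    = (h \<oplus> Idt (n + k)) \<odot> dg (Merge (n + k) (n + w)) \<odot> (pow h n \<oplus> Idt k) \<odot> dg ?Merge"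
    using comp_eq_tail(1)[OF gate_leaf_Et[OF h, of "n + w" "n + k"]] w by (simp add: acomp_assoc)
  also have "dg (Merge (n + k) (n + w)) = (Br n 1 \<oplus> Idt k) \<odot> (Idt n \<oplus> dg (Merge k w))"
    using w by (simp add: Merge_right)
  also have "(h \<oplus> Idt (n + k)) \<odot> ((Br n 1 \<oplus> Idt k) \<odot> (Idt n \<oplus> dg (Merge k w))) \<odot> (pow h n \<oplus> Idt k) \<odot> dg ?Merge
    = (h \<oplus> Idt (n + k)) \<odot> ((Br n 1 \<odot> (pow h n \<oplus> Wr)) \<oplus> Idt k) \<odot> (Idt n \<oplus> dg (Merge k w)) \<odot> dg ?Merge"
    using slide'(2)[of "pow h n" n n "dg (Merge k w)" k "Suc k"] h w by (simp add: layers)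
  also have "Br n 1 \<odot> (pow h n \<oplus> Wr) = (Wr \<oplus> pow h n) \<odot> Br n 1"
    using Br_natural[of "pow h n" n n Wr 1 1] h by simp
  also have "(h \<oplus> Idt (n + k)) \<odot> (((Wr \<oplus> pow h n) \<odot> Br n 1) \<oplus> Idt k) \<odot> (Idt n \<oplus> dg (Merge k w)) \<odot> dg ?Merge
    = (h \<oplus> Idt (n + k)) \<odot> (Wr \<oplus> pow h n \<oplus> Idt k) \<odot> dg (?Merge \<odot> (Idt n \<oplus> Merge k w) \<odot> (Br 1 n \<oplus> Idt k))"
    by (simp add: layers)
  also have "?Merge \<odot> (Idt n \<oplus> Merge k w) \<odot> (Br 1 n \<oplus> Idt k) = Merge k w \<odot> (Wr \<oplus> ?Merge)"
  proof -
    have "?Merge \<odot> (Idt n \<oplus> Merge k w) = Merge k w \<odot> (Wr \<oplus> ?Merge) \<odot> (Br n 1 \<oplus> Idt k)"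
      using Merge_Merges[OF w, of "replicate n w"] w by simp
    then have "?Merge \<odot> (Idt n \<oplus> Merge k w) \<odot> (Br 1 n \<oplus> Idt k) = Merge k w \<odot> (Wr \<oplus> ?Merge) \<odot> ((Br n 1 \<odot> Br 1 n) \<oplus> Idt k)"
      using comp_eq_tail(1)[of ?Merge "Idt n \<oplus> Merge k w"] by (simp add: acomp_assoc comp_tens_Idt del: Br_Br)
    then show ?thesis using TA w by (simp add: Idt_tens_Idt)
  qed
  also have "(h \<oplus> Idt (n + k)) \<odot> (Wr \<oplus> pow h n \<oplus> Idt k) \<odot> dg (Merge k w \<odot> (Wr \<oplus> ?Merge))
    = (pow h (Suc n) \<oplus> Idt k) \<odot> dg (Merges k (replicate (Suc n) w))"
    using comp_eq_tail(1)[OF slide(1)[OF h, of "pow h n \<oplus> Idt k" "n + k" "n + k"]] h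
    by (simp add: atens_assoc)
  finally show ?case .
qed

lemma leaves_in:
  assumes hs: "edge_sym h" and w: "w < k"
  shows "(dg (Units n) \<oplus> Idt k) \<odot> Gates (n + k) (leaves h n w) = Merges k (replicate n w) \<odot> (pow h n \<oplus> Idt k)"
proof (induction n)
  case 0 then show ?case by simp
next
  case (Suc n)
  have h: "Ty h = Some (Suc 0, Suc 0)" using hs by (simp add: edge_sym_def)
  let ?Merge = "Merges k (replicate n w)" and ?G = "Gates (n + k) (leaves h n w)"
  have TA: "Ty ?Merge = Some (n + k, k)" using w by simp
  note ok = leaves_ok[OF h w, of n]
  have "(dg (Units (Suc n)) \<oplus> Idt k) \<odot> Gates (Suc n + k) (leaves h (Suc n) w)
    = (dg Et \<oplus> dg (Units n) \<oplus> Idt k) \<odot> gate (Suc (n + k)) (edge h, [0, Suc (n + w)]) \<odot> (Wr \<oplus> ?G)"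
    using Gates_right[OF ok, of "Suc 0"] by (simp add: leaves_Suc atens_assoc)
  also have "dg Et \<oplus> dg (Units n) \<oplus> Idt k = (dg (Units n) \<oplus> Idt k) \<odot> (dg Et \<oplus> Idt (n + k))"
    using slide(2)[of "dg Et" 1 0 "dg (Units n) \<oplus> Idt k" "n + k" k] by simp
  also have "((dg (Units n) \<oplus> Idt k) \<odot> (dg Et \<oplus> Idt (n + k))) \<odot> gate (Suc (n + k)) (edge h, [0, Suc (n + w)]) \<odot> (Wr \<oplus> ?G)
    = (dg (Units n) \<oplus> Idt k) \<odot> Merge (n + k) (n + w) \<odot> (h \<oplus> Idt (n + k)) \<odot> (Wr \<oplus> ?G)"
    using comp_eq_tail(1)[OF Et_gate_leaf[OF hs, of "n + w" "n + k"]] w by (simp add: acomp_assoc)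
  also have "(h \<oplus> Idt (n + k)) \<odot> (Wr \<oplus> ?G) = h \<oplus> ?G"
    using slide(1)[OF h, of ?G "n + k" "n + k"] by simp
  also have "(dg (Units n) \<oplus> Idt k) \<odot> Merge (n + k) (n + w) \<odot> (h \<oplus> ?G)
    = Merge k w \<odot> (((dg (Units n) \<oplus> Wr) \<odot> Br 1 n) \<oplus> Idt k) \<odot> (h \<oplus> ?G)"
    using slide'(2)[of "dg (Units n)" n 0 "Merge k w" "Suc k" k] w by (simp add: Merge_right layers)
  also have "(dg (Units n) \<oplus> Wr) \<odot> Br 1 n = Wr \<oplus> dg (Units n)"
    using Br_natural[of Wr 1 1 "dg (Units n)" n 0] by simp
  also have "((Wr \<oplus> dg (Units n)) \<oplus> Idt k) \<odot> (h \<oplus> ?G) = h \<oplus> (?Merge \<odot> (pow h n \<oplus> Idt k))"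
    using h Suc.IH tens_comp[of h 1 1 Wr 1 "dg (Units n) \<oplus> Idt k" ?G] by (simp add: atens_assoc)
  also have "\<dots> = (Wr \<oplus> ?Merge) \<odot> (pow h (Suc n) \<oplus> Idt k)"
    using h tens_comp[of h 1 1 Wr 1 ?Merge "pow h n \<oplus> Idt k"] by (simp add: atens_assoc)
  finally show ?case by (simp add: acomp_assoc)
qed

lemma Merges_hub: "Merges (Suc 0) (replicate n 0) = Gr (Suc n) (Suc 0) 0"
proof (induction n)
  case (Suc n)
  then show ?case using spider'[of 1 1 1 0 0 "Suc n" 0] by (simp add: numeral_2_eq_2)
qed simp

text \<open>The star with \<open>n\<close> output leaves \<open>0, \<dots>, n - 1\<close>, \<open>m\<close> input leaves \<open>n, \<dots>, n + m - 1\<close>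
  and hub \<open>n + m\<close>.\<close>

lemma read_star:
  assumes ho: "Ty ho = Some (Suc 0, Suc 0)" and hi: "edge_sym hi" and nu: "Ty nu = Some (0, Suc 0)"
  shows "read (n + Suc m) (map ((+) n) [0..<m]) [0..<n]
     (leaves ho n m + image_mset (gmap ((+) n)) (leaves hi m 0) + {#(nu, [n + m])#})
   = pow ho n \<odot> Gr (Suc 0) n 0 \<odot> Gr (Suc m) (Suc 0) 0 \<odot> (Idt m \<oplus> nu) \<odot> pow hi m"
proof -
  let ?G = "Gates (Suc m) (leaves hi m 0)" and ?N = "Mu \<odot> (nu \<oplus> Wr)"
  let ?Y = "dg (Merges (Suc 0) (replicate n 0))"
  have Thi: "Ty hi = Some (Suc 0, Suc 0)" using hi by (simp add: edge_sym_def)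
  have F1: "Fuse (n + Suc m) (map ((+) n) [0..<m]) = Units n \<oplus> Idt m \<oplus> Et"
    using Fuse_right[of "[0..<m]" "Suc m" n] Fuse_append[of "[]" 1 "[0..<m]" m] by (simp add: Fuse_id)
  have F2: "dg (Fuse (n + Suc m) [0..<n]) = Idt n \<oplus> dg (Units m) \<oplus> dg Et"
    using Fuse_append[of "[]" "Suc m" "[0..<n]" n] Units_add[of m 1] by (simp add: Fuse_id atens_assoc)
  have G1: "Gates (n + Suc m) (image_mset (gmap ((+) n)) (leaves hi m 0)) = Idt n \<oplus> ?G"
    using Gates_right[OF leaves_ok[OF Thi, of 0 "Suc 0" m], of n] by simp
  have G2: "gate (n + Suc m) (nu, [n + m]) = Idt n \<oplus> Idt m \<oplus> ?N"
  proof -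
    have "gate (n + Suc m) (gmap ((+) n) (nu, [m])) = Idt n \<oplus> gate (m + Suc 0) (gmap ((+) m) (nu, [0]))"
      using nu by (subst gate_right) (auto simp: gate_ok_def)
    also have "gate (m + Suc 0) (gmap ((+) m) (nu, [0])) = Idt m \<oplus> gate (Suc 0) (nu, [0])"
      using nu by (subst gate_right) (auto simp: gate_ok_def)
    also have "gate (Suc 0) (nu, [0]) = ?N"
      using nu by (simp add: gate_def gate_ok_def Idt_tens_Idt numeral_2_eq_2)
    finally show ?thesis by simp
  qed
  have nuE: "?N \<odot> Et = nu"
  proof -
    have "?N \<odot> Et = Mu \<odot> (nu \<oplus> Et)" using slide(1)[OF nu, of Et 0 1] by (simp add: acomp_assoc)
    also have "\<dots> = Mu \<odot> (Wr \<oplus> Et) \<odot> nu" using slide(2)[OF nu, of Et 0 1] nu by simp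
    finally show ?thesis using comp_eq_tail(1)[OF Mu_Et', of nu] nu by simp
  qed
  have TY: "Ty ?Y = Some (1, Suc n)" by (simp add: Merges_hub)
  have dgY: "dg (Merges (Suc m) (replicate n m)) = (Br m n \<oplus> Wr) \<odot> (Idt m \<oplus> ?Y)"
    using Merges_right[of "replicate n 0" "Suc 0" m] by (simp add: map_replicate_const)
  have "read (n + Suc m) (map ((+) n) [0..<m]) [0..<n]
     (leaves ho n m + image_mset (gmap ((+) n)) (leaves hi m 0) + {#(nu, [n + m])#})
    = (Idt n \<oplus> dg (Units m) \<oplus> dg Et) \<odot> Gates (n + Suc m) (leaves ho n m) \<odot> (Idt n \<oplus> ?G) \<odot> (Idt n \<oplus> Idt m \<oplus> ?N) \<odot> (Units n \<oplus> Idt m \<oplus> Et)"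
    by (simp only: read_def Gates_plus F1 F2 G1 G2 Gates_add Gates_empty acomp_assoc)
      (use nu in \<open>simp add: numeral_2_eq_2\<close>)
  \<comment> \<open>The hub wire starts as a unit, so multiplying the state of the node into it just
    places that state there (\<open>nuE\<close>).\<close>
  also have "(Idt n \<oplus> Idt m \<oplus> ?N) \<odot> (Units n \<oplus> Idt m \<oplus> Et) = Units n \<oplus> Idt m \<oplus> nu"
    using nu nuE tens_comp[of "Units n" 0 n "Idt n" n "Idt m \<oplus> ?N" "Idt m \<oplus> Et"] tens_comp[of "Idt m" m m "Idt m" m ?N Et]
    by (simp add: numeral_2_eq_2)
  also have "(Idt n \<oplus> ?G) \<odot> (Units n \<oplus> Idt m \<oplus> nu) = (Units n \<oplus> Idt (Suc m)) \<odot> ?G \<odot> (Idt m \<oplus> nu)"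
    using nu tens_comp[of "Units n" 0 n "Idt n" n ?G "Idt m \<oplus> nu"] slide(1)[of "Units n" 0 n "?G \<odot> (Idt m \<oplus> nu)" m "Suc m"]
    by simp
  also have "Gates (n + Suc m) (leaves ho n m) \<odot> (Units n \<oplus> Idt (Suc m)) \<odot> ?G \<odot> (Idt m \<oplus> nu)
    = (pow ho n \<oplus> Idt (Suc m)) \<odot> (Br m n \<oplus> Wr) \<odot> (Idt m \<oplus> ?Y) \<odot> ?G \<odot> (Idt m \<oplus> nu)"
    using comp_eq_tail(1)[OF leaves_out[OF ho, of m "Suc m" n]] by (simp add: dgY acomp_assoc)
  also have "(Idt n \<oplus> dg (Units m) \<oplus> dg Et) \<odot> \<dots>
     = (pow ho n \<oplus> dg Et) \<odot> ?Y \<odot> ((dg (Units m) \<oplus> Wr) \<odot> ?G) \<odot> (Idt m \<oplus> nu)"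
  proof -
    have Bn: "(Idt n \<oplus> dg (Units m)) \<odot> Br m n = dg (Units m) \<oplus> Idt n"
      using Br_natural[of "dg (Units m)" m 0 "Idt n" n n] by simp
    have "(Idt n \<oplus> dg (Units m) \<oplus> dg Et) \<odot> (pow ho n \<oplus> Idt (Suc m)) = (pow ho n \<oplus> dg Et) \<odot> (Idt n \<oplus> dg (Units m) \<oplus> Wr)"
      using ho tens_comp[of "pow ho n" n n "Idt n" n "dg (Units m) \<oplus> dg Et" "Idt (Suc m)"]
        tens_comp[of "Idt n" n n "pow ho n" n "dg Et" "dg (Units m) \<oplus> Wr"] slide(2)[of "dg (Units m)" m 0 "dg Et" 1 0]
      by simp
    moreover have "(Idt n \<oplus> dg (Units m) \<oplus> Wr) \<odot> (Br m n \<oplus> Wr) = dg (Units m) \<oplus> Idt (Suc n)"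
      using in_context(5)[OF Bn, of "Suc 0"] by (simp add: layers)
    moreover have "(dg (Units m) \<oplus> Idt (Suc n)) \<odot> (Idt m \<oplus> ?Y) = ?Y \<odot> (dg (Units m) \<oplus> Wr)"
      using slide[of "dg (Units m)" m 0 ?Y 1 "Suc n"] TY by simp
    ultimately show ?thesis by (metis acomp_assoc)
  qed
  also have "(dg (Units m) \<oplus> Wr) \<odot> ?G = Gr (Suc m) (Suc 0) 0 \<odot> (pow hi m \<oplus> Wr)"
    using leaves_in[OF hi, of 0 "Suc 0" m] by (simp add: Merges_hub)
  also have "(pow ho n \<oplus> dg Et) \<odot> ?Y \<odot> (Gr (Suc m) (Suc 0) 0 \<odot> (pow hi m \<oplus> Wr)) \<odot> (Idt m \<oplus> nu)
    = pow ho n \<odot> ((Idt n \<oplus> dg Et) \<odot> ?Y) \<odot> Gr (Suc m) (Suc 0) 0 \<odot> (Idt m \<oplus> nu) \<odot> pow hi m"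
    using slide[of "pow hi m" m m nu 0 1] slide(1)[of "pow ho n" n n "dg Et" 1 0] nu Thi ho
    by (simp add: acomp_assoc[symmetric]) (simp add: acomp_assoc)
  \<comment> \<open>The sum over the hub wire: its counit removes the surplus output of the copying
    spider.\<close>
  also have "(Idt n \<oplus> dg Et) \<odot> ?Y = Gr (Suc 0) n 0"
    using spider[of 1 n 0 0 0 1 0] by (simp add: Merges_hub)
  finally show ?thesis by simp
qed

section \<open>Hadamards on edges and the derived bending rules\<close>

lemma H_H: "Hd \<odot> Hd = Wr"
  using color_change[of 1 1 0] by simp

text \<open>Colour change for the spider with two outputs, which is the cup in both colours.\<close>

lemma HH_Cu: "(Hd \<oplus> Hd) \<odot> Cu = Cu"
  using color_change[of 2 0 0] Gr_cup Rd_cup by (simp add: numeral_2_eq_2)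

lemma H_Cu: "(Hd \<oplus> Wr) \<odot> Cu = (Wr \<oplus> Hd) \<odot> Cu"
proof -
  have "(Hd \<oplus> Wr) \<odot> Cu = (Hd \<oplus> Wr) \<odot> (Hd \<oplus> Hd) \<odot> Cu" by (simp add: HH_Cu)
  also have "\<dots> = ((Hd \<odot> Hd) \<oplus> Hd) \<odot> Cu"
    using tens_comp[of Hd 1 1 Hd 1 Wr Hd] by (simp flip: acomp_assoc)
  finally show ?thesis by (simp add: H_H)
qed

lemma bend_H: "(Ca \<oplus> Wr) \<odot> (Wr \<oplus> Hd \<oplus> Wr) \<odot> (Wr \<oplus> Cu) = Hd"
proof -
  have "(Ca \<oplus> Wr) \<odot> (Wr \<oplus> Hd \<oplus> Wr) \<odot> (Wr \<oplus> Cu) = (Ca \<oplus> Wr) \<odot> (Idt 2 \<oplus> Hd) \<odot> (Wr \<oplus> Cu)"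
    using in_context(4)[OF H_Cu, of "Suc 0"] by (simp add: layers numeral_2_eq_2)
  also have "\<dots> = Hd \<odot> (Ca \<oplus> Wr) \<odot> (Wr \<oplus> Cu)"
    using slide'[of Ca 2 0 Hd 1 1] by simp
  finally show ?thesis by (simp add: snake)
qed

lemma edge_sym_Wr: "edge_sym Wr"
proof -
  have "(Ca \<oplus> Wr) \<odot> (Sw \<oplus> Wr) \<odot> (Wr \<oplus> Cu) = (Ca \<oplus> Wr) \<odot> (Wr \<oplus> Cu)"
    using in_context(5)[OF Cap_Br[of "Suc 0"], of "Suc 0"] by (simp add: layers flip: acomp_assoc) 
  then show ?thesis by (simp add: edge_sym_def edge_def Sw_Cu snake Idt_tens_Idt)
qed

lemma edge_sym_H: "edge_sym Hd"
proof -
  have "(Ca \<oplus> Wr) \<odot> (Wr \<oplus> Sw) \<odot> (edge Hd \<oplus> Wr) = (Ca \<oplus> Wr) \<odot> (Wr \<oplus> Sw) \<odot> (Hd \<oplus> Idt 2) \<odot> (Cu \<oplus> Wr)"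
    by (simp add: edge_def layers numeral_2_eq_2)
  also have "\<dots> = (Ca \<oplus> Wr) \<odot> (Hd \<oplus> Idt 2) \<odot> (Wr \<oplus> Sw) \<odot> (Cu \<oplus> Wr)"
    using slide'(2)[of Hd 1 1 Sw 2 2] by simp
  also have "\<dots> = (Ca \<oplus> Wr) \<odot> (Hd \<oplus> Idt 2) \<odot> (Sw \<oplus> Wr) \<odot> (Wr \<oplus> Cu)" by (simp add: Sw_Cu)
  also have "\<dots> = (Ca \<oplus> Wr) \<odot> (((Hd \<oplus> Wr) \<odot> Sw) \<oplus> Wr) \<odot> (Wr \<oplus> Cu)" by (simp add: layers numeral_2_eq_2)
  also have "(Hd \<oplus> Wr) \<odot> Sw = Sw \<odot> (Wr \<oplus> Hd)" using Br_natural[of Wr 1 1 Hd 1 1] by simp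
  also have "(Ca \<oplus> Wr) \<odot> ((Sw \<odot> (Wr \<oplus> Hd)) \<oplus> Wr) \<odot> (Wr \<oplus> Cu) = ((Ca \<odot> Sw) \<oplus> Wr) \<odot> (Wr \<oplus> Hd \<oplus> Wr) \<odot> (Wr \<oplus> Cu)"
    by (simp add: layers)
  also have "\<dots> = Hd" using bend_H by (simp add: Cap_Br)
  finally show ?thesis by (simp add: edge_sym_def)
qed

lemma pow_Wr [simp]: "pow Wr n = Idt n"
  by (induction n) (simp_all add: Idt_tens_Idt)

lemma pow_H [simp]: "pow Hd n = Hds n"
  by (induction n) simp_all

text \<open>The cup is itself a phase-free green spider, so bending a leg is a fusion of
  spiders.\<close>

lemma Gr_bend_leg: "(Gr (m + 1) n a \<oplus> Wr) \<odot> (Idt m \<oplus> Cu) = Gr m (n + 1) a"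
  using spider'[of 1 m n a 1 0 0] Gr_cup by (simp add: numeral_2_eq_2)

lemma zx_cong_if_arr_eq: "abs_arr s = abs_arr t \<Longrightarrow> ty s \<noteq> None \<Longrightarrow> zx_cong s t"
  by (auto simp: arr.abs_eq_iff arr_eq_def)

lemma node_isotopy_cong: "node_isotopy s t \<Longrightarrow> zx_cong s t"
proof (induction rule: node_isotopy.induct)
  case (permute_legs p q m a) show ?case by (rule zx_cong.permute)
next
  case (bend_leg m n a)
  have "abs_arr ((Green (m + 1) n a \<otimes> Id 1) \<bullet> (Id m \<otimes> Cv 1)) = (Gr (m + 1) n a \<oplus> Wr) \<odot> (Idt m \<oplus> Cu)"
    by (simp add: acomp.abs_eq atens.abs_eq Gr.abs_eq Idt.abs_eq Cup.abs_eq)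
  then show ?case unfolding Gr_bend_leg
    by (intro zx_cong_if_arr_eq) (simp_all add: Gr.abs_eq)
next
  case bend_hadamard
  have "abs_arr ((Ev 1 \<otimes> Id 1) \<bullet> (Id 1 \<otimes> Had \<otimes> Id 1) \<bullet> (Id 1 \<otimes> Cv 1)) = (Ca \<oplus> Wr) \<odot> (Wr \<oplus> Hd \<oplus> Wr) \<odot> (Wr \<oplus> Cu)"
    by (simp add: acomp.abs_eq atens.abs_eq Hd.abs_eq Idt.abs_eq Cup.abs_eq Cap.abs_eq)
  then show ?case unfolding bend_H
    by (intro zx_cong_if_arr_eq) (simp_all add: Hd.abs_eq)
qed

text \<open>Later inductions run over \<open>zx_cong\<close>, which saves them the two bending
  cases.\<close>

lemma zx_eq_iff_cong: "zx_eq s t \<longleftrightarrow> zx_cong s t"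
proof
  show "zx_eq s t \<Longrightarrow> zx_cong s t"
    by (induction rule: zx_eq.induct) (auto intro: zx_cong.intros zx_cong.wire[simplified] node_isotopy_cong)
  show "zx_cong s t \<Longrightarrow> zx_eq s t"
    by (induction rule: zx_cong.induct) (auto intro: zx_eq.intros zx_eq.wire[simplified] node_isotopy.intros zx_eq.isotopy[OF permute_legs, simplified])
qed

section \<open>Isomorphisms of open graphs\<close>

abbreviation vs :: "sgraph \<Rightarrow> nat set" where "vs X \<equiv> verts (shape X)"
abbreviation es :: "sgraph \<Rightarrow> nat set" where "es X \<equiv> arcs (shape X)"
abbreviation src :: "sgraph \<Rightarrow> nat \<Rightarrow> nat" where "src X \<equiv> tail (shape X)"
abbreviation tgt :: "sgraph \<Rightarrow> nat \<Rightarrow> nat" where "tgt X \<equiv> head (shape X)"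
abbreviation vl :: "sgraph \<Rightarrow> nat \<Rightarrow> zx_node" where "vl X \<equiv> fst (over X)"
abbreviation el :: "sgraph \<Rightarrow> nat \<Rightarrow> zx_arrow" where "el X \<equiv> snd (over X)"

lemma wf_S_zx: "wf_digraph S_zx"
  by (auto simp: wf_digraph_def S_zx_def)

lemma slice_obj_iff:
  "slice_obj X \<longleftrightarrow> (\<forall>e\<in>es X. src X e \<in> vs X \<and> tgt X e \<in> vs X \<and> el X e \<in> arcs S_zx \<and>
     tail S_zx (el X e) = vl X (src X e) \<and> head S_zx (el X e) = vl X (tgt X e))"
  using wf_S_zx by (auto simp: slice_obj_def digraph_hom_def wf_digraph_def S_zx_def)

lemma slice_hom_iff:
  "slice_hom X Y h \<longleftrightarrow> slice_obj X \<and> slice_obj Y \<and>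
     (\<forall>v\<in>vs X. fst h v \<in> vs Y \<and> vl Y (fst h v) = vl X v) \<and>
     (\<forall>e\<in>es X. snd h e \<in> es Y \<and> src Y (snd h e) = fst h (src X e) \<and> tgt Y (snd h e) = fst h (tgt X e)
        \<and> el Y (snd h e) = el X e)"
  by (auto simp: slice_hom_def digraph_hom_def slice_obj_def)

lemma N_zx_simps [simp]: "vs (N_zx n) = {1..n}" "es (N_zx n) = {}" "vl (N_zx n) = (\<lambda>_. White)"
  "el (N_zx n) = (\<lambda>_. WhiteLoop)"
  by (simp_all add: N_zx_def)

lemma slice_obj_N_zx [simp]: "slice_obj (N_zx n)"
  by (simp add: slice_obj_iff)

lemma open_graph_iff:
  "open_graph f \<longleftrightarrow> slice_obj (apex f) \<and>
     (\<forall>i\<in>{1..ins f}. inp f i \<in> vs (apex f) \<and> vl (apex f) (inp f i) = White) \<and>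
     (\<forall>i\<in>{1..outs f}. outp f i \<in> vs (apex f) \<and> vl (apex f) (outp f i) = White)"
  by (auto simp: open_graph_def slice_hom_iff)

lemma slice_hom_N_zx:
  assumes "slice_obj X" "\<And>i. 1 \<le> i \<Longrightarrow> i \<le> n \<Longrightarrow> p i \<in> vs X \<and> vl X (p i) = White"
  shows "slice_hom (N_zx n) X (p, q)"
  using assms by (simp add: slice_hom_iff)

section \<open>Universal maps out of gluings and disjoint unions\<close>

definition copair :: "smap \<Rightarrow> smap \<Rightarrow> smap" where
  "copair p q = (sum_map (fst p) (fst q), sum_map (snd p) (snd q))"

definition mcomp :: "smap \<Rightarrow> smap \<Rightarrow> smap" where
  "mcomp k h = (\<lambda>x. fst k (fst h x), \<lambda>x. snd k (snd h x))"

definition c1 :: "ograph \<Rightarrow> ograph \<Rightarrow> smap" where "c1 g f = (\<lambda>x. glue g f (inl x), inl)"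
definition c2 :: "ograph \<Rightarrow> ograph \<Rightarrow> smap" where "c2 g f = (\<lambda>x. glue g f (inr x), inr)"
definition t1 :: smap where "t1 = (inl, inl)"
definition t2 :: smap where "t2 = (inr, inr)"

lemma sum_map_simps [simp]: "sum_map f g (inl x) = f x" "sum_map f g (inr y) = g y"
  by (simp_all add: sum_map_def)

lemma inl_inr [simp]: "inl x = inl y \<longleftrightarrow> x = y" "inr x = inr y \<longleftrightarrow> x = y" "inl x \<noteq> inr y" "inr y \<noteq> inl x"
  by (simp_all add: sum_encode_eq)

lemma smap_simps [simp]:
  "fst (copair p q) (inl x) = fst p x" "snd (copair p q) (inl y) = snd p y"
  "fst (copair p q) (inr x) = fst q x" "snd (copair p q) (inr y) = snd q y"
  "fst (mcomp k h) x = fst k (fst h x)" "snd (mcomp k h) x = snd k (snd h x)"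
  "fst (c1 g f) x = glue g f (inl x)" "snd (c1 g f) = inl"
  "fst (c2 g f) x = glue g f (inr x)" "snd (c2 g f) = inr"
  "fst t1 = inl" "snd t1 = inl" "fst t2 = inr" "snd t2 = inr"
  by (simp_all add: copair_def mcomp_def c1_def c2_def t1_def t2_def)

definition ports_rel :: "ograph \<Rightarrow> ograph \<Rightarrow> nat \<Rightarrow> nat \<Rightarrow> bool" where
  "ports_rel g f x y \<longleftrightarrow> (\<exists>i\<in>{1..outs f}. x = inl (outp f i) \<and> y = inr (inp g i))"

lemma glue_Least: "glue g f z = (LEAST w. equivclp (ports_rel g f) z w)"
  by (simp add: glue_def ports_rel_def[abs_def])

lemma glue_eqv: "equivclp (ports_rel g f) z (glue g f z)"
  unfolding glue_Least by (rule LeastI) (rule equivclp_refl)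

lemma glue_cong:
  assumes "equivclp (ports_rel g f) z z'"
  shows "glue g f z = glue g f z'"
proof -
  have "equivclp (ports_rel g f) z w \<longleftrightarrow> equivclp (ports_rel g f) z' w" for w
    using assms equivclp_trans[OF assms, of w] equivclp_trans[OF equivclp_sym[OF assms], of w] by blast
  then show ?thesis by (simp add: glue_Least)
qed

lemma glue_port [simp]:
  "1 \<le> i \<Longrightarrow> i \<le> outs f \<Longrightarrow> glue g f (inl (outp f i)) = glue g f (inr (inp g i))"
  by (rule glue_cong, rule r_into_equivclp) (auto simp: ports_rel_def)

text \<open>The universal property of the gluing in terms of representatives: a compatible pair of
  maps is constant along \<open>ports_rel\<close>, hence on its equivalence classes.\<close>

lemma sum_map_glue [simp]:
  assumes "\<And>i. 1 \<le> i \<Longrightarrow> i \<le> outs f \<Longrightarrow> p (outp f i) = q (inp g i)"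
  shows "sum_map p q (glue g f z) = sum_map p q z"
proof -
  have "equivclp (ports_rel g f) z w \<Longrightarrow> sum_map p q w = sum_map p q z" for w
    by (induction rule: equivclp_induct) (use assms in \<open>auto simp: ports_rel_def\<close>)
  then show ?thesis using glue_eqv by blast
qed

lemma copair_glue:
  assumes "\<And>i. 1 \<le> i \<Longrightarrow> i \<le> outs f \<Longrightarrow> fst p (outp f i) = fst q (inp g i)"
  shows "fst (copair p q) (glue g f z) = fst (copair p q) z"
  unfolding copair_def fst_conv using assms by (rule sum_map_glue)

lemma og_comp_simps [simp]:
  "ins (og_comp g f) = ins f" "outs (og_comp g f) = outs g"
  "inp (og_comp g f) i = glue g f (inl (inp f i))" "outp (og_comp g f) i = glue g f (inr (outp g i))"
  "vs (apex (og_comp g f)) = glue g f ` (inl ` vs (apex f) \<union> inr ` vs (apex g))"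
  "es (apex (og_comp g f)) = inl ` es (apex f) \<union> inr ` es (apex g)"
  "src (apex (og_comp g f)) e = glue g f (sum_map (\<lambda>e. inl (src (apex f) e)) (\<lambda>e. inr (src (apex g) e)) e)"
  "tgt (apex (og_comp g f)) e = glue g f (sum_map (\<lambda>e. inl (tgt (apex f) e)) (\<lambda>e. inr (tgt (apex g) e)) e)"
  "vl (apex (og_comp g f)) = sum_map (vl (apex f)) (vl (apex g))"
  "el (apex (og_comp g f)) = sum_map (el (apex f)) (el (apex g))"
  by (simp_all add: og_comp_def disjoint_union_def Let_def)

lemma og_tens_simps [simp]:
  "ins (og_tens f g) = ins f + ins g" "outs (og_tens f g) = outs f + outs g"
  "inp (og_tens f g) i = (if i \<le> ins f then inl (inp f i) else inr (inp g (i - ins f)))"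
  "outp (og_tens f g) i = (if i \<le> outs f then inl (outp f i) else inr (outp g (i - outs f)))"
  "vs (apex (og_tens f g)) = inl ` vs (apex f) \<union> inr ` vs (apex g)"
  "es (apex (og_tens f g)) = inl ` es (apex f) \<union> inr ` es (apex g)"
  "src (apex (og_tens f g)) e = sum_map (\<lambda>e. inl (src (apex f) e)) (\<lambda>e. inr (src (apex g) e)) e"
  "tgt (apex (og_tens f g)) e = sum_map (\<lambda>e. inl (tgt (apex f) e)) (\<lambda>e. inr (tgt (apex g) e)) e"
  "vl (apex (og_tens f g)) = sum_map (vl (apex f)) (vl (apex g))"
  "el (apex (og_tens f g)) = sum_map (el (apex f)) (el (apex g))"
  by (simp_all add: og_tens_def disjoint_union_def)

lemma open_graph_port:
  assumes "open_graph f"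
  shows "slice_obj (apex f)"
    "1 \<le> i \<Longrightarrow> i \<le> ins f \<Longrightarrow> inp f i \<in> vs (apex f)" "1 \<le> i \<Longrightarrow> i \<le> ins f \<Longrightarrow> vl (apex f) (inp f i) = White"
    "1 \<le> i \<Longrightarrow> i \<le> outs f \<Longrightarrow> outp f i \<in> vs (apex f)" "1 \<le> i \<Longrightarrow> i \<le> outs f \<Longrightarrow> vl (apex f) (outp f i) = White"
  using assms by (auto simp: open_graph_iff)

definition composable :: "ograph \<Rightarrow> ograph \<Rightarrow> bool" where
  "composable g f \<longleftrightarrow> open_graph f \<and> open_graph g \<and> outs f = ins g"

lemma composableD:
  "composable g f \<Longrightarrow> open_graph f" "composable g f \<Longrightarrow> open_graph g" "composable g f \<Longrightarrow> outs f = ins g"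
  by (auto simp: composable_def)

text \<open>Only ports are identified and ports are white, so the labelling descends to the glued
  graph.\<close>

lemma vl_glue:
  assumes "composable g f"
  shows "sum_map (vl (apex f)) (vl (apex g)) (glue g f z) = sum_map (vl (apex f)) (vl (apex g)) z"
  by (rule sum_map_glue) (use assms in \<open>simp add: composable_def open_graph_port\<close>)

lemma slice_obj_comp: "composable g f \<Longrightarrow> slice_obj (apex (og_comp g f))"
  using vl_glue[of g f] by (auto simp: slice_obj_iff composable_def open_graph_iff)

lemma open_comp: "composable g f \<Longrightarrow> open_graph (og_comp g f)"
  using vl_glue[of g f] slice_obj_comp[of g f] by (auto simp: open_graph_iff composable_def)

lemma open_tens:
  assumes "open_graph f" "open_graph g"
  shows "open_graph (og_tens f g)"
proof -
  note f = open_graph_port[OF assms(1)] and g = open_graph_port[OF assms(2)]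
  have "slice_obj (apex (og_tens f g))"
    using f(1) g(1) by (auto simp: slice_obj_iff)
  then show ?thesis by (auto simp: open_graph_iff f(2-) g(2-))
qed

lemma hom_c1: "composable g f \<Longrightarrow> slice_hom (apex f) (apex (og_comp g f)) (c1 g f)"
  using vl_glue[of g f] slice_obj_comp[of g f] open_graph_port(1)[of f]
  by (auto simp: slice_hom_iff composable_def)

lemma hom_c2: "composable g f \<Longrightarrow> slice_hom (apex g) (apex (og_comp g f)) (c2 g f)"
  using vl_glue[of g f] slice_obj_comp[of g f] open_graph_port(1)[of g]
  by (auto simp: slice_hom_iff composable_def)

lemma hom_t1: "open_graph f \<Longrightarrow> open_graph g \<Longrightarrow> slice_hom (apex f) (apex (og_tens f g)) t1"
  using open_graph_port(1)[OF open_tens[of f g]] open_graph_port(1)[of f] by (auto simp: slice_hom_iff)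

lemma hom_t2: "open_graph f \<Longrightarrow> open_graph g \<Longrightarrow> slice_hom (apex g) (apex (og_tens f g)) t2"
  using open_graph_port(1)[OF open_tens[of f g]] open_graph_port(1)[of g] by (auto simp: slice_hom_iff)

lemma hom_mcomp: "slice_hom X Y h \<Longrightarrow> slice_hom Y Z k \<Longrightarrow> slice_hom X Z (mcomp k h)"
  unfolding slice_hom_iff slice_obj_iff by auto

lemma hom_id: "slice_obj X \<Longrightarrow> slice_hom X X (id, id)"
  by (simp add: slice_hom_iff)

lemma hom_comp:
  assumes "composable g f" "slice_hom (apex f) X p" "slice_hom (apex g) X q"
    and "\<And>i. 1 \<le> i \<Longrightarrow> i \<le> outs f \<Longrightarrow> fst p (outp f i) = fst q (inp g i)"
  shows "slice_hom (apex (og_comp g f)) X (copair p q)"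
proof -
  have "fst (copair p q) (glue g f z) = fst (copair p q) z" for z
    using assms(4) by (rule copair_glue)
  then show ?thesis
    using assms slice_obj_comp[of g f] vl_glue[of g f]
    unfolding slice_hom_iff slice_obj_iff by auto
qed

lemma hom_tens:
  assumes "open_graph f" "open_graph g" "slice_hom (apex f) X p" "slice_hom (apex g) X q"
  shows "slice_hom (apex (og_tens f g)) X (copair p q)"
  using assms open_graph_port(1)[OF open_tens[of f g]]
  unfolding slice_hom_iff slice_obj_iff by auto

section \<open>Isomorphism of open graphs\<close>

definition og_iso :: "ograph \<Rightarrow> ograph \<Rightarrow> bool"  (infix "\<cong>" 50) where
  "f \<cong> g \<longleftrightarrow> (\<exists>h. cospan_iso f g h)"

lemma cospan_map_iff:
  "cospan_map f g h \<longleftrightarrow> open_graph f \<and> open_graph g \<and> ins f = ins g \<and> outs f = outs g \<and>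
     slice_hom (apex f) (apex g) h \<and> (\<forall>i. 1 \<le> i \<longrightarrow> i \<le> ins f \<longrightarrow> fst h (inp f i) = inp g i) \<and>
     (\<forall>j. 1 \<le> j \<longrightarrow> j \<le> outs f \<longrightarrow> fst h (outp f j) = outp g j)"
  by (auto simp: cospan_map_def)

text \<open>The inverse is given explicitly: for composites both directions are then copairings, and
  bijectivity need not be argued separately.\<close>

definition iso_pair :: "ograph \<Rightarrow> ograph \<Rightarrow> smap \<Rightarrow> smap \<Rightarrow> bool" where
  "iso_pair f g h k \<longleftrightarrow> open_graph f \<and> open_graph g \<and> ins f = ins g \<and> outs f = outs g \<and>
    slice_hom (apex f) (apex g) h \<and> slice_hom (apex g) (apex f) k \<and>
    (\<forall>v\<in>vs (apex f). fst k (fst h v) = v) \<and> (\<forall>v\<in>vs (apex g). fst h (fst k v) = v) \<and>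
    (\<forall>e\<in>es (apex f). snd k (snd h e) = e) \<and> (\<forall>e\<in>es (apex g). snd h (snd k e) = e) \<and>
    (\<forall>i. 1 \<le> i \<longrightarrow> i \<le> ins f \<longrightarrow> fst h (inp f i) = inp g i \<and> fst k (inp g i) = inp f i) \<and>
    (\<forall>i. 1 \<le> i \<longrightarrow> i \<le> outs f \<longrightarrow> fst h (outp f i) = outp g i \<and> fst k (outp g i) = outp f i)"

lemma iso_pair_imp: "iso_pair f g h k \<Longrightarrow> cospan_iso f g h"
proof -
  assume iso: "iso_pair f g h k"
  have "bij_betw (fst h) (vs (apex f)) (vs (apex g))"
    using iso by (intro bij_betw_byWitness[where f' = "fst k"]) (auto simp: slice_hom_iff iso_pair_def)
  moreover have "bij_betw (snd h) (es (apex f)) (es (apex g))"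
    using iso by (intro bij_betw_byWitness[where f' = "snd k"]) (auto simp: slice_hom_iff iso_pair_def)
  ultimately show ?thesis
    using iso unfolding cospan_iso_def cospan_map_iff slice_iso_def iso_pair_def by blast
qed

lemma og_isoI:
  assumes "open_graph f" "open_graph g" "ins f = ins g" "outs f = outs g"
    and "slice_hom (apex f) (apex g) h" "slice_hom (apex g) (apex f) k"
    and "\<And>v. v \<in> vs (apex f) \<Longrightarrow> fst k (fst h v) = v" "\<And>v. v \<in> vs (apex g) \<Longrightarrow> fst h (fst k v) = v"
    and "\<And>e. e \<in> es (apex f) \<Longrightarrow> snd k (snd h e) = e" "\<And>e. e \<in> es (apex g) \<Longrightarrow> snd h (snd k e) = e"
    and "\<And>i. 1 \<le> i \<Longrightarrow> i \<le> ins f \<Longrightarrow> fst h (inp f i) = inp g i"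
    and "\<And>i. 1 \<le> i \<Longrightarrow> i \<le> outs f \<Longrightarrow> fst h (outp f i) = outp g i"
  shows "f \<cong> g"
proof -
  have "fst k (inp g i) = inp f i" if "1 \<le> i" "i \<le> ins f" for i
    using assms(7)[of "inp f i"] assms(11)[OF that] open_graph_port(2)[OF assms(1) that] by simp
  moreover have "fst k (outp g i) = outp f i" if "1 \<le> i" "i \<le> outs f" for i
    using assms(7)[of "outp f i"] assms(12)[OF that] open_graph_port(4)[OF assms(1) that] by simp
  ultimately have "iso_pair f g h k"
    using assms unfolding iso_pair_def by blast
  then show ?thesis using iso_pair_imp unfolding og_iso_def by blast
qed

lemma og_isoE:
  assumes "f \<cong> g"
  obtains h k where "iso_pair f g h k"
proof -
  obtain h where iso: "cospan_map f g h" "slice_iso (apex f) (apex g) h"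
    using assms by (auto simp: og_iso_def cospan_iso_def)
  then have hom: "slice_hom (apex f) (apex g) h"
    and bij: "bij_betw (fst h) (vs (apex f)) (vs (apex g))" "bij_betw (snd h) (es (apex f)) (es (apex g))"
    by (auto simp: slice_iso_def)
  define k where "k = (inv_into (vs (apex f)) (fst h), inv_into (es (apex f)) (snd h))"
  have kv: "fst k (fst h v) = v" if "v \<in> vs (apex f)" for v
    using that bij by (simp add: k_def bij_betw_def)
  have ke: "snd k (snd h e) = e" if "e \<in> es (apex f)" for e
    using that bij by (simp add: k_def bij_betw_def)
  have hv: "fst h (fst k v) = v" "fst k v \<in> vs (apex f)" if "v \<in> vs (apex g)" for v
    using that bij_betw_inv_into_right[OF bij(1) that] bij_betw_apply[OF bij_betw_inv_into[OF bij(1)] that]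
    by (auto simp: k_def)
  have he: "snd h (snd k e) = e" "snd k e \<in> es (apex f)" if "e \<in> es (apex g)" for e
    using that bij_betw_inv_into_right[OF bij(2) that] bij_betw_apply[OF bij_betw_inv_into[OF bij(2)] that]
    by (auto simp: k_def)
  have "slice_hom (apex g) (apex f) k"
    unfolding slice_hom_iff
  proof (intro conjI ballI)
    show "slice_obj (apex g)" "slice_obj (apex f)" using hom by (auto simp: slice_hom_iff)
    fix v assume v: "v \<in> vs (apex g)"
    show "fst k v \<in> vs (apex f)" using hv[OF v] by simp
    have "vl (apex g) (fst h (fst k v)) = vl (apex f) (fst k v)"
      using hom hv(2)[OF v] by (simp add: slice_hom_iff)
    then show "vl (apex f) (fst k v) = vl (apex g) v" using hv(1)[OF v] by simp
  next
    fix e assume e: "e \<in> es (apex g)"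
    show "snd k e \<in> es (apex f)" using he[OF e] by simp
    have m: "src (apex f) (snd k e) \<in> vs (apex f)" "tgt (apex f) (snd k e) \<in> vs (apex f)"
      using he[OF e] hom by (auto simp: slice_hom_iff slice_obj_iff)
    have "src (apex g) (snd h (snd k e)) = fst h (src (apex f) (snd k e))"
      "tgt (apex g) (snd h (snd k e)) = fst h (tgt (apex f) (snd k e))"
      "el (apex g) (snd h (snd k e)) = el (apex f) (snd k e)"
      using hom he(2)[OF e] by (auto simp: slice_hom_iff)
    then show "src (apex f) (snd k e) = fst k (src (apex g) e)" "tgt (apex f) (snd k e) = fst k (tgt (apex g) e)"
      "el (apex f) (snd k e) = el (apex g) e"
      using he(1)[OF e] kv[OF m(1)] kv[OF m(2)] by auto
  qed
  moreover have "fst k (inp g i) = inp f i" if "1 \<le> i" "i \<le> ins f" for i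
    using iso that kv[of "inp f i"] by (auto simp: cospan_map_iff open_graph_iff)
  moreover have "fst k (outp g i) = outp f i" if "1 \<le> i" "i \<le> outs f" for i
    using iso that kv[of "outp f i"] by (auto simp: cospan_map_iff open_graph_iff)
  ultimately show ?thesis
    using iso hom kv ke hv he by (intro that[of h k]) (auto simp: cospan_map_iff iso_pair_def)
qed

lemma og_iso_refl: "open_graph f \<Longrightarrow> f \<cong> f"
  by (rule og_isoI[of _ _ "(id, id)" "(id, id)"]) (auto intro: hom_id open_graph_port)

lemma og_iso_sym: "f \<cong> g \<Longrightarrow> g \<cong> f"
  by (erule og_isoE, rule og_isoI) (auto simp: iso_pair_def)

lemma og_iso_trans [trans]:
  assumes "f \<cong> g" "g \<cong> h" shows "f \<cong> h"
proof -
  from assms obtain p q r s where "iso_pair f g p q" "iso_pair g h r s"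
    by (meson og_isoE)
  then show ?thesis
    by (intro og_isoI[of _ _ "mcomp r p" "mcomp q s"])
      (auto intro: hom_mcomp simp: slice_hom_iff iso_pair_def)
qed

lemma og_iso_open: "f \<cong> g \<Longrightarrow> open_graph f" "f \<cong> g \<Longrightarrow> open_graph g"
  and og_iso_ins: "f \<cong> g \<Longrightarrow> ins f = ins g" and og_iso_outs: "f \<cong> g \<Longrightarrow> outs f = outs g"
  by (auto elim!: og_isoE simp: iso_pair_def)

lemma comp_iso_cong:
  assumes "f \<cong> f'" "g \<cong> g'" "outs f = ins g"
  shows "og_comp g f \<cong> og_comp g' f'"
proof -
  from assms obtain p q r s where 1: "iso_pair f f' p q" and 2: "iso_pair g g' r s"
    by (meson og_isoE)
  have c: "composable g f" "composable g' f'" using 1 2 assms by (auto simp: composable_def iso_pair_def)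
  have h: "slice_hom (apex f) (apex f') p" "slice_hom (apex f') (apex f) q"
    "slice_hom (apex g) (apex g') r" "slice_hom (apex g') (apex g) s"
    using 1 2 by (auto simp: iso_pair_def)
  have a: "fst (mcomp (c1 g' f') p) (outp f i) = fst (mcomp (c2 g' f') r) (inp g i)" if "1 \<le> i" "i \<le> outs f" for i
    using that 1 2 assms by (simp add: iso_pair_def)
  have a': "fst (mcomp (c1 g f) q) (outp f' i) = fst (mcomp (c2 g f) s) (inp g' i)" if "1 \<le> i" "i \<le> outs f'" for i
    using that 1 2 assms by (simp add: iso_pair_def)
  note G = copair_glue[where p = "mcomp (c1 g' f') p", OF a] copair_glue[where p = "mcomp (c1 g f) q", OF a']
  show ?thesis
    by (rule og_isoI[of _ _ "copair (mcomp (c1 g' f') p) (mcomp (c2 g' f') r)" "copair (mcomp (c1 g f) q) (mcomp (c2 g f) s)"])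
      (use 1 2 assms(3) G in \<open>auto intro!: open_comp hom_comp c hom_mcomp[OF h(1) hom_c1] hom_mcomp[OF h(2) hom_c1]
         hom_mcomp[OF h(3) hom_c2] hom_mcomp[OF h(4) hom_c2] simp: iso_pair_def\<close>)
qed

lemma tens_iso_cong:
  assumes "f \<cong> f'" "g \<cong> g'"
  shows "og_tens f g \<cong> og_tens f' g'"
proof -
  from assms obtain p q r s where 1: "iso_pair f f' p q" and 2: "iso_pair g g' r s"
    by (meson og_isoE)
  have h: "slice_hom (apex f) (apex f') p" "slice_hom (apex f') (apex f) q"
    "slice_hom (apex g) (apex g') r" "slice_hom (apex g') (apex g) s"
    using 1 2 by (auto simp: iso_pair_def)
  show ?thesis
    by (rule og_isoI[of _ _ "copair (mcomp t1 p) (mcomp t2 r)" "copair (mcomp t1 q) (mcomp t2 s)"])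
      (use 1 2 in \<open>auto intro!: open_tens hom_tens hom_mcomp[OF h(1) hom_t1] hom_mcomp[OF h(2) hom_t1]
         hom_mcomp[OF h(3) hom_t2] hom_mcomp[OF h(4) hom_t2] simp: iso_pair_def\<close>)
qed

text \<open>Both sides are colimits of the same diagram, so the maps in both directions are
  copairings of coprojections. The facts \<open>GQ\<close>, \<open>GP\<close>, \<open>GH\<close> and
  \<open>GK\<close> let these be evaluated under \<open>glue\<close>.\<close>

lemma comp_assoc_iso:
  assumes "composable g f" "composable h g"
  shows "og_comp (og_comp h g) f \<cong> og_comp h (og_comp g f)"
proof -
  note o = composableD[OF assms(1)] composableD[OF assms(2)]
  have hg_f: "composable (og_comp h g) f" and h_gf: "composable h (og_comp g f)"
    using o assms by (auto simp: composable_def intro: open_comp)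
  let ?p = "mcomp (c1 h (og_comp g f)) (c1 g f)" and ?q = "mcomp (c1 h (og_comp g f)) (c2 g f)"
  let ?s = "mcomp (c2 (og_comp h g) f) (c1 h g)" and ?t = "mcomp (c2 (og_comp h g) f) (c2 h g)"
  let ?Q = "copair ?q (c2 h (og_comp g f))" and ?P = "copair (c1 (og_comp h g) f) ?s"
  have aQ: "fst ?q (outp g i) = fst (c2 h (og_comp g f)) (inp h i)" if "1 \<le> i" "i \<le> outs g" for i
    using glue_port[of i "og_comp g f" h] that by simp
  have aP: "fst (c1 (og_comp h g) f) (outp f i) = fst ?s (inp g i)" if "1 \<le> i" "i \<le> outs f" for i
    using glue_port[of i f "og_comp h g"] that by simp
  have GQ: "fst ?Q (glue h g z) = fst ?Q z" for z using aQ by (rule copair_glue)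
  have GP: "fst ?P (glue g f z) = fst ?P z" for z using aP by (rule copair_glue)
  have aH: "fst ?p (outp f i) = fst ?Q (inp (og_comp h g) i)" if "1 \<le> i" "i \<le> outs f" for i
    using that by (simp add: GQ)
  have aK: "fst ?P (outp (og_comp g f) i) = fst ?t (inp h i)" if "1 \<le> i" "i \<le> outs (og_comp g f)" for i
    using that by (simp add: GP)
  have GH: "fst (copair ?p ?Q) (glue (og_comp h g) f z) = fst (copair ?p ?Q) z" for z
    using aH by (rule copair_glue)
  have GK: "fst (copair ?P ?t) (glue h (og_comp g f) z) = fst (copair ?P ?t) z" for z
    using aK by (rule copair_glue)
  have hom: "slice_hom (apex (og_comp h g)) (apex (og_comp h (og_comp g f))) ?Q"
    by (intro hom_comp assms hom_mcomp[OF hom_c2 hom_c1] hom_c2 h_gf aQ)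
  have hom': "slice_hom (apex (og_comp g f)) (apex (og_comp (og_comp h g) f)) ?P"
    by (intro hom_comp assms hom_mcomp[OF hom_c1 hom_c2] hom_c1 hg_f aP)
  have H: "slice_hom (apex (og_comp (og_comp h g) f)) (apex (og_comp h (og_comp g f))) (copair ?p ?Q)"
    by (intro hom_comp hg_f hom hom_mcomp[OF hom_c1 hom_c1] assms h_gf aH)
  have K: "slice_hom (apex (og_comp h (og_comp g f))) (apex (og_comp (og_comp h g) f)) (copair ?P ?t)"
    by (intro hom_comp h_gf hom' hom_mcomp[OF hom_c2 hom_c2] assms hg_f aK)
  show ?thesis
    by (rule og_isoI[OF open_comp[OF hg_f] open_comp[OF h_gf] _ _ H K]) (auto simp: GQ GP GH GK)
qed

lemma tens_assoc_iso:
  assumes "open_graph f" "open_graph g" "open_graph h"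
  shows "og_tens (og_tens f g) h \<cong> og_tens f (og_tens g h)"
proof -
  have o: "open_graph (og_tens f g)" "open_graph (og_tens g h)" using assms by (auto intro: open_tens)
  note r = hom_mcomp[OF hom_t1 hom_t1] hom_mcomp[OF hom_t1 hom_t2] hom_mcomp[OF hom_t2 hom_t1] hom_mcomp[OF hom_t2 hom_t2]
  show ?thesis
    by (rule og_isoI[of _ _ "copair (copair t1 (mcomp t2 t1)) (mcomp t2 t2)" "copair (mcomp t1 t1) (copair (mcomp t1 t2) t2)"])
      (use assms o in \<open>auto intro!: open_tens hom_tens r hom_t1 hom_t2\<close>)
qed

section \<open>Interchange, braiding and compact structure up to isomorphism\<close>

lemma tens_comp_iso:
  assumes "composable g f" "composable g' f'"
  shows "og_tens (og_comp g f) (og_comp g' f') \<cong> og_comp (og_tens g g') (og_tens f f')"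
proof -
  note o = composableD[OF assms(1)] composableD[OF assms(2)]
  let ?g = "og_tens g g'" and ?f = "og_tens f f'"
  have c: "composable ?g ?f" using o by (auto simp: composable_def intro: open_tens)
  have port: "glue ?g ?f (inl (inl (outp f i))) = glue ?g ?f (inr (inl (inp g i)))"
    if "1 \<le> i" "i \<le> ins g" for i
    using glue_port[of i ?f ?g] that o by simp
  have port': "glue ?g ?f (inl (inr (outp f' i))) = glue ?g ?f (inr (inr (inp g' i)))"
    if "1 \<le> i" "i \<le> ins g'" for i
    using glue_port[of "ins g + i" ?f ?g] that o by simp
  note r = hom_mcomp[OF hom_t1 hom_c1] hom_mcomp[OF hom_t2 hom_c1] hom_mcomp[OF hom_t1 hom_c2] hom_mcomp[OF hom_t2 hom_c2]
  note r' = hom_mcomp[OF hom_c1 hom_t1] hom_mcomp[OF hom_c2 hom_t1] hom_mcomp[OF hom_c1 hom_t2] hom_mcomp[OF hom_c2 hom_t2]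
  have a: "fst (mcomp (c1 ?g ?f) t1) (outp f i) = fst (mcomp (c2 ?g ?f) t1) (inp g i)" if "1 \<le> i" "i \<le> outs f" for i
    using port that o by simp
  have a': "fst (mcomp (c1 ?g ?f) t2) (outp f' i) = fst (mcomp (c2 ?g ?f) t2) (inp g' i)" if "1 \<le> i" "i \<le> outs f'" for i
    using port' that o by simp
  have b: "fst (copair (mcomp t1 (c1 g f)) (mcomp t2 (c1 g' f'))) (outp ?f i)
      = fst (copair (mcomp t1 (c2 g f)) (mcomp t2 (c2 g' f'))) (inp ?g i)" if "1 \<le> i" "i \<le> outs ?f" for i
  proof (cases "i \<le> outs f")
    case False
    then show ?thesis using that o glue_port[of "i - outs f" f' g'] by simp
  qed (use that o in simp)
  note G = copair_glue[where p = "mcomp (c1 ?g ?f) t1", OF a] copair_glue[where p = "mcomp (c1 ?g ?f) t2", OF a']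
    copair_glue[where p = "copair (mcomp t1 (c1 g f)) (mcomp t2 (c1 g' f'))", OF b]
  show ?thesis
    by (rule og_isoI[of _ _
          "copair (copair (mcomp (c1 ?g ?f) t1) (mcomp (c2 ?g ?f) t1)) (copair (mcomp (c1 ?g ?f) t2) (mcomp (c2 ?g ?f) t2))"
          "copair (copair (mcomp t1 (c1 g f)) (mcomp t2 (c1 g' f'))) (copair (mcomp t1 (c2 g f)) (mcomp t2 (c2 g' f')))"])
      (use o c assms port port' G in \<open>auto intro!: open_tens open_comp hom_tens hom_comp r r' b\<close>)
qed

text \<open>An edgeless cospan with an identity as input leg, that is, a function taken backwards
  from outputs to inputs. Identities and braidings have this form, which reduces their laws to
  arithmetic of port numbers.\<close>

definition pg :: "nat \<Rightarrow> nat \<Rightarrow> (nat \<Rightarrow> nat) \<Rightarrow> ograph" where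
  "pg k l \<phi> = \<lparr> ins = k, outs = l, apex = N_zx k, inp = id, outp = \<phi> \<rparr>"

lemma pg_simps [simp]: "ins (pg k l \<phi>) = k" "outs (pg k l \<phi>) = l" "apex (pg k l \<phi>) = N_zx k"
  "inp (pg k l \<phi>) = id" "outp (pg k l \<phi>) = \<phi>"
  by (simp_all add: pg_def)

definition range_ok :: "nat \<Rightarrow> nat \<Rightarrow> (nat \<Rightarrow> nat) \<Rightarrow> bool" where
  "range_ok k l \<phi> \<longleftrightarrow> (\<forall>i. 1 \<le> i \<longrightarrow> i \<le> l \<longrightarrow> 1 \<le> \<phi> i \<and> \<phi> i \<le> k)"

lemma range_okD: "range_ok k l \<phi> \<Longrightarrow> 1 \<le> i \<Longrightarrow> i \<le> l \<Longrightarrow> 1 \<le> \<phi> i \<and> \<phi> i \<le> k"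
  by (auto simp: range_ok_def)

lemma open_pg: "range_ok k l \<phi> \<Longrightarrow> open_graph (pg k l \<phi>)"
  by (auto simp: open_graph_iff range_ok_def)

text \<open>A pushout along an identity: the apex stays and only the output leg is rerouted.\<close>

lemma pg_comp_iso:
  assumes f: "open_graph f" "outs f = k" and \<phi>: "range_ok k l \<phi>"
  shows "og_comp (pg k l \<phi>) f \<cong> f \<lparr> outs := l, outp := outp f \<circ> \<phi> \<rparr>"
proof -
  have c: "composable (pg k l \<phi>) f" using f \<phi> open_pg by (auto simp: composable_def)
  have port: "glue (pg k l \<phi>) f (inl (outp f i)) = glue (pg k l \<phi>) f (inr i)" if "1 \<le> i" "i \<le> k" for i
    using glue_port[of i f "pg k l \<phi>"] that f by simp
  have "open_graph (f \<lparr> outs := l, outp := outp f \<circ> \<phi> \<rparr>)"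
    using f range_okD[OF \<phi>] by (auto simp: open_graph_iff)
  moreover have "slice_hom (N_zx k) (apex f) (outp f, id)"
    using f by (intro slice_hom_N_zx) (auto simp: open_graph_port)
  moreover have "fst (copair (id, id) (outp f, id)) (glue (pg k l \<phi>) f z) = fst (copair (id, id) (outp f, id)) z" for z
    by (rule copair_glue) simp
  ultimately show ?thesis
    by (intro og_isoI[of _ _ "copair (id, id) (outp f, id)" "c1 (pg k l \<phi>) f"])
      (use c f port range_okD[OF \<phi>] in \<open>auto intro!: open_comp hom_comp hom_id hom_c1 simp: open_graph_port\<close>)
qed

text \<open>On this side the leg being glued is \<open>\<phi>\<close>, which has to be a bijection
  for the apex to stay; its inverse \<open>\<psi>\<close> tells where each input arrives.\<close>

lemma comp_pg_iso:
  assumes f: "open_graph f" "ins f = l" and \<phi>: "range_ok k l \<phi>" and \<psi>: "range_ok l k \<psi>"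
    and inv: "\<And>i. 1 \<le> i \<Longrightarrow> i \<le> k \<Longrightarrow> \<phi> (\<psi> i) = i" "\<And>i. 1 \<le> i \<Longrightarrow> i \<le> l \<Longrightarrow> \<psi> (\<phi> i) = i"
  shows "og_comp f (pg k l \<phi>) \<cong> f \<lparr> ins := k, inp := inp f \<circ> \<psi> \<rparr>"
proof -
  have c: "composable f (pg k l \<phi>)" using f \<phi> open_pg by (auto simp: composable_def)
  have port: "glue f (pg k l \<phi>) (inl i) = glue f (pg k l \<phi>) (inr (inp f (\<psi> i)))" if "1 \<le> i" "i \<le> k" for i
    using glue_port[of "\<psi> i" "pg k l \<phi>" f] that range_okD[OF \<psi>] inv by simp
  have "open_graph (f \<lparr> ins := k, inp := inp f \<circ> \<psi> \<rparr>)"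
    using f range_okD[OF \<psi>] by (auto simp: open_graph_iff)
  moreover have "slice_hom (N_zx k) (apex f) (inp f \<circ> \<psi>, id)"
    using f range_okD[OF \<psi>] by (intro slice_hom_N_zx) (auto simp: open_graph_port)
  moreover have "fst (copair (inp f \<circ> \<psi>, id) (id, id)) (glue f (pg k l \<phi>) z) = fst (copair (inp f \<circ> \<psi>, id) (id, id)) z" for z
    by (rule copair_glue) (use inv f in simp)
  ultimately show ?thesis
    by (intro og_isoI[of _ _ "copair (inp f \<circ> \<psi>, id) (id, id)" "c2 f (pg k l \<phi>)"])
      (use c f port range_okD[OF \<psi>] inv in \<open>auto intro!: open_comp hom_comp hom_id hom_c2 simp: open_graph_port\<close>)
qed

text \<open>Legs are total functions of which only the values at actual port numbers count.\<close>

lemma og_iso_ports: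
  assumes "open_graph f" "apex g = apex f" "ins g = ins f" "outs g = outs f"
    and "\<And>i. 1 \<le> i \<Longrightarrow> i \<le> ins f \<Longrightarrow> inp g i = inp f i" "\<And>i. 1 \<le> i \<Longrightarrow> i \<le> outs f \<Longrightarrow> outp g i = outp f i"
  shows "f \<cong> g"
  by (rule og_isoI[of _ _ "(id, id)" "(id, id)"])
    (use assms in \<open>auto simp: open_graph_iff intro: hom_id\<close>)

definition psum :: "nat \<Rightarrow> nat \<Rightarrow> (nat \<Rightarrow> nat) \<Rightarrow> (nat \<Rightarrow> nat) \<Rightarrow> nat \<Rightarrow> nat" where
  "psum k l \<phi> \<psi> i = (if i \<le> l then \<phi> i else k + \<psi> (i - l))"

lemma range_ok_psum: "range_ok k l \<phi> \<Longrightarrow> range_ok k' l' \<psi> \<Longrightarrow> range_ok (k + k') (l + l') (psum k l \<phi> \<psi>)"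
  unfolding range_ok_def psum_def
  by (intro allI impI) (auto, metis One_nat_def Suc_leI add.commute le_diff_conv linorder_not_le not_less_eq_eq zero_less_diff trans_le_add1 le_add_diff_inverse nat_le_linear add_le_cancel_left)

lemma pg_tens_iso:
  assumes "range_ok k l \<phi>" "range_ok k' l' \<psi>"
  shows "og_tens (pg k l \<phi>) (pg k' l' \<psi>) \<cong> pg (k + k') (l + l') (psum k l \<phi> \<psi>)"
proof -
  have o: "open_graph (pg k l \<phi>)" "open_graph (pg k' l' \<psi>)" using assms by (auto intro: open_pg)
  have "slice_hom (N_zx k) (N_zx (k + k')) (id, id)" "slice_hom (N_zx k') (N_zx (k + k')) (\<lambda>v. k + v, id)"
    by (auto simp: slice_hom_iff)
  moreover have "slice_hom (N_zx (k + k')) (apex (og_tens (pg k l \<phi>) (pg k' l' \<psi>))) (\<lambda>v. if v \<le> k then inl v else inr (v - k), id)"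
    using open_graph_port(1)[OF open_tens[OF o]] by (intro slice_hom_N_zx) (auto simp: image_iff)
  ultimately show ?thesis
    by (intro og_isoI[of _ _ "copair (id, id) (\<lambda>v. k + v, id)" "(\<lambda>v. if v \<le> k then inl v else inr (v - k), id)"])
      (use o assms in \<open>auto intro!: open_tens open_pg range_ok_psum hom_tens simp: psum_def\<close>)
qed

lemma og_id_pg: "og_id n = pg n n id"
  by (simp add: og_id_def pg_def)

definition bperm :: "nat \<Rightarrow> nat \<Rightarrow> nat \<Rightarrow> nat" where
  "bperm m n i = (if i \<le> n then m + i else i - n)"

lemma og_braid_pg: "og_braid m n = pg (m + n) (n + m) (bperm m n)"
  by (simp add: og_braid_def pg_def bperm_def[abs_def])

lemma range_ok_id [simp]: "range_ok n n id" by (simp add: range_ok_def)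
lemma range_ok_bperm [simp]: "range_ok (m + n) (n + m) (bperm m n)" by (auto simp: range_ok_def bperm_def)

lemma open_id: "open_graph (og_id n)" unfolding og_id_pg by (rule open_pg) simp
lemma open_braid: "open_graph (og_braid m n)" unfolding og_braid_pg by (rule open_pg) simp

lemma id_comp_iso: "open_graph f \<Longrightarrow> outs f = n \<Longrightarrow> og_comp (og_id n) f \<cong> f"
  using pg_comp_iso[of f n n id] by (auto simp: og_id_pg)

lemma comp_id_iso: "open_graph f \<Longrightarrow> ins f = n \<Longrightarrow> og_comp f (og_id n) \<cong> f"
  using comp_pg_iso[of f n n id id] by (auto simp: og_id_pg)

lemma pg_cong: "range_ok k l \<phi> \<Longrightarrow> (\<And>i. 1 \<le> i \<Longrightarrow> i \<le> l \<Longrightarrow> \<phi> i = \<psi> i) \<Longrightarrow> pg k l \<phi> \<cong> pg k l \<psi>"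
  by (rule og_iso_ports) (auto intro: open_pg)

lemma tens_id_iso: "og_tens (og_id m) (og_id n) \<cong> og_id (m + n)"
proof -
  have "og_tens (og_id m) (og_id n) \<cong> pg (m + n) (m + n) (psum m m id id)"
    unfolding og_id_pg by (rule pg_tens_iso) auto
  also have "\<dots> \<cong> og_id (m + n)"
    unfolding og_id_pg by (rule pg_cong) (auto intro: range_ok_psum simp: psum_def)
  finally show ?thesis .
qed

lemma unit_tens_iso: "open_graph f \<Longrightarrow> og_tens (og_id 0) f \<cong> f"
  unfolding og_id_pg
  by (rule og_isoI[of _ _ "copair (id, id) (id, id)" t2])
    (auto simp: open_graph_port intro!: open_tens open_pg hom_tens hom_t2 slice_hom_N_zx hom_id)

lemma tens_unit_iso: "open_graph f \<Longrightarrow> og_tens f (og_id 0) \<cong> f"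
  unfolding og_id_pg
  by (rule og_isoI[of _ _ "copair (id, id) (id, id)" t1])
    (auto simp: open_graph_port intro!: open_tens open_pg hom_tens hom_t1 slice_hom_N_zx hom_id)

lemma braid_natural_iso:
  assumes f: "open_graph f" "open_graph f'"
  shows "og_comp (og_braid (outs f) (outs f')) (og_tens f f') \<cong> og_comp (og_tens f' f) (og_braid (ins f) (ins f'))"
proof -
  let ?l = "og_tens f f' \<lparr> outs := outs f' + outs f, outp := outp (og_tens f f') \<circ> bperm (outs f) (outs f') \<rparr>"
  let ?r = "og_tens f' f \<lparr> ins := ins f + ins f', inp := inp (og_tens f' f) \<circ> bperm (ins f') (ins f) \<rparr>"
  have o: "open_graph (og_tens f f')" "open_graph (og_tens f' f)" using f by (auto intro: open_tens)
  have 1: "og_comp (og_braid (outs f) (outs f')) (og_tens f f') \<cong> ?l"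
    unfolding og_braid_pg by (rule pg_comp_iso) (use o in auto)
  have 2: "og_comp (og_tens f' f) (og_braid (ins f) (ins f')) \<cong> ?r"
    unfolding og_braid_pg by (rule comp_pg_iso) (use o in \<open>auto simp: bperm_def\<close>)
  have "?l \<cong> ?r"
    using og_iso_open(2)[OF 1] og_iso_open(2)[OF 2] f
    by (intro og_isoI[of _ _ "copair t2 t1" "copair t2 t1"]) (auto intro!: hom_tens hom_t1 hom_t2 simp: bperm_def)
  then show ?thesis using 1 2 og_iso_sym og_iso_trans by blast
qed

lemma pg_pg_iso:
  assumes "range_ok k l \<phi>" "range_ok l m \<psi>"
  shows "og_comp (pg l m \<psi>) (pg k l \<phi>) \<cong> pg k m (\<phi> \<circ> \<psi>)"
proof -
  have "og_comp (pg l m \<psi>) (pg k l \<phi>) \<cong> pg k l \<phi> \<lparr> outs := m, outp := outp (pg k l \<phi>) \<circ> \<psi> \<rparr>"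
    by (rule pg_comp_iso) (use assms in \<open>auto intro: open_pg\<close>)
  also have "pg k l \<phi> \<lparr> outs := m, outp := outp (pg k l \<phi>) \<circ> \<psi> \<rparr> = pg k m (\<phi> \<circ> \<psi>)"
    by (simp add: pg_def)
  finally show ?thesis .
qed

lemma range_ok_comp: "range_ok k l \<phi> \<Longrightarrow> range_ok l m \<psi> \<Longrightarrow> range_ok k m (\<phi> \<circ> \<psi>)"
  by (auto simp: range_ok_def)

lemma braid_braid_iso: "og_comp (og_braid n m) (og_braid m n) \<cong> og_id (m + n)"
proof -
  have r: "range_ok (n + m) (m + n) (bperm n m)" by simp
  have "og_comp (og_braid n m) (og_braid m n) \<cong> pg (m + n) (m + n) (bperm m n \<circ> bperm n m)"
    unfolding og_braid_pg by (rule pg_pg_iso) auto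
  also have "\<dots> \<cong> og_id (m + n)"
    unfolding og_id_pg by (rule pg_cong, rule range_ok_comp[OF range_ok_bperm r]) (auto simp: bperm_def)
  finally show ?thesis .
qed

lemma hexagon_iso:
  "og_braid m (n + k) \<cong> og_comp (og_tens (og_id n) (og_braid m k)) (og_tens (og_braid m n) (og_id k))"
proof -
  let ?a = "psum (m + n) (n + m) (bperm m n) id" and ?b = "psum n n id (bperm m k)"
  have a: "range_ok (m + n + k) (n + m + k) ?a" and b: "range_ok (n + (m + k)) (n + (k + m)) ?b"
    by (intro range_ok_psum; simp)+
  have 1: "og_tens (og_braid m n) (og_id k) \<cong> pg (m + n + k) (n + m + k) ?a"
    unfolding og_braid_pg og_id_pg by (rule pg_tens_iso) auto
  have 2: "og_tens (og_id n) (og_braid m k) \<cong> pg (n + (m + k)) (n + (k + m)) ?b"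
    unfolding og_braid_pg og_id_pg by (rule pg_tens_iso) auto
  have "og_comp (og_tens (og_id n) (og_braid m k)) (og_tens (og_braid m n) (og_id k))
    \<cong> og_comp (pg (n + (m + k)) (n + (k + m)) ?b) (pg (m + n + k) (n + m + k) ?a)"
    using 1 2 by (rule comp_iso_cong) (auto simp: og_braid_pg og_id_pg)
  also have "\<dots> \<cong> pg (m + n + k) (n + (k + m)) (?a \<circ> ?b)"
    using pg_pg_iso[OF a, of "n + (k + m)" ?b] b by (simp add: add.assoc)
  also have "\<dots> \<cong> og_braid m (n + k)"
  proof -
    have "range_ok (m + n + k) (n + (k + m)) (?a \<circ> ?b)"
      using range_ok_comp[OF a, of "n + (k + m)" ?b] b by (simp add: add.assoc)
    then have "pg (m + n + k) (n + (k + m)) (?a \<circ> ?b) \<cong> pg (m + n + k) (n + (k + m)) (bperm m (n + k))"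
      by (rule pg_cong) (auto simp: psum_def bperm_def)
    then show ?thesis unfolding og_braid_pg by (simp add: add.assoc)
  qed
  finally show ?thesis by (rule og_iso_sym)
qed

definition fold2 :: "nat \<Rightarrow> nat \<Rightarrow> nat" where
  "fold2 n i = (if i \<le> n then i else i - n)"

lemma og_ev_simps [simp]: "ins (og_ev n) = n + n" "outs (og_ev n) = 0" "apex (og_ev n) = N_zx n"
  "inp (og_ev n) = fold2 n"
  by (simp_all add: og_ev_def fold2_def[abs_def])

lemma og_coev_simps [simp]: "ins (og_coev n) = 0" "outs (og_coev n) = n + n" "apex (og_coev n) = N_zx n"
  "outp (og_coev n) = fold2 n"
  by (simp_all add: og_coev_def fold2_def[abs_def])

lemma open_ev: "open_graph (og_ev n)" and open_coev: "open_graph (og_coev n)"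
  by (auto simp: open_graph_iff fold2_def)

lemma ev_braid_iso: "og_comp (og_ev n) (og_braid n n) \<cong> og_ev n"
proof -
  have "og_comp (og_ev n) (og_braid n n) \<cong> og_ev n \<lparr> ins := n + n, inp := inp (og_ev n) \<circ> bperm n n \<rparr>"
    unfolding og_braid_pg by (rule comp_pg_iso) (auto simp: open_ev bperm_def)
  also have "\<dots> \<cong> og_ev n"
    by (rule og_iso_sym, rule og_iso_ports) (auto simp: open_ev fold2_def bperm_def)
  finally show ?thesis .
qed

lemma ev_tens_iso:
  "og_ev (m + n) \<cong> og_comp (og_tens (og_ev m) (og_ev n)) (og_tens (og_tens (og_id m) (og_braid n m)) (og_id n))"
proof -
  let ?a = "psum m m id (bperm n m)" and ?a' = "psum m m id (bperm m n)"
  let ?b = "psum (m + (n + m)) (m + (m + n)) ?a id" and ?b' = "psum (m + (m + n)) (m + (n + m)) ?a' id"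
  have a: "range_ok (m + (n + m)) (m + (m + n)) ?a" "range_ok (m + (m + n)) (m + (n + m)) ?a'"
    by (intro range_ok_psum; simp)+
  then have b: "range_ok (m + (n + m) + n) (m + (m + n) + n) ?b" "range_ok (m + (m + n) + n) (m + (n + m) + n) ?b'"
    by (intro range_ok_psum; simp)+
  have "og_tens (og_tens (og_id m) (og_braid n m)) (og_id n) \<cong> og_tens (pg (m + (n + m)) (m + (m + n)) ?a) (og_id n)"
    unfolding og_braid_pg og_id_pg by (intro tens_iso_cong pg_tens_iso og_iso_refl open_pg) auto
  also have "\<dots> \<cong> pg (m + (n + m) + n) (m + (m + n) + n) ?b"
    unfolding og_id_pg using a by (intro pg_tens_iso) auto
  finally have 1: "og_tens (og_tens (og_id m) (og_braid n m)) (og_id n) \<cong> \<dots>" .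
  let ?E = "og_tens (og_ev m) (og_ev n)"
  have oE: "open_graph ?E" by (intro open_tens open_ev)
  have inv: "?b (?b' i) = i" if "1 \<le> i" "i \<le> m + (n + m) + n" for i
    using that by (auto simp: psum_def bperm_def)
  have inv': "?b' (?b i) = i" if "1 \<le> i" "i \<le> m + (m + n) + n" for i
    using that by (auto simp: psum_def bperm_def)
  have "og_comp ?E (og_tens (og_tens (og_id m) (og_braid n m)) (og_id n))
      \<cong> og_comp ?E (pg (m + (n + m) + n) (m + (m + n) + n) ?b)"
    using 1 og_iso_refl[OF oE] by (rule comp_iso_cong) (auto simp: og_braid_pg og_id_pg)
  also have X: "\<dots> \<cong> ?E \<lparr> ins := m + (n + m) + n, inp := inp ?E \<circ> ?b' \<rparr>"
    by (rule comp_pg_iso[OF oE _ b inv inv']) auto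
  also have "\<dots> \<cong> og_ev (m + n)"
  proof (rule og_isoI[of _ _ "copair (id, id) (\<lambda>v. m + v, id)" "(\<lambda>v. if v \<le> m then inl v else inr (v - m), id)"])
    show "open_graph (?E \<lparr> ins := m + (n + m) + n, inp := inp ?E \<circ> ?b' \<rparr>)"
      by (rule og_iso_open(2)[OF X])
    show "slice_hom (apex (?E \<lparr> ins := m + (n + m) + n, inp := inp ?E \<circ> ?b' \<rparr>)) (apex (og_ev (m + n))) (copair (id, id) (\<lambda>v. m + v, id))"
      by (auto intro!: hom_tens open_ev slice_hom_N_zx)
    show "slice_hom (apex (og_ev (m + n))) (apex (?E \<lparr> ins := m + (n + m) + n, inp := inp ?E \<circ> ?b' \<rparr>)) (\<lambda>v. if v \<le> m then inl v else inr (v - m), id)"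
      using open_graph_port(1)[OF oE] by (auto intro!: slice_hom_N_zx simp: image_iff)
  qed (auto simp: open_ev psum_def bperm_def fold2_def)
  finally show ?thesis by (rule og_iso_sym)
qed

text \<open>Each strand has four copies in the composite, one per tensor factor, and the facts
  \<open>1\<close> to \<open>3\<close> glue them along the zigzag to one node.\<close>

lemma snake_iso:
  "og_comp (og_tens (og_ev n) (og_id n)) (og_tens (og_id n) (og_coev n)) \<cong> og_id n"
proof -
  let ?g = "og_tens (og_ev n) (og_id n)" and ?f = "og_tens (og_id n) (og_coev n)"
  have o: "open_graph ?g" "open_graph ?f" by (auto intro: open_tens open_ev open_coev open_id)
  then have c: "composable ?g ?f" by (auto simp: composable_def og_id_pg)
  have 1: "glue ?g ?f (inl (inl i)) = glue ?g ?f (inr (inl i))" if "1 \<le> i" "i \<le> n" for i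
    using glue_port[of i ?f ?g] that by (simp add: og_id_pg fold2_def)
  have 2: "glue ?g ?f (inl (inr i)) = glue ?g ?f (inr (inl i))" if "1 \<le> i" "i \<le> n" for i
    using glue_port[of "n + i" ?f ?g] that by (simp add: og_id_pg fold2_def)
  have 3: "glue ?g ?f (inl (inr i)) = glue ?g ?f (inr (inr i))" if "1 \<le> i" "i \<le> n" for i
    using glue_port[of "n + n + i" ?f ?g] that by (simp add: og_id_pg fold2_def)
  let ?i = "copair (id, id) (id, id)"
  have h: "slice_hom (apex ?f) (N_zx n) ?i" "slice_hom (apex ?g) (N_zx n) ?i"
    by (auto intro!: hom_tens open_id open_coev open_ev slice_hom_N_zx simp: og_id_pg open_pg)
  have agree: "fst ?i (outp ?f i) = fst ?i (inp ?g i)" if "1 \<le> i" "i \<le> outs ?f" for i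
    using that by (auto simp: og_id_pg fold2_def)
  have hom: "slice_hom (apex (og_comp ?g ?f)) (N_zx n) (copair ?i ?i)"
    by (rule hom_comp[OF c h agree])
  have k: "slice_hom (N_zx n) (apex (og_comp ?g ?f)) (mcomp (c2 ?g ?f) t2)"
    using hom_mcomp[OF hom_t2[OF open_ev open_id[of n]] hom_c2[OF c]] by (simp add: og_id_pg)
  have glue: "fst (copair ?i ?i) (glue ?g ?f z) = fst (copair ?i ?i) z" for z
    using agree by (rule copair_glue)
  show ?thesis
    by (rule og_isoI[of _ _ "copair ?i ?i" "mcomp (c2 ?g ?f) t2"])
      (use c hom k glue 1 2 3 in \<open>auto intro!: open_comp open_id simp: og_id_pg open_pg\<close>)
qed

section \<open>The path sum of an open graph\<close>

lemma og_star_simps [simp]: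
  "ins (og_star x m n) = m" "outs (og_star x m n) = n" "vs (apex (og_star x m n)) = {0..m + n}"
  "es (apex (og_star x m n)) = {1..m + n}"
  "src (apex (og_star x m n)) e = (if e \<le> m then e else 0)"
  "tgt (apex (og_star x m n)) e = (if e \<le> m then 0 else e)"
  "vl (apex (og_star x m n)) v = (if v = 0 then x else White)"
  "el (apex (og_star x m n)) e = (if e \<le> m then FromWhite x else ToWhite x)"
  "inp (og_star x m n) = id" "outp (og_star x m n) j = m + j"
  by (simp_all add: og_star_def)

lemma og_wire_simps [simp]:
  "ins og_wire = 1" "outs og_wire = 1" "vs (apex og_wire) = {0, 1}" "es (apex og_wire) = {0}"
  "src (apex og_wire) e = 0" "tgt (apex og_wire) e = 1" "vl (apex og_wire) v = White"
  "el (apex og_wire) e = WhiteLoop" "inp og_wire i = 0" "outp og_wire i = 1"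
  by (simp_all add: og_wire_def)

lemma open_wire: "open_graph og_wire"
  by (auto simp: open_graph_iff slice_obj_iff S_zx_def)

lemma open_star:
  assumes "x \<noteq> White" "x = DiamN \<longrightarrow> m + n = 0"
  shows "open_graph (og_star x m n)"
  using assms by (auto simp: open_graph_iff slice_obj_iff S_zx_def)

lemma translate_typed: "typed t m n \<Longrightarrow> open_graph (translate t) \<and> ins (translate t) = m \<and> outs (translate t) = n"
proof (induction rule: typed.induct)
  case (2 m n)
  then show ?case by (simp add: open_braid) (simp add: og_braid_def)
next
  case (10 f m k g n)
  then show ?case by (auto intro: open_comp simp: composable_def)
qed (simp_all add: open_id open_ev open_coev open_wire og_green_def og_red_def og_had_def og_diam_def
     open_star open_tens og_id_pg open_pg)

section \<open>Operators attached to nodes and arcs\<close>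

definition fin_graph :: "sgraph \<Rightarrow> bool" where
  "fin_graph X \<longleftrightarrow> finite (vs X) \<and> finite (es X)"

text \<open>A red node carries the green state of its phase, its colour being moved into Hadamards
  on the adjacent arcs as in colour change. A Hadamard node is a phase-free hub whose one Hadamard
  is put on the outgoing arc by \<open>hout\<close>. A diamond keeps the red half of the scalar
  \<open>Gr 1 0 0 \<odot> Rd 0 1 0\<close>; summing over its wire supplies the green half.\<close>

primrec vbox :: "zx_node \<Rightarrow> arr" where
  "vbox White = Et"
| "vbox (GreenN a) = Gr 0 (Suc 0) a"
| "vbox (RedN a) = Gr 0 (Suc 0) a"
| "vbox HadN = Et"
| "vbox DiamN = Rd 0 (Suc 0) 0"

primrec hin :: "zx_node \<Rightarrow> arr" where
  "hin White = Wr" | "hin (GreenN a) = Wr" | "hin (RedN a) = Hd" | "hin HadN = Wr" | "hin DiamN = Wr"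

primrec hout :: "zx_node \<Rightarrow> arr" where
  "hout White = Wr" | "hout (GreenN a) = Wr" | "hout (RedN a) = Hd" | "hout HadN = Hd" | "hout DiamN = Wr"

primrec hbox :: "zx_arrow \<Rightarrow> arr" where
  "hbox WhiteLoop = Wr"
| "hbox (ToWhite x) = hout x"
| "hbox (FromWhite x) = hin x"

lemma Ty_boxes [simp]:
  "Ty (vbox x) = Some (0, Suc 0)" "Ty (hin x) = Some (Suc 0, Suc 0)" "Ty (hout x) = Some (Suc 0, Suc 0)"
  "Ty (hbox y) = Some (Suc 0, Suc 0)"
     apply (cases x; simp)
    apply (cases x; simp)
   apply (cases x; simp)
  apply (cases y)
    apply simp
  subgoal for z by (cases z; simp)
  subgoal for z by (cases z; simp)
  done

text \<open>For an arc at a non-white node the white end comes first, whichever way the arc points,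
  to match \<open>leaves\<close>, where the leaf precedes the hub. Between white nodes the target
  comes first, as \<open>Rb_wire\<close> expects.\<close>

definition legs :: "sgraph \<Rightarrow> nat \<Rightarrow> nat list" where
  "legs X e = (case el X e of FromWhite _ \<Rightarrow> [src X e, tgt X e] | _ \<Rightarrow> [tgt X e, src X e])"

lemma length_legs [simp]: "length (legs X e) = Suc (Suc 0)"
  by (simp add: legs_def split: zx_arrow.split)

lemma set_legs: "slice_obj X \<Longrightarrow> e \<in> es X \<Longrightarrow> set (legs X e) \<subseteq> vs X"
  by (auto simp: legs_def slice_obj_iff split: zx_arrow.split)

definition nodes :: "sgraph \<Rightarrow> nat set" where
  "nodes X = {v \<in> vs X. vl X v \<noteq> White}"

definition gates :: "sgraph \<Rightarrow> (nat \<Rightarrow> nat) \<Rightarrow> gate multiset" where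
  "gates X e = image_mset (\<lambda>a. (edge (hbox (el X a)), map e (legs X a))) (mset_set (es X))
     + image_mset (\<lambda>v. (vbox (vl X v), [e v])) (mset_set (nodes X))"

definition enum :: "ograph \<Rightarrow> (nat \<Rightarrow> nat) \<Rightarrow> bool" where
  "enum f e \<longleftrightarrow> open_graph f \<and> fin_graph (apex f) \<and> bij_betw e (vs (apex f)) {0..<card (vs (apex f))}"

text \<open>The path sum of an open graph: every vertex becomes a wire, every node and every arc a
  multiplication operator on these wires, and the remaining wires are summed over.\<close>

definition rb :: "ograph \<Rightarrow> (nat \<Rightarrow> nat) \<Rightarrow> arr" where
  "rb f e = read (card (vs (apex f))) (map (\<lambda>i. e (inp f i)) [1..<Suc (ins f)])
     (map (\<lambda>i. e (outp f i)) [1..<Suc (outs f)]) (gates (apex f) e)"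

lemma enum_less: "enum f e \<Longrightarrow> v \<in> vs (apex f) \<Longrightarrow> e v < card (vs (apex f))"
  by (auto simp: enum_def bij_betw_def)

lemma enum_ok:
  assumes "enum f e"
  shows "\<forall>x\<in>set (map (\<lambda>i. e (inp f i)) [1..<Suc (ins f)]). x < card (vs (apex f))"
    "\<forall>x\<in>set (map (\<lambda>i. e (outp f i)) [1..<Suc (outs f)]). x < card (vs (apex f))"
    "\<forall>g\<in>#gates (apex f) e. gate_ok (card (vs (apex f))) g"
proof -
  have o: "open_graph f" and fin: "finite (vs (apex f))" "finite (es (apex f))"
    using assms by (auto simp: enum_def fin_graph_def)
  note P = open_graph_port[OF o]
  show "\<forall>x\<in>set (map (\<lambda>i. e (inp f i)) [1..<Suc (ins f)]). x < card (vs (apex f))"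
    "\<forall>x\<in>set (map (\<lambda>i. e (outp f i)) [1..<Suc (outs f)]). x < card (vs (apex f))"
    using P(2,4) enum_less[OF assms] by auto
  show "\<forall>g\<in>#gates (apex f) e. gate_ok (card (vs (apex f))) g"
    using fin set_legs[OF P(1)] enum_less[OF assms] finite_subset[of "nodes (apex f)" "vs (apex f)"]
    by (fastforce simp: gates_def gate_ok_def nodes_def)
qed

text \<open>With the enumeration pulled back along the isomorphism, ports and operators are
  literally the same lists and multisets.\<close>

lemma rb_iso:
  assumes iso: "iso_pair f g h k" and e: "enum g e"
  shows "enum f (\<lambda>v. e (fst h v)) \<and> rb f (\<lambda>v. e (fst h v)) = rb g e"
proof -
  have bij: "bij_betw (fst h) (vs (apex f)) (vs (apex g))" "bij_betw (snd h) (es (apex f)) (es (apex g))"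
    using iso_pair_imp[OF iso] by (auto simp: cospan_iso_def slice_iso_def)
  have hom: "slice_hom (apex f) (apex g) h" and o: "open_graph f" using iso by (auto simp: iso_pair_def)
  have card: "card (vs (apex f)) = card (vs (apex g))" using bij(1) by (rule bij_betw_same_card)
  have fin: "fin_graph (apex f)"
    using e bij bij_betw_finite by (auto simp: enum_def fin_graph_def)
  have en: "enum f (\<lambda>v. e (fst h v))"
    using o fin bij_betw_trans[OF bij(1)] e by (auto simp: enum_def card o_def)
  have nodes: "fst h ` nodes (apex f) = nodes (apex g)"
  proof -
    have "nodes (apex g) = {v \<in> fst h ` vs (apex f). vl (apex g) v \<noteq> White}"
      using bij(1) by (auto simp: nodes_def bij_betw_def)
    also have "\<dots> = fst h ` nodes (apex f)"
      using hom by (auto simp: nodes_def slice_hom_iff)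
    finally show ?thesis by simp
  qed
  have "mset_set (es (apex g)) = image_mset (snd h) (mset_set (es (apex f)))"
    using bij(2) image_mset_mset_set[of "snd h" "es (apex f)"] by (simp add: bij_betw_def)
  moreover have "mset_set (nodes (apex g)) = image_mset (fst h) (mset_set (nodes (apex f)))"
    using bij(1) image_mset_mset_set[of "fst h" "nodes (apex f)"] nodes
    by (auto simp: bij_betw_def nodes_def inj_on_def)
  moreover have "legs (apex g) (snd h a) = map (fst h) (legs (apex f) a)" "el (apex g) (snd h a) = el (apex f) a"
    if "a \<in> es (apex f)" for a
    using hom that by (auto simp: legs_def slice_hom_iff split: zx_arrow.split)
  moreover have "vl (apex g) (fst h v) = vl (apex f) v" if "v \<in> nodes (apex f)" for v
    using hom that by (auto simp: nodes_def slice_hom_iff)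
  moreover have "finite (es (apex f))" "finite (nodes (apex f))"
    using fin by (auto simp: fin_graph_def nodes_def)
  ultimately have "gates (apex g) e = gates (apex f) (\<lambda>v. e (fst h v))"
    by (auto simp: gates_def multiset.map_comp o_def intro!: arg_cong2[where f = "(+)"] image_mset_cong)
  moreover have "map (\<lambda>i. e (fst h (inp f i))) [1..<Suc (ins f)] = map (\<lambda>i. e (inp g i)) [1..<Suc (ins g)]"
    "map (\<lambda>i. e (fst h (outp f i))) [1..<Suc (outs f)] = map (\<lambda>i. e (outp g i)) [1..<Suc (outs g)]"
    using iso by (auto simp: iso_pair_def)
  ultimately show ?thesis using en by (simp only: rb_def card simp_thms)
qed

text \<open>Two enumerations differ by the permutation \<open>s\<close>, to which
  \<open>read_renumber\<close> applies.\<close>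

lemma rb_enum:
  assumes e: "enum f e" and e': "enum f e'"
  shows "rb f e = rb f e'"
proof -
  let ?V = "vs (apex f)" and ?k = "card (vs (apex f))"
  have b: "bij_betw e ?V {0..<?k}" "bij_betw e' ?V {0..<?k}" using e e' by (auto simp: enum_def)
  define s where "s = map (\<lambda>x. e' (inv_into ?V e x)) [0..<?k]"
  have se: "s ! e v = e' v" if "v \<in> ?V" for v
    using that b(1) enum_less[OF e that] by (simp add: s_def bij_betw_def)
  have bb: "bij_betw (e' \<circ> inv_into ?V e) {0..<?k} {0..<?k}"
    using bij_betw_trans[OF bij_betw_inv_into[OF b(1)] b(2)] .
  have s: "distinct s" "length s = ?k" "\<forall>x\<in>set s. x < ?k"
    using bb by (auto simp: s_def distinct_map bij_betw_def o_def)
  have o: "open_graph f" and fin: "finite ?V" "finite (es (apex f))"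
    using e by (auto simp: enum_def fin_graph_def)
  note P = open_graph_port[OF o]
  have "image_mset (gmap ((!) s)) (gates (apex f) e) = gates (apex f) e'"
  proof -
    have "map ((!) s) (map e (legs (apex f) a)) = map e' (legs (apex f) a)" if "a \<in> es (apex f)" for a
      using set_legs[OF P(1) that] se by auto
    moreover have "s ! e v = e' v" if "v \<in> nodes (apex f)" for v using that se by (simp add: nodes_def)
    moreover have "finite (nodes (apex f))" using fin by (simp add: nodes_def)
    ultimately show ?thesis using fin
      by (auto simp: gates_def multiset.map_comp o_def intro!: arg_cong2[where f = "(+)"] image_mset_cong)
  qed
  moreover have "map ((!) s) (map (\<lambda>i. e (inp f i)) [1..<Suc (ins f)]) = map (\<lambda>i. e' (inp f i)) [1..<Suc (ins f)]"
    "map ((!) s) (map (\<lambda>i. e (outp f i)) [1..<Suc (outs f)]) = map (\<lambda>i. e' (outp f i)) [1..<Suc (outs f)]"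
    using P se by auto
  ultimately show ?thesis
    using read_renumber[OF s enum_ok[OF e]] by (simp only: rb_def)
qed

text \<open>Ports are white, so any other node is alone in its class and represents itself; this is
  why \<open>nodes_comp\<close> can be a plain disjoint union.\<close>

lemma glue_node:
  assumes "composable g f" "sum_map (vl (apex f)) (vl (apex g)) z \<noteq> White"
  shows "glue g f z = z"
proof -
  have "equivclp (ports_rel g f) z w \<Longrightarrow> w = z" for w
  proof (induction rule: equivclp_induct)
    case (step y w)
    then show ?case using assms by (auto simp: ports_rel_def composable_def open_graph_port)
  qed simp
  then show ?thesis using glue_eqv by blast
qed

lemma mset_set_inl_inr:
  assumes "finite P" "finite Q"
  shows "mset_set (inl ` P \<union> inr ` Q) = image_mset inl (mset_set P) + image_mset inr (mset_set Q)"
  using assms by (subst mset_set_Union) (auto simp: image_mset_mset_set inj_on_def)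

lemma nodes_comp:
  assumes c: "composable g f"
  shows "nodes (apex (og_comp g f)) = inl ` nodes (apex f) \<union> inr ` nodes (apex g)"
proof (intro set_eqI iffI)
  fix z assume "z \<in> nodes (apex (og_comp g f))"
  then obtain y where y: "y \<in> inl ` vs (apex f) \<union> inr ` vs (apex g)" "z = glue g f y"
    and "sum_map (vl (apex f)) (vl (apex g)) z \<noteq> White"
    by (auto simp: nodes_def)
  moreover from this have "z = y" using glue_node[OF c] vl_glue[OF c] by simp
  ultimately show "z \<in> inl ` nodes (apex f) \<union> inr ` nodes (apex g)" by (auto simp: nodes_def)
next
  fix z assume z: "z \<in> inl ` nodes (apex f) \<union> inr ` nodes (apex g)"
  then have "glue g f z = z" using glue_node[OF c] by (auto simp: nodes_def)
  moreover have "z \<in> inl ` vs (apex f) \<union> inr ` vs (apex g)" "sum_map (vl (apex f)) (vl (apex g)) z \<noteq> White"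
    using z by (auto simp: nodes_def)
  ultimately show "z \<in> nodes (apex (og_comp g f))"
    unfolding nodes_def og_comp_simps by (metis (mono_tags, lifting) imageI mem_Collect_eq)
qed

text \<open>The cocone \<open>p\<close>, \<open>q\<close> from \<open>read_comp\<close> and the
  quotient by \<open>glue\<close> are pushouts of the same span, so \<open>e\<close> enumerates the
  glued vertices. It is onto because the cocone is jointly surjective; it is injective because the
  kernel property can be tested with \<open>glue\<close> itself.\<close>

lemma rb_comp:
  assumes c: "composable g f" and e1: "enum f e1" and e2: "enum g e2"
  shows "\<exists>e. enum (og_comp g f) e \<and> rb (og_comp g f) e = rb g e2 \<odot> rb f e1"
proof -
  let ?m = "card (vs (apex f))" and ?n = "card (vs (apex g))"
  let ?us = "map (\<lambda>i. e1 (outp f i)) [1..<Suc (outs f)]" and ?vs = "map (\<lambda>i. e2 (inp g i)) [1..<Suc (ins g)]"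
  have o: "open_graph f" "open_graph g" "outs f = ins g" using c by (auto simp: composable_def)
  have b1: "bij_betw e1 (vs (apex f)) {0..<?m}" and b2: "bij_betw e2 (vs (apex g)) {0..<?n}"
    using e1 e2 by (auto simp: enum_def)
  have fin: "finite (vs (apex f))" "finite (es (apex f))" "finite (vs (apex g))" "finite (es (apex g))"
    using e1 e2 by (auto simp: enum_def fin_graph_def)
  have "length ?us = length ?vs" using o by simp
  from read_comp[OF this enum_ok[OF e1] enum_ok[OF e2]]
  obtain w p q where len: "length p = ?m" "length q = ?n" and set: "set p \<union> set q = {0..<w}"
    and eq: "\<forall>i<length ?us. p ! (?us ! i) = q ! (?vs ! i)"
    and univ: "\<And>\<theta> :: nat + nat \<Rightarrow> nat. (\<forall>i<length ?us. \<theta> (Inl (?us ! i)) = \<theta> (Inr (?vs ! i))) \<Longrightarrow>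
      (\<forall>x\<in>{..<?m} <+> {..<?n}. \<forall>y\<in>{..<?m} <+> {..<?n}.
        case_sum ((!) p) ((!) q) x = case_sum ((!) p) ((!) q) y \<longrightarrow> \<theta> x = \<theta> y)"
    and rd: "rb g e2 \<odot> rb f e1 = read w (map ((!) p) (map (\<lambda>i. e1 (inp f i)) [1..<Suc (ins f)]))
      (map ((!) q) (map (\<lambda>i. e2 (outp g i)) [1..<Suc (outs g)]))
      (image_mset (gmap ((!) q)) (gates (apex g) e2) + image_mset (gmap ((!) p)) (gates (apex f) e1))"
    unfolding rb_def by metis
  define e where "e = sum_map (\<lambda>x. p ! e1 x) (\<lambda>y. q ! e2 y)"
  \<comment> \<open>The lists count from \<open>0\<close>, the ports from \<open>1\<close>.\<close>
  have port: "p ! e1 (outp f i) = q ! e2 (inp g i)" if "1 \<le> i" "i \<le> outs f" for i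
    using eq[rule_format, of "i - 1"] that o by (simp del: upt_Suc)
  have eg: "e (glue g f z) = e z" for z
    unfolding e_def using port by (rule sum_map_glue)
  have e_simps: "e (inl x) = p ! e1 x" "e (inr y) = q ! e2 y" for x y by (simp_all add: e_def)
  let ?Z = "inl ` vs (apex f) \<union> inr ` vs (apex g)"
  have image: "e ` glue g f ` ?Z = {0..<w}"
  proof -
    have "e ` glue g f ` ?Z = (!) p ` e1 ` vs (apex f) \<union> (!) q ` e2 ` vs (apex g)"
      by (simp add: image_image eg image_Un e_simps)
    also have "\<dots> = (!) p ` {0..<?m} \<union> (!) q ` {0..<?n}" using b1 b2 by (simp add: bij_betw_def)
    also have "\<dots> = set p \<union> set q" unfolding len[symmetric] by (auto simp: set_conv_nth)
    finally show ?thesis using set by simp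
  qed
  define i1 where "i1 = inv_into (vs (apex f)) e1"
  define i2 where "i2 = inv_into (vs (apex g)) e2"
  have i1: "i1 (e1 x) = x" if "x \<in> vs (apex f)" for x using b1 that by (auto simp: i1_def bij_betw_def)
  have i2: "i2 (e2 y) = y" if "y \<in> vs (apex g)" for y using b2 that by (auto simp: i2_def bij_betw_def)
  \<comment> \<open>The test cocone: it takes an index back to its vertex and on to the class of
    that vertex.\<close>
  let ?th = "case_sum (\<lambda>x. glue g f (inl (i1 x))) (\<lambda>y. glue g f (inr (i2 y)))"
  define d where "d = sum_map (\<lambda>x. Inl (e1 x) :: nat + nat) (\<lambda>y. Inr (e2 y))"
  have th: "\<forall>i<length ?us. ?th (Inl (?us ! i)) = ?th (Inr (?vs ! i))"
  proof (intro allI impI)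
    fix i assume "i < length ?us"
    then have i: "1 \<le> Suc i" "Suc i \<le> outs f" by (auto simp del: upt_Suc)
    then show "?th (Inl (?us ! i)) = ?th (Inr (?vs ! i))"
      using o glue_port[OF i, of g] open_graph_port(4)[OF o(1) i] open_graph_port(2)[OF o(2), of "Suc i"]
      by (simp add: i1 i2 del: upt_Suc)
  qed
  have d: "d z \<in> {..<?m} <+> {..<?n}" "case_sum ((!) p) ((!) q) (d z) = e z" "?th (d z) = glue g f z"
    if "z \<in> ?Z" for z
    using that enum_less[OF e1] enum_less[OF e2] by (auto simp: d_def e_simps i1 i2)
  have inj: "glue g f x = glue g f y" if "x \<in> ?Z" "y \<in> ?Z" "e x = e y" for x y
    using univ[OF th, rule_format, OF d(1)[OF that(1)] d(1)[OF that(2)]] d(2,3)[OF that(1)] d(2,3)[OF that(2)] that(3)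
    by simp
  have bij: "bij_betw e (vs (apex (og_comp g f))) {0..<w}"
    unfolding bij_betw_def og_comp_simps(5)
  proof
    show "inj_on e (glue g f ` ?Z)"
    proof (rule inj_onI)
      fix a b assume "a \<in> glue g f ` ?Z" "b \<in> glue g f ` ?Z" and ab: "e a = e b"
      then obtain x y where "x \<in> ?Z" "y \<in> ?Z" "a = glue g f x" "b = glue g f y" by blast
      then show "a = b" using inj[of x y] ab by (simp only: eg)
    qed
  qed (rule image)
  then have card: "card (vs (apex (og_comp g f))) = w" using bij_betw_same_card by fastforce
  have en: "enum (og_comp g f) e"
    using open_comp[OF c] fin bij unfolding card[symmetric] by (simp add: enum_def fin_graph_def)
  have legs1: "map e (legs (apex (og_comp g f)) (inl a)) = map ((!) p) (map e1 (legs (apex f) a))" for a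
    by (auto simp: legs_def eg e_simps split: zx_arrow.split)
  have legs2: "map e (legs (apex (og_comp g f)) (inr a)) = map ((!) q) (map e2 (legs (apex g) a))" for a
    by (auto simp: legs_def eg e_simps split: zx_arrow.split)
  have gates: "gates (apex (og_comp g f)) e
    = image_mset (gmap ((!) q)) (gates (apex g) e2) + image_mset (gmap ((!) p)) (gates (apex f) e1)"
    using fin unfolding gates_def nodes_comp[OF c]
    by (simp add: mset_set_inl_inr nodes_def multiset.map_comp o_def legs1[simplified] legs2[simplified] e_simps)
  show ?thesis
    by (rule exI[of _ e], rule conjI[OF en], unfold rd) (simp add: rb_def card[simplified] gates eg e_simps o_def del: upt_Suc)
qed

lemma rb_tens:
  assumes e1: "enum f e1" and e2: "enum g e2"
  shows "\<exists>e. enum (og_tens f g) e \<and> rb (og_tens f g) e = rb f e1 \<oplus> rb g e2"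
proof -
  let ?m = "card (vs (apex f))" and ?n = "card (vs (apex g))"
  have o: "open_graph f" "open_graph g" using e1 e2 by (auto simp: enum_def)
  have b1: "bij_betw e1 (vs (apex f)) {0..<?m}" and b2: "bij_betw e2 (vs (apex g)) {0..<?n}"
    using e1 e2 by (auto simp: enum_def)
  have fin: "finite (vs (apex f))" "finite (es (apex f))" "finite (vs (apex g))" "finite (es (apex g))"
    using e1 e2 by (auto simp: enum_def fin_graph_def)
  define e where "e = sum_map e1 (\<lambda>y. ?m + e2 y)"
  have e_simps: "e (inl x) = e1 x" "e (inr y) = ?m + e2 y" for x y by (simp_all add: e_def)
  have card: "card (vs (apex (og_tens f g))) = ?m + ?n"
    using fin by (simp, subst card_Un_disjoint) (auto simp: card_image inj_on_def)
  have "e ` vs (apex (og_tens f g)) = e1 ` vs (apex f) \<union> (+) ?m ` e2 ` vs (apex g)"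
    by (simp add: image_Un image_image e_simps)
  also have "\<dots> = {0..<?m + ?n}"
    using b1 b2 by (simp add: bij_betw_def ivl_disj_un add.commute)
  finally have im: "e ` vs (apex (og_tens f g)) = {0..<?m + ?n}" .
  have "inj_on e (vs (apex (og_tens f g)))"
    by (rule eq_card_imp_inj_on) (use fin im card in auto)
  then have en: "enum (og_tens f g) e"
    using im fin open_tens[OF o] by (simp add: enum_def bij_betw_def card[simplified] fin_graph_def)
  have legs1: "map e (legs (apex (og_tens f g)) (inl a)) = map e1 (legs (apex f) a)" for a
    by (auto simp: legs_def e_simps split: zx_arrow.split)
  have legs2: "map e (legs (apex (og_tens f g)) (inr a)) = map ((+) ?m) (map e2 (legs (apex g) a))" for a
    by (auto simp: legs_def e_simps split: zx_arrow.split)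
  have nodes: "nodes (apex (og_tens f g)) = inl ` nodes (apex f) \<union> inr ` nodes (apex g)"
    by (auto simp: nodes_def)
  have gates: "gates (apex (og_tens f g)) e = gates (apex f) e1 + image_mset (gmap ((+) ?m)) (gates (apex g) e2)"
    using fin unfolding gates_def nodes
    by (simp add: mset_set_inl_inr nodes_def multiset.map_comp o_def legs1[simplified] legs2[simplified] e_simps)
  have split: "map h [1..<Suc (a + b)] = map h [1..<Suc a] @ map (\<lambda>i. h (a + i)) [1..<Suc b]" for a b and h :: "nat \<Rightarrow> nat"
  proof -
    have "[1..<Suc (a + b)] = [1..<Suc a] @ [Suc a..<Suc a + b]"
      using upt_add_eq_append[of 1 "Suc a" b] by simp
    moreover have "[Suc a..<Suc a + b] = map ((+) a) [1..<Suc b]"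
      by (rule nth_equalityI) (auto simp del: upt_Suc)
    ultimately show ?thesis by (simp add: o_def del: upt_Suc)
  qed
  have ins: "map (\<lambda>i. e (inp (og_tens f g) i)) [1..<Suc (ins f + ins g)]
    = map (\<lambda>i. e1 (inp f i)) [1..<Suc (ins f)] @ map ((+) ?m) (map (\<lambda>i. e2 (inp g i)) [1..<Suc (ins g)])"
    unfolding split by (auto simp: e_simps simp del: upt_Suc)
  have outs: "map (\<lambda>i. e (outp (og_tens f g) i)) [1..<Suc (outs f + outs g)]
    = map (\<lambda>i. e1 (outp f i)) [1..<Suc (outs f)] @ map ((+) ?m) (map (\<lambda>i. e2 (outp g i)) [1..<Suc (outs g)])"
    unfolding split by (auto simp: e_simps simp del: upt_Suc)
  have "rb (og_tens f g) e = rb f e1 \<oplus> rb g e2"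
    unfolding rb_def card og_tens_simps(1,2) ins outs gates
    by (rule read_tens[OF enum_ok[OF e1] enum_ok[OF e2]])
  then show ?thesis using en by blast
qed

text \<open>Abstracts from the enumeration. The value is unique by \<open>Rb_unique\<close>, and an
  infinite graph has none.\<close>

definition Rb :: "ograph \<Rightarrow> arr \<Rightarrow> bool" where
  "Rb f a \<longleftrightarrow> (\<exists>e. enum f e \<and> rb f e = a)"

lemma Rb_comp: "Rb f a \<Longrightarrow> Rb g b \<Longrightarrow> outs f = ins g \<Longrightarrow> Rb (og_comp g f) (b \<odot> a)"
  unfolding Rb_def by (metis rb_comp composable_def enum_def)

lemma Rb_tens: "Rb f a \<Longrightarrow> Rb g b \<Longrightarrow> Rb (og_tens f g) (a \<oplus> b)"
  unfolding Rb_def by (metis rb_tens)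

lemma Rb_iso: "f \<cong> g \<Longrightarrow> Rb g a \<Longrightarrow> Rb f a"
  unfolding Rb_def by (metis og_isoE rb_iso)

lemma Rb_unique: "Rb f a \<Longrightarrow> Rb f b \<Longrightarrow> a = b"
  unfolding Rb_def by (metis rb_enum)

lemma RbI:
  assumes "open_graph f" "finite (vs (apex f))" "finite (es (apex f))"
    "bij_betw e (vs (apex f)) {0..<k}"
    "read k (map (\<lambda>i. e (inp f i)) [1..<Suc (ins f)]) (map (\<lambda>i. e (outp f i)) [1..<Suc (outs f)]) (gates (apex f) e) = a"
  shows "Rb f a"
proof -
  have "card (vs (apex f)) = k" using assms(4) bij_betw_same_card by fastforce
  then show ?thesis using assms unfolding Rb_def rb_def enum_def fin_graph_def by blast
qed

section \<open>Path sums of the generators\<close>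

lemma bij_pred: "bij_betw (\<lambda>i. i - 1) {1..k} {0..<k::nat}"
  by (rule bij_betw_byWitness[where f' = Suc]) auto

lemma gates_N_zx [simp]: "gates (N_zx k) e = {#}"
  by (simp add: gates_def nodes_def)

lemma map_pred: "map (\<lambda>i. i - Suc 0) [Suc 0..<Suc n] = [0..<n]"
  by (rule nth_equalityI) (auto simp del: upt_Suc)

lemma read_empty: "\<forall>x\<in>set xs. x < k \<Longrightarrow> \<forall>x\<in>set ys. x < k \<Longrightarrow> read k xs ys {#} = dg (Fuse k ys) \<odot> Fuse k xs"
  by (simp add: read_def)

lemma Rb_id: "Rb (og_id n) (Idt n)"
proof (rule RbI[OF open_id _ _ _, of n "\<lambda>i. i - 1" n])
  show "bij_betw (\<lambda>i. i - 1) (vs (apex (og_id n))) {0..<n}" using bij_pred[of n] by (simp add: og_id_pg)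
qed (simp_all add: og_id_pg map_pred read_empty Fuse_id del: upt_Suc)

lemma map_bperm: "map (\<lambda>i. bperm m n i - Suc 0) [Suc 0..<Suc (n + m)] = map ((+) m) [0..<n] @ [0..<m]"
  by (rule nth_equalityI) (auto simp: bperm_def nth_append simp del: upt_Suc)

lemma read_braid: "read (m + n) [0..<m + n] (map ((+) m) [0..<n] @ [0..<m]) {#} = Br m n"
  by (subst read_empty) (auto simp: Fuse_id Fuse_Br comp_Idt[of _ "m + n" "n + m"])

lemma Rb_braid: "Rb (og_braid m n) (Br m n)"
proof (rule RbI[OF open_braid, of m n "\<lambda>i. i - 1" "m + n"])
  show "bij_betw (\<lambda>i. i - 1) (vs (apex (og_braid m n))) {0..<m + n}" using bij_pred[of "m + n"] by (simp add: og_braid_pg)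
qed (simp_all add: og_braid_pg map_pred map_bperm read_braid del: upt_Suc)

text \<open>\<open>Cap 0\<close> is idempotent by the tensor law and has \<open>Cup 0\<close> as a
  right inverse by the snake equation.\<close>

lemma Cap_0: "Cap 0 = Idt 0"
proof -
  have 1: "Cap 0 \<odot> Cup 0 = Idt 0" using snake[of 0] by simp
  have "Cap (0 + 0) = (Cap 0 \<oplus> Cap 0) \<odot> ((Idt 0 \<oplus> Br 0 0) \<oplus> Idt 0)"
    by transfer (rule arr_eqI, auto intro!: zx_cong.ev_tens[of 0 0, simplified])
  then have 2: "Cap 0 = Cap 0 \<odot> Cap 0"
    using slide(1)[of "Cap 0" 0 0 "Cap 0" 0 0] by simp
  have "Cap 0 = Cap 0 \<odot> (Cap 0 \<odot> Cup 0)" by (simp add: 1)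
  also have "\<dots> = (Cap 0 \<odot> Cap 0) \<odot> Cup 0" by (simp only: acomp_assoc)
  also have "\<dots> = Idt 0" using 1 2 by simp
  finally show ?thesis .
qed

lemma Cap_tens: "Cap (m + n) = (Cap m \<oplus> Cap n) \<odot> ((Idt m \<oplus> Br n m) \<oplus> Idt n)"
  by transfer (rule arr_eqI, auto intro!: zx_cong.ev_tens)

text \<open>The tensor law builds evaluations from single strands, on graphs and on arrows alike, so
  that only one strand has to be computed.\<close>

lemma Rb_ev: "Rb (og_ev n) (Cap n)"
proof (induction n)
  case 0
  have "og_ev 0 \<cong> og_id 0"
    by (rule og_isoI[of _ _ "(id, id)" "(id, id)"]) (auto simp: open_ev open_id og_id_pg intro!: open_pg hom_id)
  then show ?case using Rb_iso Rb_id[of 0] by (simp add: Cap_0)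
next
  case (Suc n)
  have "Rb (og_ev 1) (Cap 1)"
  proof (rule RbI[OF open_ev, of 1 "\<lambda>i. i - 1" 1])
    show "bij_betw (\<lambda>i. i - 1) (vs (apex (og_ev 1))) {0..<1}" using bij_pred[of 1] by simp
    have "[1..<Suc 2] = [1, 2]" by (simp add: upt_rec)
    then show "read 1 (map (\<lambda>i. inp (og_ev 1) i - 1) [1..<Suc (ins (og_ev 1))])
       (map (\<lambda>i. outp (og_ev 1) i - 1) [1..<Suc (outs (og_ev 1))]) (gates (apex (og_ev 1)) (\<lambda>i. i - 1)) = Cap 1"
      using spider[of 1 0 0 0 0 2 0] Gr_cap
      by (simp add: numeral_2_eq_2 fold2_def read_empty Mu_Et' Idt_tens_Idt)
  qed simp_all
  then have "Rb (og_comp (og_tens (og_ev 1) (og_ev n)) (og_tens (og_tens (og_id 1) (og_braid n 1)) (og_id n)))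
     ((Cap 1 \<oplus> Cap n) \<odot> ((Idt 1 \<oplus> Br n 1) \<oplus> Idt n))"
    by (intro Rb_comp Rb_tens Suc Rb_id Rb_braid) (auto simp: og_id_pg og_braid_pg)
  then show ?case using Rb_iso[OF ev_tens_iso[of 1 n]] Cap_tens[of 1 n] by simp
qed

text \<open>The graph is that of the evaluation with its legs exchanged; as it has no operators, its
  path sum is the dagger.\<close>

lemma Rb_coev: "Rb (og_coev n) (Cup n)"
proof -
  obtain e where e: "enum (og_ev n) e" "rb (og_ev n) e = Cap n" using Rb_ev by (auto simp: Rb_def)
  note ok = enum_ok(1)[OF e(1)]
  have "enum (og_coev n) e" using e(1) open_coev by (simp add: enum_def)
  moreover have "rb (og_coev n) e = dg (rb (og_ev n) e)"
    using ok by (simp add: rb_def read_empty)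
  ultimately show ?thesis using e by (auto simp: Rb_def)
qed

lemma Rb_wire: "Rb og_wire Wr"
\<comment> \<open>The target gets number \<open>0\<close> and the source number \<open>1\<close>:
  the output is then a leaf hanging on the input, as in \<open>gate_leaf_Et\<close>.\<close>
proof (rule RbI[OF open_wire, of "\<lambda>v. if v = 0 then 1 else 0" 2])
  show "bij_betw (\<lambda>v. if v = 0 then 1 else 0) (vs (apex og_wire)) {0..<2::nat}"
    by (rule bij_betw_byWitness[where f' = "\<lambda>v. if v = 0 then 1 else 0"]) auto
  have g: "gates (apex og_wire) (\<lambda>v. if v = 0 then 1 else 0) = {#(edge Wr, [0, Suc 0])#}"
    by (simp add: gates_def nodes_def legs_def)
  have Fuse: "Fuse 2 [Suc 0] = Et \<oplus> Wr" "Fuse 2 [0] = Wr \<oplus> Et"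
    using Fuse_append[of "[0]" 1 "[]" 1] Fuse_append[of "[]" 1 "[0]" 1] Fuse_id[of 1] by (simp_all add: numeral_2_eq_2)
  have "read 2 [Suc 0] [0] {#(edge Wr, [0, Suc 0])#} = (Wr \<oplus> dg Et) \<odot> gate 2 (edge Wr, [0, Suc 0]) \<odot> (Et \<oplus> Wr)"
    unfolding read_def Fuse by (simp add: comp_Idt[of _ 2 2])
  also have "gate 2 (edge Wr, [0, Suc 0]) \<odot> (Et \<oplus> Wr) = De"
    using gate_leaf_Et[of Wr 0 1] by (simp add: numeral_2_eq_2 Idt_tens_Idt)
  also have "(Wr \<oplus> dg Et) \<odot> De = Wr"
    using arg_cong[OF Mu_Et', of dg] by simp
  finally show "read 2 (map (\<lambda>i. if inp og_wire i = 0 then 1 else 0) [1..<Suc (ins og_wire)]) (map (\<lambda>i. if outp og_wire i = 0 then 1 else 0) [1..<Suc (outs og_wire)])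
     (gates (apex og_wire) (\<lambda>v. if v = 0 then 1 else 0)) = Wr"
    using g by simp
qed simp_all

lemma edge_sym_hin: "edge_sym (hin x)"
  by (cases x) (simp_all add: edge_sym_Wr edge_sym_H)

lemma Rb_star:
  assumes x: "x \<noteq> White" "x = DiamN \<longrightarrow> m + n = 0"
  shows "Rb (og_star x m n) (pow (hout x) n \<odot> Gr (Suc 0) n 0 \<odot> Gr (Suc m) (Suc 0) 0 \<odot> (Idt m \<oplus> vbox x) \<odot> pow (hin x) m)"
proof -
  \<comment> \<open>The numbering used in \<open>read_star\<close>: outputs, then inputs, and last
    the hub, which is node \<open>0\<close> of the graph.\<close>
  define e where "e v = (if v = 0 then n + m else if v \<le> m then n + v - 1 else v - m - 1)" for v
  let ?X = "apex (og_star x m n)"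
  show ?thesis
  proof (rule RbI[OF open_star[OF x], of e "n + Suc m"])
    show "bij_betw e (vs ?X) {0..<n + Suc m}"
      by (rule bij_betw_byWitness[where f' = "\<lambda>i. if i = n + m then 0 else if i < n then m + i + 1 else i - n + 1"])
        (auto simp: e_def split: if_splits)
    have "Suc ` {0..<m} = {1..m}" "(+) (Suc m) ` {0..<n} = {Suc m..m + n}"
      by (simp_all only: image_Suc_atLeastLessThan image_add_atLeastLessThan) auto
    then have "mset_set {Suc m..m + n} = image_mset ((+) (Suc m)) (mset_set {0..<n})"
      "mset_set {1..m} = image_mset Suc (mset_set {0..<m})"
      using image_mset_mset_set[of Suc "{0..<m}"] image_mset_mset_set[of "(+) (Suc m)" "{0..<n}"] inj_on_add[of "Suc m"]
      by (simp_all del: image_Suc_atLeastLessThan image_add_atLeastLessThan)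
    moreover have "{1..m + n} = {Suc m..m + n} \<union> {1..m}" by auto
    ultimately have "mset_set {1..m + n} = image_mset ((+) (Suc m)) (mset_set {0..<n}) + image_mset Suc (mset_set {0..<m})"
      by (simp only:, subst mset_set_Union) auto
    then have "image_mset (\<lambda>a. (edge (hbox (el ?X a)), map e (legs ?X a))) (mset_set (es ?X))
      = image_mset (\<lambda>j. (edge (hout x), [j, n + m])) (mset_set {0..<n}) + image_mset (\<lambda>i. (edge (hin x), [n + i, n + m])) (mset_set {0..<m})"
      by (auto simp: multiset.map_comp o_def legs_def e_def intro!: arg_cong2[where f = "(+)"] image_mset_cong)
    also have "\<dots> = leaves (hout x) n m + image_mset (gmap ((+) n)) (leaves (hin x) m 0)"
      by (simp add: leaves_def multiset.map_comp o_def mset_upt)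
    finally have g: "gates ?X e = leaves (hout x) n m + image_mset (gmap ((+) n)) (leaves (hin x) m 0) + {#(vbox x, [n + m])#}"
    proof -
      assume *: "image_mset (\<lambda>a. (edge (hbox (el ?X a)), map e (legs ?X a))) (mset_set (es ?X))
        = leaves (hout x) n m + image_mset (gmap ((+) n)) (leaves (hin x) m 0)"
      have "nodes ?X = {0}" using x by (auto simp: nodes_def)
      then show ?thesis unfolding gates_def * by (simp add: e_def)
    qed
    have i: "map (\<lambda>i. e (inp (og_star x m n) i)) [1..<Suc (ins (og_star x m n))] = map ((+) n) [0..<m]"
      by (rule nth_equalityI) (auto simp: e_def simp del: upt_Suc)
    have o: "map (\<lambda>i. e (outp (og_star x m n) i)) [1..<Suc (outs (og_star x m n))] = [0..<n]"
      by (rule nth_equalityI) (auto simp: e_def simp del: upt_Suc)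
    show "read (n + Suc m) (map (\<lambda>i. e (inp (og_star x m n) i)) [1..<Suc (ins (og_star x m n))])
      (map (\<lambda>i. e (outp (og_star x m n) i)) [1..<Suc (outs (og_star x m n))]) (gates ?X e)
      = pow (hout x) n \<odot> Gr (Suc 0) n 0 \<odot> Gr (Suc m) (Suc 0) 0 \<odot> (Idt m \<oplus> vbox x) \<odot> pow (hin x) m"
      unfolding g i o by (rule read_star) (auto simp: edge_sym_hin)
  qed simp_all
qed

lemma fuse_phase: "Gr (Suc 0) n 0 \<odot> Gr (Suc m) (Suc 0) 0 \<odot> (Idt m \<oplus> Gr 0 (Suc 0) a) = Gr m n a"
  using spider'[of 1 m 1 0 0 0 a] spider[of 1 0 0 n 0 m a] by simp

lemma Rb_green: "Rb (og_green m n a) (Gr m n a)"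
  using Rb_star[of "GreenN a" m n] fuse_phase[of n m a] by (simp add: og_green_def)

lemma Rb_red: "Rb (og_red m n a) (Rd m n a)"
proof -
  have "Gr (Suc 0) n 0 \<odot> Gr (Suc m) (Suc 0) 0 \<odot> (Idt m \<oplus> Gr 0 (Suc 0) a) \<odot> Hds m = Gr m n a \<odot> Hds m"
    using fuse_phase[of n m a] by (simp flip: acomp_assoc)
  then show ?thesis
    using Rb_star[of "RedN a" m n] color_change[of n m a] by (simp add: og_red_def)
qed

lemma Rb_had: "Rb og_had Hd"
proof -
  have "Gr (Suc 0) (Suc 0) 0 \<odot> Gr (Suc (Suc 0)) (Suc 0) 0 \<odot> (Wr \<oplus> Et) = Wr"
    using fuse_phase[of 1 1 0] by simp
  then show ?thesis using Rb_star[of HadN 1 1] by (simp add: og_had_def)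
qed

lemma Rb_diam: "Rb og_diam Dm"
  using Rb_star[of DiamN 0 0] diamond_arr' by (simp add: og_diam_def)

lemma Rb_translate: "typed t m n \<Longrightarrow> Rb (translate t) (abs_arr t)"
proof (induction rule: typed.induct)
  case (5)
  have "abs_arr Wire = Wr" unfolding Idt.abs_eq arr.abs_eq_iff arr_eq_def using zx_cong.wire by simp
  then show ?case using Rb_wire by simp
next
  case (10 f m k g n)
  then show ?case using translate_typed by (auto simp flip: acomp.abs_eq intro!: Rb_comp)
qed (simp_all add: Rb_id Rb_braid Rb_ev Rb_coev Rb_green Rb_red Rb_had Rb_diam Rb_tens
   flip: Idt.abs_eq Br.abs_eq Cap.abs_eq Cup.abs_eq Gr.abs_eq Rd.abs_eq Hd.abs_eq Dm.abs_eq atens.abs_eq)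

text \<open>The path sum of \<open>translate s\<close> is computed once from \<open>s\<close> itself
  and once from \<open>t\<close> along the isomorphism.\<close>

theorem coherence:
  assumes "typed s m n" "typed t m n" "translate s \<cong> translate t"
  shows "zx_eq s t"
proof -
  have "Rb (translate s) (abs_arr s)" "Rb (translate s) (abs_arr t)"
    using Rb_translate assms Rb_iso by blast+
  then have "abs_arr s = abs_arr t" by (rule Rb_unique)
  then show ?thesis using assms unfolding zx_eq_iff_cong by (intro zx_cong_if_arr_eq) (auto simp: typed_iff_ty)
qed

section \<open>Two-cells and equality of diagrams\<close>

lemma og_relabel_simps [simp]:
  "ins (og_relabel r f) = ins f" "outs (og_relabel r f) = outs f" "inp (og_relabel r f) = inp f"
  "outp (og_relabel r f) = outp f" "shape (apex (og_relabel r f)) = shape (apex f)"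
  "vl (apex (og_relabel r f)) v = r (vl (apex f) v)" "el (apex (og_relabel r f)) e = map_arrow r (el (apex f) e)"
  by (simp_all add: og_relabel_def)

lemma og_swap_simps [simp]:
  "ins (og_swap f) = outs f" "outs (og_swap f) = ins f" "inp (og_swap f) = outp f" "outp (og_swap f) = inp f"
  "vs (apex (og_swap f)) = vs (apex f)" "es (apex (og_swap f)) = es (apex f)"
  "src (apex (og_swap f)) = tgt (apex f)" "tgt (apex (og_swap f)) = src (apex f)"
  "vl (apex (og_swap f)) = vl (apex f)" "el (apex (og_swap f)) e = reverse_arrow (el (apex f) e)"
  by (simp_all add: og_swap_def)

text \<open>What colour exchange and phase negation have in common. Since every node but
  \<open>White\<close> and \<open>DiamN\<close> has arcs to and from white, it makes
  \<open>map_arrow r\<close> respect \<open>S_zx\<close>.\<close>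

definition good :: "(zx_node \<Rightarrow> zx_node) \<Rightarrow> bool" where
  "good r \<longleftrightarrow> (\<forall>x. r (r x) = x) \<and> r White = White \<and> r DiamN = DiamN"

lemma good_exchange: "good exchange_node"
proof -
  have "exchange_node (exchange_node x) = x" for x by (cases x) auto
  then show ?thesis by (simp add: good_def)
qed

lemma good_negate: "good negate_node"
proof -
  have "negate_node (negate_node x) = x" for x by (cases x) auto
  then show ?thesis by (simp add: good_def)
qed

lemma arcs_S_zx [simp]: "WhiteLoop \<in> arcs S_zx" "ToWhite x \<in> arcs S_zx \<longleftrightarrow> x \<noteq> White \<and> x \<noteq> DiamN"
  "FromWhite x \<in> arcs S_zx \<longleftrightarrow> x \<noteq> White \<and> x \<noteq> DiamN"
  by (auto simp: S_zx_def)

lemma map_arrow_S_zx: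
  assumes "good r" "a \<in> arcs S_zx"
  shows "map_arrow r a \<in> arcs S_zx" "tail S_zx (map_arrow r a) = r (tail S_zx a)"
    "head S_zx (map_arrow r a) = r (head S_zx a)"
proof -
  have rr: "r (r x) = x" "r White = White" "r DiamN = DiamN" for x using assms(1) by (auto simp: good_def)
  have "x = White" if "r x = White" for x using rr(1)[of x] rr(2) that by simp
  moreover have "x = DiamN" if "r x = DiamN" for x using rr(1)[of x] rr(3) that by simp
  ultimately show "map_arrow r a \<in> arcs S_zx"
    using assms(2) by (cases a) auto
  show "tail S_zx (map_arrow r a) = r (tail S_zx a)" "head S_zx (map_arrow r a) = r (head S_zx a)"
    using rr(2) by (cases a; simp add: S_zx_def)+
qed

lemma reverse_arrow_S_zx:
  assumes "a \<in> arcs S_zx"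
  shows "reverse_arrow a \<in> arcs S_zx" "tail S_zx (reverse_arrow a) = head S_zx a"
    "head S_zx (reverse_arrow a) = tail S_zx a"
  using assms by (auto simp: S_zx_def)

lemma slice_obj_relabel: "good r \<Longrightarrow> slice_obj (apex f) \<Longrightarrow> slice_obj (apex (og_relabel r f))"
  by (auto simp: slice_obj_iff map_arrow_S_zx)

lemma slice_obj_swap: "slice_obj (apex f) \<Longrightarrow> slice_obj (apex (og_swap f))"
  by (auto simp: slice_obj_iff reverse_arrow_S_zx)

lemma open_relabel: "good r \<Longrightarrow> open_graph f \<Longrightarrow> open_graph (og_relabel r f)"
  unfolding open_graph_iff by (auto simp: slice_obj_relabel) (auto simp: good_def)

lemma open_swap: "open_graph f \<Longrightarrow> open_graph (og_swap f)"
  unfolding open_graph_iff by (auto simp: slice_obj_swap)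

lemma hom_relabel: "good r \<Longrightarrow> slice_hom (apex f) (apex g) h \<Longrightarrow> slice_hom (apex (og_relabel r f)) (apex (og_relabel r g)) h"
  by (auto simp: slice_hom_iff slice_obj_relabel)

lemma hom_swap: "slice_hom (apex f) (apex g) h \<Longrightarrow> slice_hom (apex (og_swap f)) (apex (og_swap g)) h"
  by (auto simp: slice_hom_iff slice_obj_swap)

lemma relabel_iso: "good r \<Longrightarrow> f \<cong> g \<Longrightarrow> og_relabel r f \<cong> og_relabel r g"
  by (erule og_isoE, rule og_isoI) (auto simp: iso_pair_def intro: open_relabel hom_relabel)

lemma swap_iso: "f \<cong> g \<Longrightarrow> og_swap f \<cong> og_swap g"
  by (erule og_isoE, rule og_isoI) (auto simp: iso_pair_def intro: open_swap hom_swap)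

lemma sum_map_comp: "r \<circ> sum_map f g = sum_map (r \<circ> f) (r \<circ> g)"
  by (auto simp: sum_map_def fun_eq_iff split: sum.split)

lemma og_relabel_comp: "og_relabel r (og_comp g f) = og_comp (og_relabel r g) (og_relabel r f)"
  by (simp add: og_relabel_def og_comp_def disjoint_union_def Let_def glue_def[abs_def] sum_map_comp)

lemma og_relabel_tens: "og_relabel r (og_tens f g) = og_tens (og_relabel r f) (og_relabel r g)"
  by (simp add: og_relabel_def og_tens_def disjoint_union_def sum_map_comp cong: if_cong)

lemma og_swap_tens: "og_swap (og_tens f g) = og_tens (og_swap f) (og_swap g)"
  by (simp add: og_swap_def og_tens_def disjoint_union_def sum_map_comp cong: if_cong)

lemma og_swap_swap [simp]: "og_swap (og_swap f) = f"
proof -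
  have "reverse_arrow \<circ> (reverse_arrow \<circ> h) = h" for h :: "nat \<Rightarrow> zx_arrow"
  proof
    fix x show "(reverse_arrow \<circ> (reverse_arrow \<circ> h)) x = h x" by (cases "h x") auto
  qed
  then show ?thesis by (simp add: og_swap_def)
qed

text \<open>Only an isomorphism: reversal exchanges the summands of the disjoint union, and with
  them the least representatives.\<close>

lemma swap_comp_iso:
  assumes c: "composable g f"
  shows "og_swap (og_comp g f) \<cong> og_comp (og_swap f) (og_swap g)"
proof -
  let ?L = "og_comp g f" and ?R = "og_comp (og_swap f) (og_swap g)"
  have c': "composable (og_swap f) (og_swap g)" using c by (auto simp: composable_def open_swap)
  have port: "glue (og_swap f) (og_swap g) (inr (outp f i)) = glue (og_swap f) (og_swap g) (inl (inp g i))"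
    if "1 \<le> i" "i \<le> outs f" for i
    using glue_port[of i "og_swap g" "og_swap f"] that c by (simp add: composable_def)
  have a: "fst (c2 (og_swap f) (og_swap g)) (outp f i) = fst (c1 (og_swap f) (og_swap g)) (inp g i)"
    if "1 \<le> i" "i \<le> outs f" for i
    using port that by simp
  have a': "fst (c2 g f) (outp (og_swap g) i) = fst (c1 g f) (inp (og_swap f) i)"
    if "1 \<le> i" "i \<le> outs (og_swap g)" for i
    using glue_port[of i f g] that c by (simp add: composable_def)
  let ?h = "copair (c2 (og_swap f) (og_swap g)) (c1 (og_swap f) (og_swap g))" and ?k = "copair (c2 g f) (c1 g f)"
  have G: "fst ?h (glue g f z) = fst ?h z" for z using a by (rule copair_glue)
  have G': "fst ?k (glue (og_swap f) (og_swap g) z) = fst ?k z" for z using a' by (rule copair_glue)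
  have "slice_hom (apex ?L) (apex (og_swap ?R)) ?h"
    using hom_swap[OF hom_c2[OF c']] hom_swap[OF hom_c1[OF c']] by (intro hom_comp c a) simp_all
  from hom_swap[OF this] have h: "slice_hom (apex (og_swap ?L)) (apex ?R) ?h" by simp
  have k: "slice_hom (apex ?R) (apex (og_swap ?L)) ?k"
    by (intro hom_comp c' a' hom_swap[OF hom_c1[OF c]] hom_swap[OF hom_c2[OF c]])
  show ?thesis
    by (rule og_isoI[OF open_swap[OF open_comp[OF c]] open_comp[OF c'] _ _ h k]) (auto simp: G G')
qed

text \<open>Reversal of a graph keeps the phases that \<open>dag\<close> negates; \<open>neg\<close>
  makes up for the difference in \<open>swap_translate\<close>.\<close>

primrec neg :: "zx_term \<Rightarrow> zx_term" where
  "neg (Id n) = Id n"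
| "neg (Braid m n) = Braid m n"
| "neg (Ev n) = Ev n"
| "neg (Cv n) = Cv n"
| "neg Wire = Wire"
| "neg (Green m n a) = Green m n (- a)"
| "neg (Red m n a) = Red m n (- a)"
| "neg Had = Had"
| "neg Diam = Diam"
| "neg (g \<bullet> f) = neg g \<bullet> neg f"
| "neg (f \<otimes> g) = neg f \<otimes> neg g"

lemma ty_neg [simp]: "ty (neg t) = ty t"
  by (induction t) (auto split: option.splits)

lemma neg_neg [simp]: "neg (neg t) = t" by (induction t) auto
lemma neg_dag: "neg (dag t) = dag (neg t)" by (induction t) auto
lemma neg_exchange: "neg (exchange t) = exchange (neg t)" by (induction t) auto
lemma neg_hads [simp]: "neg (hads n) = hads n" by (induction n) auto

lemma neg_phase_pi: "- phase_of pi = phase_of pi"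
proof -
  have "[- angle (phase_of pi) = - pi] (rmod (2 * pi))"
    using rcong_angle_phase_of[of pi] by simp
  moreover have "[- pi = pi] (rmod (2 * pi))"
    by (auto simp: rcong_altdef intro!: exI[of _ "1 :: int"])
  ultimately have "[- angle (phase_of pi) = pi] (rmod (2 * pi))" by (rule rcong_trans)
  then show ?thesis unfolding uminus_phase_def phase_of_eq_iff .
qed

text \<open>The relations with phase \<open>pi\<close> survive negation because \<open>pi\<close>
  and \<open>- pi\<close> agree modulo \<open>2 * pi\<close>; the others are uniform in their phases
  or have phase zero.\<close>

lemma basic_relation_neg: "basic_relation s t \<Longrightarrow> basic_relation (neg s) (neg t)"
proof (induction rule: basic_relation.induct)
  case (spider k n p q b m a)
  then show ?case using basic_relation.spider[of k n p q "- b" m "- a"] by (simp add: add.commute)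
next
  case (pi_commutation a)
  then show ?case using basic_relation.pi_commutation[of "- a"] by (simp add: neg_phase_pi)
qed (use basic_relation.intros in \<open>simp_all add: neg_phase_pi\<close>)

lemma zx_cong_neg: "zx_cong s t \<Longrightarrow> zx_cong (neg s) (neg t)"
proof (induction rule: zx_cong.induct)
  case (permute p q m a)
  show ?case using zx_cong.permute[of p q m "- a"] by simp
next
  case wire show ?case using zx_cong.wire by simp
qed (auto simp: neg_dag neg_exchange typed_iff_ty intro: zx_cong.intros basic_relation_neg)

lemma translate_exchange: "translate (exchange t) = og_relabel exchange_node (translate t)"
proof (induction t)
  case (Green m n a)
  then show ?case by (auto simp: og_green_def og_red_def og_star_def og_relabel_def fun_eq_iff)
next
  case (Red m n a)
  then show ?case by (auto simp: og_green_def og_red_def og_star_def og_relabel_def fun_eq_iff)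
next
  case (Comp g f)
  then show ?case by (simp add: og_relabel_comp)
next
  case (Tens f g)
  then show ?case by (simp add: og_relabel_tens)
qed (auto simp: og_id_def og_braid_def og_ev_def og_coev_def og_wire_def
     og_had_def og_diam_def og_star_def og_relabel_def N_zx_def fun_eq_iff)

lemma translate_neg: "translate (neg t) = og_relabel negate_node (translate t)"
proof (induction t)
  case (Green m n a)
  then show ?case by (auto simp: og_green_def og_red_def og_star_def og_relabel_def fun_eq_iff)
next
  case (Red m n a)
  then show ?case by (auto simp: og_green_def og_red_def og_star_def og_relabel_def fun_eq_iff)
next
  case (Comp g f)
  then show ?case by (simp add: og_relabel_comp)
next
  case (Tens f g)
  then show ?case by (simp add: og_relabel_tens)
qed (auto simp: og_id_def og_braid_def og_ev_def og_coev_def og_wire_def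
     og_had_def og_diam_def og_star_def og_relabel_def N_zx_def fun_eq_iff)

text \<open>Reversal turns the leaves after \<open>m\<close> into inputs, which have to be numbered
  first; the two maps exchange the blocks of leaves and arcs.\<close>

lemma swap_star_iso:
  assumes "x \<noteq> White" "x = DiamN \<longrightarrow> m + n = 0"
  shows "og_swap (og_star x m n) \<cong> og_star x n m"
proof -
  let ?h = "\<lambda>v. if v = 0 then 0 else if v \<le> m then n + v else v - m"
  let ?k = "\<lambda>v. if v = 0 then 0 else if v \<le> n then m + v else v - n"
  have o: "open_graph (og_swap (og_star x m n))" "open_graph (og_star x n m)"
    using assms by (auto intro!: open_swap open_star)
  show ?thesis
    by (rule og_isoI[OF o, of "(?h, ?h)" "(?k, ?k)"])
      (use open_graph_port(1)[OF o(1)] open_graph_port(1)[OF o(2)] in \<open>auto simp: slice_hom_iff\<close>)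
qed

lemma swap_wire_iso: "og_swap og_wire \<cong> og_wire"
proof -
  have o: "open_graph (og_swap og_wire)" by (intro open_swap open_wire)
  show ?thesis
    by (rule og_isoI[OF o open_wire, of "(\<lambda>v. 1 - v, id)" "(\<lambda>v. 1 - v, id)"])
      (use open_graph_port(1)[OF o] open_graph_port(1)[OF open_wire] in \<open>auto simp: slice_hom_iff\<close>)
qed

lemma swap_N_zx:
  "og_swap (og_id n) = og_id n" "og_swap (og_ev n) = og_coev n" "og_swap (og_coev n) = og_ev n"
  by (simp_all add: og_swap_def og_id_def og_ev_def og_coev_def N_zx_def o_def)

lemma swap_braid_iso: "og_swap (og_braid m n) \<cong> og_braid n m"
proof -
  have o: "open_graph (og_swap (og_braid m n))" by (intro open_swap open_braid)
  show ?thesis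
    by (rule og_isoI[OF o open_braid, where h = "(bperm n m, id)" and k = "(bperm m n, id)"])
      (use open_graph_port(1)[OF o] open_graph_port(1)[OF open_braid[of n m]] in
        \<open>auto simp: slice_hom_iff og_braid_pg bperm_def\<close>)
qed

lemma translate_open: "typed t m n \<Longrightarrow> open_graph (translate t)"
  and translate_ins: "typed t m n \<Longrightarrow> ins (translate t) = m"
  and translate_outs: "typed t m n \<Longrightarrow> outs (translate t) = n"
  using translate_typed by auto

lemma composable_translate: "typed f m k \<Longrightarrow> typed g k n \<Longrightarrow> composable (translate g) (translate f)"
  by (simp add: composable_def translate_open translate_ins translate_outs)

lemma swap_translate: "typed t m n \<Longrightarrow> og_swap (translate t) \<cong> translate (neg (dag t))"
proof (induction rule: typed.induct)
  case (10 f m k g n)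
  have "og_swap (translate (g \<bullet> f)) \<cong> og_comp (og_swap (translate f)) (og_swap (translate g))"
    using swap_comp_iso[OF composable_translate[OF 10(1,2)]] by simp
  also have "\<dots> \<cong> translate (neg (dag (g \<bullet> f)))"
    using comp_iso_cong[OF 10(4,3)] translate_ins[OF 10(2)] translate_outs[OF 10(1)] by simp
  finally show ?case .
next
  case (11 f m n g m' n')
  then show ?case by (simp add: og_swap_tens tens_iso_cong)
qed (simp_all add: swap_N_zx swap_braid_iso swap_wire_iso og_green_def og_red_def og_had_def og_diam_def
    swap_star_iso og_iso_refl open_id open_ev open_coev)

lemma dag_translate: "typed t m n \<Longrightarrow> og_dag (translate t) \<cong> translate (dag t)"
  using relabel_iso[OF good_negate swap_translate[of t m n]] by (simp add: og_dag_def flip: translate_neg)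

section \<open>The generated 1-cells\<close>

lemma cell1_open: "zx_cell1 f \<Longrightarrow> open_graph f"
proof (induction rule: zx_cell1.induct)
  case (comp f g)
  then show ?case by (auto intro: open_comp simp: composable_def)
next
  case (iso f g h)
  then show ?case by (simp add: cospan_iso_def cospan_map_iff)
qed (auto simp: open_wire open_id open_ev open_coev open_braid og_green_def og_red_def og_had_def
   og_diam_def open_star open_tens)

lemma cell1_translate: "typed t m n \<Longrightarrow> zx_cell1 (translate t)"
  by (induction rule: typed.induct) (auto intro: zx_cell1.intros(1-11) simp: translate_ins translate_outs)

lemma cell1_iso: "zx_cell1 f \<Longrightarrow> f \<cong> g \<Longrightarrow> zx_cell1 g"
  unfolding og_iso_def by (blast intro: zx_cell1.iso)

lemma cell1_full: "zx_cell1 f \<Longrightarrow> \<exists>t. typed t (ins f) (outs f) \<and> translate t \<cong> f"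
proof (induction rule: zx_cell1.induct)
  case wire
  then show ?case using typed.intros(5) open_wire og_iso_refl by (intro exI[of _ Wire]) auto
next
  case (green m n a)
  then show ?case using typed.intros(6) by (intro exI[of _ "Green m n a"]) (auto simp: og_green_def intro!: og_iso_refl open_star)
next
  case (red m n a)
  then show ?case using typed.intros(7) by (intro exI[of _ "Red m n a"]) (auto simp: og_red_def intro!: og_iso_refl open_star)
next
  case had
  then show ?case using typed.intros(8) by (intro exI[of _ Had]) (auto simp: og_had_def intro!: og_iso_refl open_star)
next
  case diam
  then show ?case using typed.intros(9) by (intro exI[of _ Diam]) (auto simp: og_diam_def intro!: og_iso_refl open_star)
next
  case (ident n)
  then show ?case using typed.intros(1) by (intro exI[of _ "Id n"]) (auto simp: og_id_pg intro!: og_iso_refl open_pg)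
next
  case (braid m n)
  then show ?case using typed.intros(2) by (intro exI[of _ "Braid m n"]) (auto simp: og_braid_pg intro!: og_iso_refl open_pg)
next
  case (ev n)
  then show ?case using typed.intros(3) by (intro exI[of _ "Ev n"]) (auto intro!: og_iso_refl open_ev)
next
  case (coev n)
  then show ?case using typed.intros(4) by (intro exI[of _ "Cv n"]) (auto intro!: og_iso_refl open_coev)
next
  case (comp f g)
  then obtain s t where s: "typed s (ins f) (outs f)" "translate s \<cong> f" and t: "typed t (ins g) (outs g)" "translate t \<cong> g"
    by blast
  then have "typed (t \<bullet> s) (ins f) (outs g)" "translate (t \<bullet> s) \<cong> og_comp g f"
    using comp(3) comp_iso_cong[OF s(2) t(2)] translate_outs[OF s(1)] translate_ins[OF t(1)]
    by (auto intro: typed.intros)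
  then show ?case by (intro exI[of _ "t \<bullet> s"]) simp
next
  case (tens f g)
  then obtain s t where s: "typed s (ins f) (outs f)" "translate s \<cong> f" and t: "typed t (ins g) (outs g)" "translate t \<cong> g"
    by blast
  then have "typed (s \<otimes> t) (ins f + ins g) (outs f + outs g)" "translate (s \<otimes> t) \<cong> og_tens f g"
    using tens_iso_cong[OF s(2) t(2)] by (auto intro: typed.intros)
  then show ?case by (intro exI[of _ "s \<otimes> t"]) simp
next
  case (iso f g h)
  have "f \<cong> g" unfolding og_iso_def using iso.hyps by blast
  then show ?case using iso.IH og_iso_trans og_iso_ins og_iso_outs by metis
qed

lemma cell1_relabel:
  assumes "zx_cell1 f" shows "zx_cell1 (og_relabel exchange_node f)" "zx_cell1 (og_relabel negate_node f)"
proof -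
  obtain t where t: "typed t (ins f) (outs f)" "translate t \<cong> f" using cell1_full[OF assms] by blast
  then have "typed (exchange t) (ins f) (outs f)" "typed (neg t) (ins f) (outs f)" by (auto simp: typed_iff_ty)
  then have "zx_cell1 (translate (exchange t))" "zx_cell1 (translate (neg t))" by (blast intro: cell1_translate)+
  then show "zx_cell1 (og_relabel exchange_node f)" "zx_cell1 (og_relabel negate_node f)"
    using relabel_iso[OF good_exchange t(2)] relabel_iso[OF good_negate t(2)] cell1_iso
    by (auto simp: translate_exchange translate_neg)
qed

lemma cell1_swap:
  assumes "zx_cell1 f" shows "zx_cell1 (og_swap f)"
proof -
  obtain t where t: "typed t (ins f) (outs f)" "translate t \<cong> f" using cell1_full[OF assms] by blast
  then have "typed (neg (dag t)) (outs f) (ins f)" by (auto simp: typed_iff_ty)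
  then have "zx_cell1 (translate (neg (dag t)))" by (rule cell1_translate)
  moreover have "translate (neg (dag t)) \<cong> og_swap f"
    using og_iso_trans[OF og_iso_sym[OF swap_translate[OF t(1)]] swap_iso[OF t(2)]] .
  ultimately show ?thesis by (rule cell1_iso)
qed

text \<open>2-cells with the same ends are identified, so only their existence matters, and
  inductions can run over pairs of ends.\<close>

definition Rel :: "ograph \<Rightarrow> ograph \<Rightarrow> bool" where
  "Rel f g \<longleftrightarrow> (\<exists>cell. zx_cell2 cell \<and> sdom cell = f \<and> scod cell = g)"

lemma Rel_basic: "basic_cell2 cell \<Longrightarrow> Rel (sdom cell) (scod cell)"
  unfolding Rel_def by (blast intro: zx_cell2.basic)

lemma Rel_iso:
  assumes "zx_cell1 f" "f \<cong> g" shows "Rel f g"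
proof -
  obtain h where h: "cospan_iso f g h" using assms(2) by (auto simp: og_iso_def)
  have "iso_pair f f (id, id) (id, id)"
    using cell1_open[OF assms(1)] by (simp add: iso_pair_def hom_id open_graph_port)
  then have "cospan_iso f f (id, id)" by (rule iso_pair_imp)
  then have "zx_cell2 \<lparr> sdom = f, scod = g, sapex = f, sleft = (id, id), sright = h \<rparr>"
    using assms h cell1_iso by (intro zx_cell2.iso) auto
  then show ?thesis unfolding Rel_def by force
qed

lemma Rel_trans [trans]:
  assumes "Rel f g" "Rel g h" shows "Rel f h"
proof -
  from assms obtain c d where "zx_cell2 c" "sdom c = f" "scod c = g" "zx_cell2 d" "sdom d = g" "scod d = h"
    unfolding Rel_def by blast
  then have "zx_cell2 (vcomp d c)" by (intro zx_cell2.vertical) auto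
  moreover have "sdom (vcomp d c) = f" "scod (vcomp d c) = h"
    using \<open>sdom c = f\<close> \<open>scod d = h\<close> by (simp_all add: vcomp_def)
  ultimately show ?thesis unfolding Rel_def by blast
qed

lemma Rel_comp:
  assumes "Rel f f'" "Rel g g'" "outs f = ins g" shows "Rel (og_comp g f) (og_comp g' f')"
proof -
  from assms obtain c d where "zx_cell2 c" "sdom c = f" "scod c = f'" "zx_cell2 d" "sdom d = g" "scod d = g'"
    unfolding Rel_def by blast
  then have "zx_cell2 (hcomp d c)" using assms(3) by (intro zx_cell2.horizontal) auto
  moreover have "sdom (hcomp d c) = og_comp g f" "scod (hcomp d c) = og_comp g' f'"
    using \<open>sdom c = f\<close> \<open>sdom d = g\<close> \<open>scod c = f'\<close> \<open>scod d = g'\<close> by (simp_all add: hcomp_def)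
  ultimately show ?thesis unfolding Rel_def by blast
qed

lemma Rel_tens:
  assumes "Rel f f'" "Rel g g'" shows "Rel (og_tens f g) (og_tens f' g')"
proof -
  from assms obtain c d where "zx_cell2 c" "sdom c = f" "scod c = f'" "zx_cell2 d" "sdom d = g" "scod d = g'"
    unfolding Rel_def by blast
  then have "zx_cell2 (span_tens c d)" by (intro zx_cell2.tensor)
  moreover have "sdom (span_tens c d) = og_tens f g" "scod (span_tens c d) = og_tens f' g'"
    using \<open>sdom c = f\<close> \<open>sdom d = g\<close> \<open>scod c = f'\<close> \<open>scod d = g'\<close> by (simp_all add: span_tens_def)
  ultimately show ?thesis unfolding Rel_def by blast
qed

text \<open>Spans are discarded: one with two invertible legs becomes an isomorphism between its
  ends, and a change of representative keeps both ends.\<close>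

lemma Rel_induct [consumes 1, case_names basic iso trans comp tens]:
  assumes "Rel f g"
    and basic: "\<And>cell. basic_cell2 cell \<Longrightarrow> P (sdom cell) (scod cell)"
    and iso: "\<And>f g. zx_cell1 f \<Longrightarrow> zx_cell1 g \<Longrightarrow> f \<cong> g \<Longrightarrow> P f g"
    and trans: "\<And>f g h. Rel f g \<Longrightarrow> P f g \<Longrightarrow> Rel g h \<Longrightarrow> P g h \<Longrightarrow> P f h"
    and comp: "\<And>f f' g g'. Rel f f' \<Longrightarrow> P f f' \<Longrightarrow> Rel g g' \<Longrightarrow> P g g' \<Longrightarrow> outs f = ins g \<Longrightarrow>
       P (og_comp g f) (og_comp g' f')"
    and tens: "\<And>f f' g g'. Rel f f' \<Longrightarrow> P f f' \<Longrightarrow> Rel g g' \<Longrightarrow> P g g' \<Longrightarrow> P (og_tens f g) (og_tens f' g')"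
  shows "P f g"
proof -
  have "zx_cell2 cell \<Longrightarrow> P (sdom cell) (scod cell)" for cell
  proof (induction rule: zx_cell2.induct)
    case (basic cell) then show ?case by (rule assms(2))
  next
    case (iso cell)
    then have "sdom cell \<cong> scod cell"
      using og_iso_trans og_iso_sym unfolding og_iso_def by meson
    then show ?case using iso assms(3) by blast
  next
    case (vertical c d)
    then have "Rel (sdom c) (scod c)" "Rel (sdom d) (scod d)" by (auto simp: Rel_def)
    then show ?case using vertical trans[of "sdom c" "scod c" "scod d"] by (simp add: vcomp_def)
  next
    case (horizontal c d)
    then have "Rel (sdom c) (scod c)" "Rel (sdom d) (scod d)" by (auto simp: Rel_def)
    then show ?case using horizontal comp by (simp add: hcomp_def)
  next
    case (tensor c d)
    then have "Rel (sdom c) (scod c)" "Rel (sdom d) (scod d)" by (auto simp: Rel_def)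
    then show ?case using tensor tens by (simp add: span_tens_def)
  next
    case (same_class c d) then show ?case by simp
  qed
  then show ?thesis using assms(1) unfolding Rel_def by blast
qed

lemma span_simps [simp]:
  "sdom (basic_span f g) = f" "scod (basic_span f g) = g"
  "sdom (span_relabel r cell) = og_relabel r (sdom cell)" "scod (span_relabel r cell) = og_relabel r (scod cell)"
  "sdom (span_swap cell) = og_swap (sdom cell)" "scod (span_swap cell) = og_swap (scod cell)"
  "sdom (span_turn cell) = scod cell" "scod (span_turn cell) = sdom cell"
  by (simp_all add: basic_span_def Let_def span_relabel_def span_swap_def span_turn_def)

lemma basic_relation_typed: "basic_relation s t \<Longrightarrow> \<exists>m n. typed s m n \<and> typed t m n"
  using ty_basic_relation by (simp add: typed_iff_ty)

lemma basic_cell2_cell1: "basic_cell2 cell \<Longrightarrow> zx_cell1 (sdom cell) \<and> zx_cell1 (scod cell) \<and>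
  ins (sdom cell) = ins (scod cell) \<and> outs (sdom cell) = outs (scod cell)"
proof (induction rule: basic_cell2.induct)
  case (relation s t)
  then obtain m n where "typed s m n" "typed t m n" using basic_relation_typed by blast
  then show ?case using cell1_translate by (simp add: translate_ins translate_outs)
next
  case wire
  then show ?case using zx_cell1.wire zx_cell1.ident[of 1] by (simp add: og_id_pg)
qed (auto simp: cell1_relabel cell1_swap)

lemma Rel_cell1: "Rel f g \<Longrightarrow> zx_cell1 f \<and> zx_cell1 g \<and> ins f = ins g \<and> outs f = outs g"
proof (induction rule: Rel_induct)
  case (basic cell) then show ?case using basic_cell2_cell1 by blast
next
  case (iso f g) then show ?case using og_iso_ins og_iso_outs by blast
qed (auto intro: zx_cell1.comp zx_cell1.tens)

lemma Rel_sym: "Rel f g \<Longrightarrow> Rel g f"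
proof (induction rule: Rel_induct)
  case (basic cell) then show ?case using Rel_basic[OF basic_cell2.turn] by simp
next
  case (iso f g) then show ?case using Rel_iso og_iso_sym by blast
next
  case (trans f g h) then show ?case by (blast intro: Rel_trans)
next
  case (comp f f' g g') then show ?case using Rel_cell1[OF comp.hyps(1)] Rel_cell1[OF comp.hyps(2)] by (intro Rel_comp) auto
next
  case (tens f f' g g') then show ?case by (intro Rel_tens)
qed

text \<open>Relabelling commutes with composition and tensor on the nose, which leaves basic 2-cells
  and isomorphisms to be checked.\<close>

lemma Rel_relabel:
  assumes r: "good r" and cell1: "\<And>f. zx_cell1 f \<Longrightarrow> zx_cell1 (og_relabel r f)"
    and basic: "\<And>cell. basic_cell2 cell \<Longrightarrow> Rel (og_relabel r (sdom cell)) (og_relabel r (scod cell))"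
  shows "Rel f g \<Longrightarrow> Rel (og_relabel r f) (og_relabel r g)"
proof (induction rule: Rel_induct)
  case (basic cell) then show ?case by (rule assms(3))
next
  case (iso f g) then show ?case using Rel_iso cell1 relabel_iso[OF r] by blast
next
  case (trans f g h) then show ?case by (blast intro: Rel_trans)
qed (simp_all add: og_relabel_comp og_relabel_tens Rel_tens Rel_comp)

lemma Rel_exchange: "Rel f g \<Longrightarrow> Rel (og_relabel exchange_node f) (og_relabel exchange_node g)"
  by (rule Rel_relabel[OF good_exchange cell1_relabel(1)]) (use Rel_basic[OF basic_cell2.exchange] in auto)

lemma og_relabel_relabel: "og_relabel r (og_relabel s f) = og_relabel (r \<circ> s) f"
proof -
  have "map_arrow r \<circ> (map_arrow s \<circ> h) = map_arrow (r \<circ> s) \<circ> h" for h :: "nat \<Rightarrow> zx_arrow"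
  proof
    fix x show "(map_arrow r \<circ> (map_arrow s \<circ> h)) x = (map_arrow (r \<circ> s) \<circ> h) x" by (cases "h x") auto
  qed
  then show ?thesis using o_assoc[of r s "vl (apex f)"] by (simp add: og_relabel_def)
qed

lemma og_relabel_swap: "og_relabel r (og_swap f) = og_swap (og_relabel r f)"
proof -
  have "map_arrow r \<circ> (reverse_arrow \<circ> h) = reverse_arrow \<circ> (map_arrow r \<circ> h)" for h :: "nat \<Rightarrow> zx_arrow"
  proof
    fix x show "(map_arrow r \<circ> (reverse_arrow \<circ> h)) x = (reverse_arrow \<circ> (map_arrow r \<circ> h)) x" by (cases "h x") auto
  qed
  then show ?thesis by (simp add: og_relabel_def og_swap_def)
qed

lemma negate_exchange: "negate_node \<circ> exchange_node = exchange_node \<circ> negate_node"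
proof
  fix x show "(negate_node \<circ> exchange_node) x = (exchange_node \<circ> negate_node) x" by (cases x) auto
qed

text \<open>Negating phases is not one of the operations that generate basic 2-cells, so a 2-cell
  between the negated ends has to be produced; for the relations it comes from
  \<open>basic_relation_neg\<close>.\<close>

lemma basic_cell2_negate:
  "basic_cell2 cell \<Longrightarrow> \<exists>cell'. basic_cell2 cell' \<and> sdom cell' = og_relabel negate_node (sdom cell) \<and>
     scod cell' = og_relabel negate_node (scod cell)"
proof (induction rule: basic_cell2.induct)
  case (relation s t)
  then show ?case using basic_cell2.relation[OF basic_relation_neg]
    by (intro exI[of _ "basic_span (translate (neg s)) (translate (neg t))"]) (simp add: translate_neg)
next
  case wire
  have "og_relabel negate_node og_wire = og_wire" "og_relabel negate_node (og_id 1) = og_id 1"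
    using translate_neg[of Wire] translate_neg[of "Id 1"] by simp_all
  then show ?case using basic_cell2.wire by (intro exI[of _ "basic_span og_wire (og_id 1)"]) simp
next
  case (exchange cell)
  then obtain cell' where "basic_cell2 cell'" "sdom cell' = og_relabel negate_node (sdom cell)"
     "scod cell' = og_relabel negate_node (scod cell)" by blast
  then show ?case using basic_cell2.exchange[of cell']
    by (intro exI[of _ "span_relabel exchange_node cell'"]) (simp add: og_relabel_relabel negate_exchange)
next
  case (swap cell)
  then obtain cell' where "basic_cell2 cell'" "sdom cell' = og_relabel negate_node (sdom cell)"
     "scod cell' = og_relabel negate_node (scod cell)" by blast
  then show ?case using basic_cell2.swap[of cell']
    by (intro exI[of _ "span_swap cell'"]) (simp add: og_relabel_swap)
next
  case (turn cell)
  then show ?case using basic_cell2.turn by (metis span_simps(7,8))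
qed

lemma Rel_negate: "Rel f g \<Longrightarrow> Rel (og_relabel negate_node f) (og_relabel negate_node g)"
  by (rule Rel_relabel[OF good_negate cell1_relabel(2)]) (use basic_cell2_negate Rel_basic in fastforce)+

lemma Rel_swap: "Rel f g \<Longrightarrow> Rel (og_swap f) (og_swap g)"
proof (induction rule: Rel_induct)
  case (basic cell) then show ?case using Rel_basic[OF basic_cell2.swap] by simp
next
  case (iso f g) then show ?case using Rel_iso cell1_swap swap_iso by blast
next
  case (trans f g h) then show ?case by (blast intro: Rel_trans)
next
  case (comp f f' g g')
  have c: "composable g f" "composable g' f'"
    using Rel_cell1[OF comp.hyps(1)] Rel_cell1[OF comp.hyps(2)] comp.hyps(3) cell1_open by (auto simp: composable_def)
  have z: "zx_cell1 (og_comp g f)" "zx_cell1 (og_comp g' f')"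
    using Rel_cell1[OF comp.hyps(1)] Rel_cell1[OF comp.hyps(2)] comp.hyps(3) by (auto intro: zx_cell1.comp)
  \<comment> \<open>Reversal respects composites only up to isomorphism, so both ends are corrected
    by invertible 2-cells.\<close>
  have "Rel (og_swap (og_comp g f)) (og_comp (og_swap f) (og_swap g))"
    "Rel (og_swap (og_comp g' f')) (og_comp (og_swap f') (og_swap g'))"
    using z c Rel_iso cell1_swap swap_comp_iso by blast+
  moreover have "Rel (og_comp (og_swap f) (og_swap g)) (og_comp (og_swap f') (og_swap g'))"
    using comp by (intro Rel_comp) auto
  ultimately show ?case by (meson Rel_trans Rel_sym)
next
  case (tens f f' g g') then show ?case by (simp add: og_swap_tens Rel_tens)
qed

lemma Rel_dag: "Rel f g \<Longrightarrow> Rel (og_dag f) (og_dag g)"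
  unfolding og_dag_def by (intro Rel_negate Rel_swap)

text \<open>Exchanging two output ports is undone by renumbering the leaves; the renumbering
  \<open>\<phi>\<close> is an involution and so provides its own inverse.\<close>

lemma permute_iso:
  assumes x: "x \<noteq> White" "x \<noteq> DiamN"
  shows "og_comp (og_tens (og_id p) (og_tens (og_braid 1 1) (og_id q))) (og_star x m (p + (2 + q)))
    \<cong> og_star x m (p + (2 + q))"
proof -
  let ?n = "p + (2 + q)" and ?s = "og_star x m (p + (2 + q))"
  define \<phi> where "\<phi> = psum p p id (psum 2 2 (bperm 1 1) id)"
  have two: "range_ok 2 2 (bperm 1 1)" by (auto simp: range_ok_def bperm_def)
  then have r: "range_ok (2 + q) (2 + q) (psum 2 2 (bperm 1 1) id)" by (rule range_ok_psum) simp
  have \<phi>: "range_ok ?n ?n \<phi>" unfolding \<phi>_def by (rule range_ok_psum[OF range_ok_id r])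
  have inv: "\<phi> (\<phi> i) = i" if "1 \<le> i" for i
    using that by (auto simp: \<phi>_def psum_def bperm_def)
  have o: "open_graph ?s" using x by (intro open_star) auto
  have "og_tens (og_id p) (og_tens (og_braid 1 1) (og_id q)) \<cong> og_tens (og_id p) (pg (2 + q) (2 + q) (psum 2 2 (bperm 1 1) id))"
    using pg_tens_iso[OF two, of q q id] 
    by (intro tens_iso_cong og_iso_refl open_id) (simp add: og_braid_pg og_id_pg numeral_2_eq_2)
  also have "\<dots> \<cong> pg ?n ?n \<phi>"
    unfolding og_id_pg \<phi>_def using r by (intro pg_tens_iso) auto
  finally have "og_comp (og_tens (og_id p) (og_tens (og_braid 1 1) (og_id q))) ?s \<cong> og_comp (pg ?n ?n \<phi>) ?s"
    by (intro comp_iso_cong og_iso_refl o) (auto simp: og_braid_pg og_id_pg)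
  also have X: "\<dots> \<cong> ?s \<lparr> outs := ?n, outp := outp ?s \<circ> \<phi> \<rparr>"
    by (rule pg_comp_iso[OF o _ \<phi>]) simp
  also have "\<dots> \<cong> ?s"
  proof -
    \<comment> \<open>A leaf and its arc bear the same number, so one renumbering serves nodes and
      arcs.\<close>
    let ?h = "\<lambda>v. if v \<le> m then v else m + \<phi> (v - m)"
    have pos: "0 < \<phi> i" if "0 < i" for i
      using that by (auto simp: \<phi>_def psum_def bperm_def)
    have le: "\<phi> i \<le> ?n" if "0 < i" "i \<le> ?n" for i
      using range_okD[OF \<phi>, of i] that by auto
    have pos': "\<phi> (v - m) \<noteq> 0" "m + \<phi> (v - m) \<noteq> 0" "\<not> m + \<phi> (v - m) \<le> m" if "\<not> v \<le> m" for v
      using pos[of "v - m"] that by simp_all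
    have le': "\<phi> (v - m) \<le> ?n" if "\<not> v \<le> m" "v \<le> m + ?n" for v
      using le[of "v - m"] that by simp
    have so: "slice_obj (apex ?s)" using open_graph_port(1)[OF o] .
    have h: "slice_hom (apex ?s) (apex ?s) (?h, ?h)"
      unfolding slice_hom_iff
    proof (intro conjI so ballI)
      fix v assume "v \<in> vs (apex ?s)"
      then show "fst (?h, ?h) v \<in> vs (apex ?s)" "vl (apex ?s) (fst (?h, ?h) v) = vl (apex ?s) v"
        using le'[of v] pos'[of v] by (cases "v \<le> m"; simp)+
    next
      fix e assume "e \<in> es (apex ?s)"
      then show "snd (?h, ?h) e \<in> es (apex ?s)"
        "src (apex ?s) (snd (?h, ?h) e) = fst (?h, ?h) (src (apex ?s) e)"
        "tgt (apex ?s) (snd (?h, ?h) e) = fst (?h, ?h) (tgt (apex ?s) e)"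
        "el (apex ?s) (snd (?h, ?h) e) = el (apex ?s) e"
        using le'[of e] pos'[of e] by (cases "e \<le> m"; simp add: Suc_le_eq)+
    qed
    show ?thesis
      by (rule og_isoI[OF og_iso_open(2)[OF X] o, of "(?h, ?h)" "(?h, ?h)"])
        (use h inv pos range_okD[OF \<phi>] in \<open>auto simp: Suc_le_eq not_le\<close>)
  qed
  finally show ?thesis .
qed

text \<open>Relations become basic 2-cells, congruence rules become composites of 2-cells, and the
  structural rules become isomorphisms. The dagger case needs two corrections, since
  \<open>og_dag\<close> agrees with \<open>dag\<close> only up to isomorphism.\<close>

lemma soundness: "zx_cong s t \<Longrightarrow> Rel (translate s) (translate t)"
proof -
  have iso: "Rel (translate s) (translate t)" if "zx_cong s t" "translate s \<cong> translate t" for s t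
    using ty_zx_cong[OF that(1)] cell1_translate that(2) Rel_iso by (auto simp: typed_iff_ty[symmetric])
  note tr = translate_open translate_ins translate_outs composable_translate
  show "zx_cong s t \<Longrightarrow> Rel (translate s) (translate t)"
  proof (induction rule: zx_cong.induct)
    case (basic s t)
    then show ?case using Rel_basic[OF basic_cell2.relation] by simp
  next
    case (permute p q m a)
    show ?case by (rule iso[OF zx_cong.permute]) (use permute_iso[of "GreenN a" p q m] in \<open>simp add: og_green_def\<close>)
  next
    case wire
    then show ?case using Rel_basic[OF basic_cell2.wire] by simp
  next
    case (exchange s t)
    then show ?case using Rel_exchange by (simp add: translate_exchange)
  next
    case (dagger s t)
    then obtain m n where ty: "typed s m n" "typed t m n" by (auto simp: typed_iff_ty dest: ty_zx_cong)
    then have "zx_cell1 (translate (dag s))" "zx_cell1 (translate (dag t))"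
      by (auto intro!: cell1_translate[of _ n m] simp: typed_iff_ty)
    moreover have "Rel (og_dag (translate s)) (og_dag (translate t))" using dagger Rel_dag by blast
    ultimately show ?case
      using Rel_iso[OF _ og_iso_sym[OF dag_translate]] ty by (meson Rel_trans Rel_sym)
  next
    case (refl t m n)
    then show ?case using cell1_translate Rel_iso og_iso_refl translate_open by blast
  next
    case (sym s t) then show ?case by (blast intro: Rel_sym)
  next
    case (trans s t u) then show ?case by (blast intro: Rel_trans)
  next
    case (comp_cong f f' g g' m k n)
    then show ?case by (auto intro!: Rel_comp simp: tr)
  next
    case (tens_cong f f' g g') then show ?case by (simp add: Rel_tens)
  next
    case (comp_id_left f m n)
    show ?case by (rule iso[OF zx_cong.comp_id_left[OF comp_id_left]]) (use comp_id_left in \<open>simp add: tr id_comp_iso\<close>)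
  next
    case (comp_id_right f m n)
    show ?case by (rule iso[OF zx_cong.comp_id_right[OF comp_id_right]]) (use comp_id_right in \<open>simp add: tr comp_id_iso\<close>)
  next
    case (comp_assoc f m k g l h n)
    show ?case by (rule iso[OF zx_cong.comp_assoc[OF comp_assoc]]) (use comp_assoc in \<open>simp add: comp_assoc_iso tr\<close>)
  next
    case (tens_id m n)
    show ?case by (rule iso[OF zx_cong.tens_id]) (simp add: tens_id_iso)
  next
    case (tens_comp f m k g n f' m' k' g' n')
    show ?case by (rule iso[OF zx_cong.tens_comp[OF tens_comp]]) (use tens_comp in \<open>simp add: tens_comp_iso tr\<close>)
  next
    case (tens_assoc f m n f' m' n' f'' m'' n'')
    show ?case by (rule iso[OF zx_cong.tens_assoc[OF tens_assoc]]) (use tens_assoc in \<open>simp add: tens_assoc_iso tr\<close>)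
  next
    case (tens_unit_left f m n)
    show ?case by (rule iso[OF zx_cong.tens_unit_left[OF tens_unit_left]]) (use tens_unit_left in \<open>simp add: unit_tens_iso tr\<close>)
  next
    case (tens_unit_right f m n)
    show ?case by (rule iso[OF zx_cong.tens_unit_right[OF tens_unit_right]]) (use tens_unit_right in \<open>simp add: tens_unit_iso tr\<close>)
  next
    case (braid_natural f m n f' m' n')
    show ?case by (rule iso[OF zx_cong.braid_natural[OF braid_natural]])
      (use braid_natural braid_natural_iso[of "translate f" "translate f'"] in \<open>simp add: tr\<close>)
  next
    case (braid_braid n m)
    show ?case by (rule iso[OF zx_cong.braid_braid]) (simp add: braid_braid_iso)
  next
    case (hexagon m n k)
    show ?case by (rule iso[OF zx_cong.hexagon]) (simp add: hexagon_iso)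
  next
    case (snake n)
    show ?case by (rule iso[OF zx_cong.snake]) (simp add: snake_iso)
  next
    case (ev_braid n)
    show ?case by (rule iso[OF zx_cong.ev_braid]) (simp add: ev_braid_iso)
  next
    case (ev_tens m n)
    show ?case by (rule iso[OF zx_cong.ev_tens]) (simp add: ev_tens_iso)
  qed
qed

text \<open>A 2-cell read back on terms. Terms and graphs are tied only up to isomorphism, since a
  generated 1-cell need not be a translation on the nose.\<close>

definition presented :: "ograph \<Rightarrow> ograph \<Rightarrow> bool" where
  "presented f g \<longleftrightarrow> (\<exists>s t. zx_cong s t \<and> translate s \<cong> f \<and> translate t \<cong> g)"

lemma presented_basic: "basic_cell2 cell \<Longrightarrow> presented (sdom cell) (scod cell)"
proof (induction rule: basic_cell2.induct)
  case (relation s t)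
  then obtain m n where "typed s m n" "typed t m n" using basic_relation_typed by blast
  then show ?case using relation unfolding presented_def
    by (intro exI[of _ s] exI[of _ t]) (auto intro: zx_cong.basic og_iso_refl translate_open)
next
  case wire
  then show ?case unfolding presented_def
    by (intro exI[of _ Wire] exI[of _ "Id 1"]) (simp add: zx_cong.wire[simplified] og_iso_refl open_wire open_id)
next
  case (exchange cell)
  then obtain s t where "zx_cong s t" "translate s \<cong> sdom cell" "translate t \<cong> scod cell"
    by (auto simp: presented_def)
  then show ?case unfolding presented_def
    by (intro exI[of _ "exchange s"] exI[of _ "exchange t"])
      (simp add: zx_cong.exchange translate_exchange relabel_iso good_exchange)
next
  case (swap cell)
  then obtain s t where st: "zx_cong s t" "translate s \<cong> sdom cell" "translate t \<cong> scod cell"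
    by (auto simp: presented_def)
  then obtain m n where "typed s m n" "typed t m n" by (auto simp: typed_iff_ty dest: ty_zx_cong)
  then have "translate (neg (dag s)) \<cong> og_swap (sdom cell)" "translate (neg (dag t)) \<cong> og_swap (scod cell)"
    using st swap_iso swap_translate og_iso_sym og_iso_trans by meson+
  then show ?case unfolding presented_def using st zx_cong_neg zx_cong.dagger by fastforce
next
  case (turn cell)
  then show ?case unfolding presented_def using zx_cong.sym by fastforce
qed

lemma completeness: "Rel f g \<Longrightarrow> presented f g"
proof (induction rule: Rel_induct)
  case (basic cell) then show ?case by (rule presented_basic)
next
  case (iso f g)
  obtain t where t: "typed t (ins f) (outs f)" "translate t \<cong> f" using cell1_full[OF iso(1)] by blast
  then show ?case unfolding presented_def using iso(3) og_iso_trans zx_cong.refl by blast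
next
  case (trans f g h)
  then obtain s t s' t' where 1: "zx_cong s t" "translate s \<cong> f" "translate t \<cong> g"
    and 2: "zx_cong s' t'" "translate s' \<cong> g" "translate t' \<cong> h" unfolding presented_def by blast
  then obtain m n m' n' where t: "typed t m n" "typed s' m' n'" using ty_zx_cong by (meson typed_iff_ty)
  moreover have iso: "translate t \<cong> translate s'" using 1 2 og_iso_trans og_iso_sym by blast
  moreover have "m' = m" "n' = n" using t og_iso_ins[OF iso] og_iso_outs[OF iso] by (auto simp: translate_ins translate_outs)
  \<comment> \<open>The terms \<open>t\<close> and \<open>s'\<close> were chosen independently for
    the two 2-cells but represent the same middle graph.\<close>
  ultimately have "zx_cong t s'" using coherence by (simp add: zx_eq_iff_cong)
  then show ?case unfolding presented_def using 1 2 zx_cong.trans by blast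
next
  case (comp f f' g g')
  then obtain s t s' t' where 1: "zx_cong s t" "translate s \<cong> f" "translate t \<cong> f'"
    and 2: "zx_cong s' t'" "translate s' \<cong> g" "translate t' \<cong> g'" unfolding presented_def by blast
  then obtain m k k' n where t: "typed s m k" "typed t m k" "typed s' k' n" "typed t' k' n"
    using ty_zx_cong by (meson typed_iff_ty)
  have k: "k' = k" using t comp.hyps(3) og_iso_outs[OF 1(2)] og_iso_ins[OF 2(2)] by (simp add: translate_ins translate_outs)
  then have "zx_cong (s' \<bullet> s) (t' \<bullet> t)" using 1 2 t zx_cong.comp_cong by blast
  moreover have "translate (s' \<bullet> s) \<cong> og_comp g f" "translate (t' \<bullet> t) \<cong> og_comp g' f'"
    using 1 2 t k by (auto intro!: comp_iso_cong simp: translate_ins translate_outs)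
  ultimately show ?case unfolding presented_def by blast
next
  case (tens f f' g g')
  then obtain s t s' t' where 1: "zx_cong s t" "translate s \<cong> f" "translate t \<cong> f'"
    and 2: "zx_cong s' t'" "translate s' \<cong> g" "translate t' \<cong> g'" unfolding presented_def by blast
  then have "zx_cong (s \<otimes> s') (t \<otimes> t')" "translate (s \<otimes> s') \<cong> og_tens f g" "translate (t \<otimes> t') \<cong> og_tens f' g'"
    by (auto intro: zx_cong.tens_cong tens_iso_cong)
  then show ?case unfolding presented_def by blast
qed

text \<open>\<open>completeness\<close> supplies some pair of equal terms for the two ends;
  \<open>coherence\<close> at either end replaces them by \<open>s\<close> and
  \<open>t\<close>.\<close>

theorem Rel_translate_iff:
  assumes s: "typed s m n" and t: "typed t m n"
  shows "Rel (translate s) (translate t) \<longleftrightarrow> zx_eq s t"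
proof
  assume "Rel (translate s) (translate t)"
  then obtain s' t' where st: "zx_cong s' t'" "translate s' \<cong> translate s" "translate t' \<cong> translate t"
    by (auto simp: presented_def dest!: completeness)
  then obtain k l where k: "typed s' k l" "typed t' k l" using ty_zx_cong by (meson typed_iff_ty)
  moreover have "k = m" "l = n"
    using k s og_iso_ins[OF st(2)] og_iso_outs[OF st(2)] by (auto simp: translate_ins translate_outs)
  ultimately have "zx_eq s' s" "zx_eq t' t" using coherence s t st by blast+
  then show "zx_eq s t" using st by (meson zx_eq.trans zx_eq.sym zx_eq_iff_cong)
next
  assume "zx_eq s t" then show "Rel (translate s) (translate t)" using soundness by (simp add: zx_eq_iff_cong)
qed

section \<open>The equivalence\<close>

lemma functor_betweenD:
  assumes "functor_between C D Fo Fa"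
  shows "category_laws C" "category_laws D" "x \<in> Obj C \<Longrightarrow> Fo x \<in> Obj D"
    "f \<in> Hom C x y \<Longrightarrow> Fa f \<in> Hom D (Fo x) (Fo y)" "x \<in> Obj C \<Longrightarrow> Fa (Ident C x) = Ident D (Fo x)"
    "f \<in> Hom C x y \<Longrightarrow> g \<in> Hom C y z \<Longrightarrow> Fa (Cmp C g f) = Cmp D (Fa g) (Fa f)"
  using assms unfolding functor_between_def by blast+

lemma functor_between_cong:
  assumes "functor_between C D Fo Fa"
    and "\<And>x. x \<in> Obj C \<Longrightarrow> Go x = Fo x" "\<And>x y f. f \<in> Hom C x y \<Longrightarrow> Ga f = Fa f"
  shows "functor_between C D Go Ga"
proof -
  note func = functor_betweenD[OF assms(1)]
  interpret category_laws C by (rule func(1))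
  show ?thesis
    unfolding functor_between_def
  proof (intro conjI ballI allI)
    fix x y z f g assume f: "f \<in> Hom C x y" and g: "g \<in> Hom C y z"
    show "Ga (Cmp C g f) = Cmp D (Ga g) (Ga f)"
      using func(6)[OF f g] assms(3)[OF cmp_hom[OF f g]] assms(3)[OF f] assms(3)[OF g] by simp
  next
    fix x y f assume f: "f \<in> Hom C x y"
    then show "Ga f \<in> Hom D (Go x) (Go y)" using func(4)[OF f] assms(2,3) hom_obj[OF f] by simp
  next
    fix x assume x: "x \<in> Obj C"
    show "Ga (Ident C x) = Ident D (Go x)" using func(5)[OF x] assms(3)[OF ident_hom[OF x]] assms(2)[OF x] by simp
  qed (use func assms(2) in auto)
qed

lemma ident_functor: "category_laws C \<Longrightarrow> functor_between C C id id"
  unfolding functor_between_def by simp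

lemma natural_iso_ident:
  assumes func: "functor_between C C Fo Fa" and G: "functor_between C C Go Ga"
    and o: "\<And>x. x \<in> Obj C \<Longrightarrow> Fo x = x" "\<And>x. x \<in> Obj C \<Longrightarrow> Go x = x"
    and a: "\<And>x y f. f \<in> Hom C x y \<Longrightarrow> Fa f = f" "\<And>x y f. f \<in> Hom C x y \<Longrightarrow> Ga f = f"
  shows "natural_iso C C Fo Fa Go Ga (Ident C)"
proof -
  interpret category_laws C using func by (auto simp: functor_between_def)
  show ?thesis
    unfolding natural_iso_def is_iso_def
  proof (intro conjI func G ballI allI)
    fix x assume x: "x \<in> Obj C"
    note i = ident_hom[OF x]
    show "Ident C x \<in> Hom C (Fo x) (Go x)" using i o[OF x] by simp
    show "\<exists>g\<in>Hom C (Go x) (Fo x). Cmp C g (Ident C x) = Ident C (Fo x) \<and> Cmp C (Ident C x) g = Ident C (Go x)"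
      using i o[OF x] cmp_ident_left[OF i] by auto
  next
    fix x y f assume f: "f \<in> Hom C x y"
    then show "Cmp C (Ident C y) (Fa f) = Cmp C (Ga f) (Ident C x)"
      using a[OF f] cmp_ident_left[OF f] cmp_ident_right[OF f] by simp
  qed
qed

text \<open>Both functors fix the objects, so identities serve as unit and counit. Injectivity is
  assumed across different hom-sets, which permits a single inverse \<open>G\<close> on their
  union.\<close>

lemma equivalence_if_bijective:
  assumes E: "functor_between C D id E" and obj: "Obj D = Obj C"
    and inj: "\<And>x y x' y' f g. f \<in> Hom C x y \<Longrightarrow> g \<in> Hom C x' y' \<Longrightarrow> E f = E g \<Longrightarrow> f = g"
    and surj: "\<And>x y. Hom D x y \<subseteq> E ` Hom C x y"
  shows "equivalence_of_categories C D id E"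
proof -
  note func = functor_betweenD[OF E, simplified]
  interpret C: category_laws C by (rule func(1))
  interpret D: category_laws D by (rule func(2))
  define H where "H = (\<Union>x y. Hom C x y)"
  define G where "G = inv_into H E"
  have "inj_on E H" unfolding inj_on_def H_def using inj by blast
  then have GE: "G (E f) = f" if "f \<in> Hom C x y" for f x y
    unfolding G_def using that by (intro inv_into_f_f) (auto simp: H_def)
  have EG: "G f \<in> Hom C x y \<and> E (G f) = f" if "f \<in> Hom D x y" for f x y
    using surj[of x y] that GE by auto
  have G: "functor_between D C id G"
    unfolding functor_between_def
  proof (intro conjI ballI allI)
    fix x assume "x \<in> Obj D"
    then have x: "x \<in> Obj C" using obj by simp
    show "G (Ident D x) = Ident C (id x)" using func(5)[OF x] GE[OF C.ident_hom[OF x]] by simp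
  next
    fix x y z f g assume f: "f \<in> Hom D x y" and g: "g \<in> Hom D y z"
    have "E (Cmp C (G g) (G f)) = Cmp D g f"
      using func(6)[of "G f" x y "G g" z] EG[OF f] EG[OF g] by simp
    then show "G (Cmp D g f) = Cmp C (G g) (G f)"
      using GE[OF C.cmp_hom[of "G f" x y "G g" z]] EG[OF f] EG[OF g] by metis
  qed (use EG obj C.category_laws_axioms D.category_laws_axioms in auto)
  have 1: "functor_between C C (id \<circ> id) (G \<circ> E)"
    by (rule functor_between_cong[OF ident_functor[OF func(1)]]) (simp_all add: GE)
  have 2: "functor_between D D (id \<circ> id) (E \<circ> G)"
    by (rule functor_between_cong[OF ident_functor[OF func(2)]]) (use EG in auto)
  have "natural_iso C C id id (id \<circ> id) (G \<circ> E) (Ident C)"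
    by (rule natural_iso_ident[OF ident_functor[OF func(1)] 1]) (auto simp: GE)
  moreover have "natural_iso D D (id \<circ> id) (E \<circ> G) id id (Ident D)"
    by (rule natural_iso_ident[OF 2 ident_functor[OF func(2)]]) (use EG in auto)
  ultimately show ?thesis unfolding equivalence_of_categories_def using E G by blast
qed

text \<open>Equations pass to the image of a map that is onto on hom-sets and respects all
  operations. It is applied to \<open>zx\<close> as an image of \<open>arr_cat\<close> and to
  \<open>norm_zx\<close> as an image of \<open>zx\<close>. Disjointness of hom-sets is assumed
  because \<open>\<Phi>\<close> might identify arrows of different types.\<close>

locale dagger_compact_image = dagger_compact C
  for C :: "('o, 'a, 'm) dagger_compact_data_scheme" +
  fixes D :: "('o, 'b, 'n) dagger_compact_data_scheme" and \<Phi> :: "'a \<Rightarrow> 'b"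
  assumes disjoint: "\<lbrakk>h \<in> Hom D x y; h \<in> Hom D x' y'\<rbrakk> \<Longrightarrow> x = x' \<and> y = y'"
    and obj [simp]: "Obj D = Obj C"
    and hom [simp]: "Hom D x y = \<Phi> ` Hom C x y"
    and ident [simp]: "x \<in> Obj C \<Longrightarrow> Ident D x = \<Phi> (Ident C x)"
    and cmp [simp]: "\<lbrakk>f \<in> Hom C x y; g \<in> Hom C y z\<rbrakk> \<Longrightarrow> Cmp D (\<Phi> g) (\<Phi> f) = \<Phi> (Cmp C g f)"
    and unit [simp]: "Unit D = Unit C"
    and tobj [simp]: "TObj D = TObj C"
    and tarr [simp]: "\<lbrakk>f \<in> Hom C x y; g \<in> Hom C x' y'\<rbrakk> \<Longrightarrow> TArr D (\<Phi> f) (\<Phi> g) = \<Phi> (TArr C f g)"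
    and brd [simp]: "\<lbrakk>x \<in> Obj C; y \<in> Obj C\<rbrakk> \<Longrightarrow> Brd D x y = \<Phi> (Brd C x y)"
    and eval [simp]: "x \<in> Obj C \<Longrightarrow> Eval D x = \<Phi> (Eval C x)"
    and coev [simp]: "x \<in> Obj C \<Longrightarrow> Coev D x = \<Phi> (Coev C x)"
    and dag [simp]: "f \<in> Hom C x y \<Longrightarrow> Dag D (\<Phi> f) = \<Phi> (Dag C f)"
begin

lemma dagger_compact_D: "dagger_compact D"
proof -
  show ?thesis
  proof
    fix f x y x' y' assume "f \<in> Hom D x y" "f \<in> Hom D x' y'"
    then show "x = x' \<and> y = y'" by (rule disjoint)
  next
    fix f x y assume "f \<in> Hom D x y"
    then show "x \<in> Obj D \<and> y \<in> Obj D" using hom_obj by auto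
  next
    fix x assume "x \<in> Obj D" then show "Ident D x \<in> Hom D x x" using ident_hom by simp
  next
    fix f x y g z assume "f \<in> Hom D x y" "g \<in> Hom D y z"
    then show "Cmp D g f \<in> Hom D x z" using cmp_hom by auto
  next
    fix f x y assume "f \<in> Hom D x y"
    then obtain f' where f: "f = \<Phi> f'" "f' \<in> Hom C x y" by auto
    then have o: "x \<in> Obj C" "y \<in> Obj C" using hom_obj by auto
    show "Cmp D f (Ident D x) = f" using f o cmp[OF ident_hom f(2)] cmp_ident_right by simp
    show "Cmp D (Ident D y) f = f" using f o cmp[OF f(2) ident_hom] cmp_ident_left by simp
    show "TArr D (Ident D (Unit D)) f = f \<and> TArr D f (Ident D (Unit D)) = f"
      using f o tarr[OF ident_hom[OF unit_obj] f(2)] tarr[OF f(2) ident_hom[OF unit_obj]] tensor_unit[OF f(2)] unit_obj by simp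
    show "Dag D f \<in> Hom D y x" using f dag_hom by auto
    show "Dag D (Dag D f) = f" using f dag[OF dag_hom[OF f(2)]] dag_dag by simp
  next
    fix f w x g y h z assume "f \<in> Hom D w x" "g \<in> Hom D x y" "h \<in> Hom D y z"
    then obtain f' g' h' where f: "f = \<Phi> f'" "f' \<in> Hom C w x" and g: "g = \<Phi> g'" "g' \<in> Hom C x y"
      and h: "h = \<Phi> h'" "h' \<in> Hom C y z" by auto
    show "Cmp D (Cmp D h g) f = Cmp D h (Cmp D g f)"
      using f g h cmp[OF f(2) cmp_hom[OF g(2) h(2)]] cmp[OF cmp_hom[OF f(2) g(2)] h(2)] cmp_assoc by simp
  next
    show "Unit D \<in> Obj D" using unit_obj by simp
  next
    fix x y assume "x \<in> Obj D" "y \<in> Obj D"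
    then have o: "x \<in> Obj C" "y \<in> Obj C" by auto
    then have t: "TObj C x y \<in> Obj C" "TObj C y x \<in> Obj C" by (auto intro: tensor_obj)
    show "TObj D x y \<in> Obj D" using t by simp
    show "TArr D (Ident D x) (Ident D y) = Ident D (TObj D x y)"
      using o t tarr[OF ident_hom[OF o(1)] ident_hom[OF o(2)]] tensor_ident by simp
    show "Brd D x y \<in> Hom D (TObj D x y) (TObj D y x)" using o braid_hom by simp
    show "Cmp D (Brd D y x) (Brd D x y) = Ident D (TObj D x y)"
      using o t cmp[OF braid_hom[OF o] braid_hom[OF o(2,1)]] braid_braid by simp
    show "Dag D (Brd D x y) = Brd D y x" using o dag[OF braid_hom[OF o]] dag_braid by simp
    have 1: "TArr C (Eval C x) (Eval C y) \<in> Hom C (TObj C (TObj C x x) (TObj C y y)) (TObj C (Unit C) (Unit C))"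
      by (intro tensor_hom eval_hom o)
    have 2: "TArr C (Ident C x) (Brd C y x) \<in> Hom C (TObj C x (TObj C y x)) (TObj C x (TObj C x y))"
      by (intro tensor_hom ident_hom braid_hom o)
    have 3: "TArr C (TArr C (Ident C x) (Brd C y x)) (Ident C y) \<in>
       Hom C (TObj C (TObj C x (TObj C y x)) y) (TObj C (TObj C x (TObj C x y)) y)"
      by (intro tensor_hom[OF 2] ident_hom o)
    \<comment> \<open>Strict associativity of objects makes the middle objects of the two factors
      coincide.\<close>
    have e: "TObj C (TObj C x (TObj C x y)) y = TObj C (TObj C x x) (TObj C y y)"
      using o t by (simp add: tensor_obj_assoc tensor_obj)
    show "Eval D (TObj D x y) = Cmp D (TArr D (Eval D x) (Eval D y))
                (TArr D (TArr D (Ident D x) (Brd D y x)) (Ident D y))"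
      using o t tarr[OF eval_hom[OF o(1)] eval_hom[OF o(2)]] tarr[OF ident_hom[OF o(1)] braid_hom[OF o(2,1)]]
        tarr[OF 2 ident_hom[OF o(2)]] cmp[OF 3[unfolded e] 1] eval_tensor by simp
  next
    fix x y z assume "x \<in> Obj D" "y \<in> Obj D" "z \<in> Obj D"
    then have o: "x \<in> Obj C" "y \<in> Obj C" "z \<in> Obj C" by auto
    then have t: "TObj C y z \<in> Obj C" by (auto intro: tensor_obj)
    show "TObj D (TObj D x y) z = TObj D x (TObj D y z)" using o tensor_obj_assoc by simp
    have 1: "TArr C (Brd C x y) (Ident C z) \<in> Hom C (TObj C (TObj C x y) z) (TObj C (TObj C y x) z)"
      by (intro tensor_hom braid_hom ident_hom o)
    have 2: "TArr C (Ident C y) (Brd C x z) \<in> Hom C (TObj C (TObj C y x) z) (TObj C y (TObj C z x))"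
      using tensor_hom[OF ident_hom[OF o(2)] braid_hom[OF o(1,3)]] o by (simp add: tensor_obj_assoc)
    show "Brd D x (TObj D y z) = Cmp D (TArr D (Ident D y) (Brd D x z)) (TArr D (Brd D x y) (Ident D z))"
      using o t tarr[OF ident_hom[OF o(2)] braid_hom[OF o(1,3)]] tarr[OF braid_hom[OF o(1,2)] ident_hom[OF o(3)]]
        cmp[OF 1 2] hexagon by simp
  next
    fix x assume "x \<in> Obj D"
    then have x: "x \<in> Obj C" by simp
    show "TObj D (Unit D) x = x \<and> TObj D x (Unit D) = x" using x tensor_obj_unit by simp
    show "Eval D x \<in> Hom D (TObj D x x) (Unit D)" "Coev D x \<in> Hom D (Unit D) (TObj D x x)"
      using x eval_hom coev_hom by simp_all
    have 1: "TArr C (Ident C x) (Coev C x) \<in> Hom C x (TObj C x (TObj C x x))"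
      "TArr C (Coev C x) (Ident C x) \<in> Hom C x (TObj C (TObj C x x) x)"
      using tensor_hom[OF ident_hom[OF x] coev_hom[OF x]] tensor_hom[OF coev_hom[OF x] ident_hom[OF x]] tensor_obj_unit[OF x]
      by simp_all
    have 2: "TArr C (Eval C x) (Ident C x) \<in> Hom C (TObj C x (TObj C x x)) x"
      "TArr C (Ident C x) (Eval C x) \<in> Hom C (TObj C (TObj C x x) x) x"
      using tensor_hom[OF ident_hom[OF x] eval_hom[OF x]] tensor_hom[OF eval_hom[OF x] ident_hom[OF x]] tensor_obj_unit[OF x] x
      by (simp_all add: tensor_obj_assoc)
    note ta = tarr[OF ident_hom[OF x] eval_hom[OF x]] tarr[OF eval_hom[OF x] ident_hom[OF x]]
      tarr[OF ident_hom[OF x] coev_hom[OF x]] tarr[OF coev_hom[OF x] ident_hom[OF x]]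
    show "Cmp D (TArr D (Eval D x) (Ident D x)) (TArr D (Ident D x) (Coev D x)) = Ident D x"
      using x ta cmp[OF 1(1) 2(1)] snake by simp
    show "Cmp D (TArr D (Ident D x) (Eval D x)) (TArr D (Coev D x) (Ident D x)) = Ident D x"
      using x ta cmp[OF 1(2) 2(2)] snake' by simp
    show "Cmp D (Eval D x) (Brd D x x) = Eval D x"
      using x cmp[OF braid_hom[OF x x] eval_hom[OF x]] eval_braid by simp
    show "Dag D (Ident D x) = Ident D x" using x dag[OF ident_hom[OF x]] dag_ident by simp
    show "Dag D (Eval D x) = Coev D x" using x dag[OF eval_hom[OF x]] dag_eval by simp
  next
    fix f x y f' x' y' assume "f \<in> Hom D x y" "f' \<in> Hom D x' y'"
    then obtain g g' where f: "f = \<Phi> g" "g \<in> Hom C x y" and f': "f' = \<Phi> g'" "g' \<in> Hom C x' y'" by auto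
    then have o: "x \<in> Obj C" "y \<in> Obj C" "x' \<in> Obj C" "y' \<in> Obj C" using hom_obj by blast+
    show "TArr D f f' \<in> Hom D (TObj D x x') (TObj D y y')" using f f' tensor_hom by auto
    show "Cmp D (Brd D y y') (TArr D f f') = Cmp D (TArr D f' f) (Brd D x x')"
      using f f' o cmp[OF tensor_hom[OF f(2) f'(2)] braid_hom[OF o(2,4)]]
        cmp[OF braid_hom[OF o(1,3)] tensor_hom[OF f'(2) f(2)]] braid_natural by simp
    show "Dag D (TArr D f f') = TArr D (Dag D f) (Dag D f')"
      using f f' dag[OF tensor_hom[OF f(2) f'(2)]] tarr[OF dag_hom[OF f(2)] dag_hom[OF f'(2)]] dag_tensor by simp
  next
    fix f x y g z f' x' y' g' z' assume "f \<in> Hom D x y" "g \<in> Hom D y z" "f' \<in> Hom D x' y'" "g' \<in> Hom D y' z'"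
    then obtain a b a' b' where f: "f = \<Phi> a" "a \<in> Hom C x y" and g: "g = \<Phi> b" "b \<in> Hom C y z"
      and f': "f' = \<Phi> a'" "a' \<in> Hom C x' y'" and g': "g' = \<Phi> b'" "b' \<in> Hom C y' z'" by auto
    show "TArr D (Cmp D g f) (Cmp D g' f') = Cmp D (TArr D g g') (TArr D f f')"
      using f g f' g' tarr[OF cmp_hom[OF f(2) g(2)] cmp_hom[OF f'(2) g'(2)]]
        cmp[OF tensor_hom[OF f(2) f'(2)] tensor_hom[OF g(2) g'(2)]] tensor_cmp by simp
  next
    fix f x y f' x' y' f'' x'' y'' assume "f \<in> Hom D x y" "f' \<in> Hom D x' y'" "f'' \<in> Hom D x'' y''"
    then obtain a b c where f: "f = \<Phi> a" "a \<in> Hom C x y" and g: "f' = \<Phi> b" "b \<in> Hom C x' y'"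
      and h: "f'' = \<Phi> c" "c \<in> Hom C x'' y''" by auto
    show "TArr D (TArr D f f') f'' = TArr D f (TArr D f' f'')"
      using f g h tarr[OF tensor_hom[OF f(2) g(2)] h(2)] tarr[OF f(2) tensor_hom[OF g(2) h(2)]] tensor_assoc by simp
  next
    fix f x y g z assume "f \<in> Hom D x y" "g \<in> Hom D y z"
    then obtain a b where f: "f = \<Phi> a" "a \<in> Hom C x y" and g: "g = \<Phi> b" "b \<in> Hom C y z" by auto
    show "Dag D (Cmp D g f) = Cmp D (Dag D f) (Dag D g)"
      using f g dag[OF cmp_hom[OF f(2) g(2)]] cmp[OF dag_hom[OF g(2)] dag_hom[OF f(2)]] dag_cmp by simp
  qed
qed

end

text \<open>The error class has no type and so lies in no hom-set.\<close>

definition arr_cat :: "(nat, arr) dagger_compact_data" where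
  "arr_cat = \<lparr> Obj = UNIV, Hom = (\<lambda>m n. {a. Ty a = Some (m, n)}), Ident = Idt, Cmp = acomp, Unit = 0,
     TObj = (+), TArr = atens, Brd = Br, Eval = Cap, Coev = Cup, Dag = dg \<rparr>"

lemma arr_cat_simps [simp]:
  "Obj arr_cat = UNIV" "Hom arr_cat m n = {a. Ty a = Some (m, n)}" "Ident arr_cat = Idt" "Cmp arr_cat = acomp"
  "Unit arr_cat = 0" "TObj arr_cat = (+)" "TArr arr_cat = atens" "Brd arr_cat = Br" "Eval arr_cat = Cap"
  "Coev arr_cat = Cup" "Dag arr_cat = dg"
  by (simp_all add: arr_cat_def)

lemma dagger_compact_arr_cat: "dagger_compact arr_cat"
  by standard
    (simp_all add: acomp_assoc atens_assoc Idt_tens_Idt tens_comp Br_natural Br_hexagon snake snake' Cap_Br Cap_tens)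

lemma zx_eq_ty: "zx_eq s t \<Longrightarrow> \<exists>m n. typed s m n \<and> typed t m n"
  by (auto simp: zx_eq_iff_cong typed_iff_ty dest: ty_zx_cong)

lemma abs_arr_eq_iff: "typed s m n \<Longrightarrow> abs_arr s = abs_arr t \<longleftrightarrow> zx_eq s t"
  by (auto simp: arr.abs_eq_iff arr_eq_def zx_eq_iff_cong typed_iff_ty)

lemma zx_class_eq_iff: "typed s m n \<Longrightarrow> zx_class s = zx_class t \<longleftrightarrow> zx_eq s t"
  unfolding zx_class_def using zx_eq.refl zx_eq.sym zx_eq.trans by blast

lemma zx_class_eq: "zx_eq s t \<Longrightarrow> zx_class s = zx_class t"
  unfolding zx_class_def using zx_eq.sym zx_eq.trans by blast

lemma in_zx_class: "typed s m n \<Longrightarrow> s \<in> zx_class s"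
  unfolding zx_class_def using zx_eq.refl by blast

lemma abs_rep_arr: "abs_arr (rep_arr a) = a"
  using Quotient3_arr by (rule Quotient3_abs_rep)

text \<open>The passage from the quotient type to the classes of \<open>zx\<close>, which are sets
  of terms; on typed terms both identify the same terms.\<close>

definition class_of_arr :: "arr \<Rightarrow> zx_term set" where
  "class_of_arr a = zx_class (rep_arr a)"

lemma zx_eq_rep: "typed t m n \<Longrightarrow> zx_eq t (rep_arr (abs_arr t))"
  using abs_arr_eq_iff[of t m n "rep_arr (abs_arr t)"] abs_rep_arr by simp

lemma class_of_arr: "typed t m n \<Longrightarrow> class_of_arr (abs_arr t) = zx_class t"
  unfolding class_of_arr_def using zx_eq_rep zx_class_eq by metis

text \<open>When the operation respects classes, the union runs over copies of one class.\<close>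

lemma lift1_class:
  assumes "a \<in> X" "\<And>x. x \<in> X \<Longrightarrow> cls (f x) = cls (f a)"
  shows "lift1 cls f X = cls (f a)"
  using assms unfolding lift1_def by blast

lemma lift2_class:
  assumes "a \<in> X" "b \<in> Y" "\<And>x y. x \<in> X \<Longrightarrow> y \<in> Y \<Longrightarrow> cls (f x y) = cls (f a b)"
  shows "lift2 cls f X Y = cls (f a b)"
  using assms unfolding lift2_def by blast

lemma zx_simps [simp]:
  "Obj zx = UNIV" "Hom zx m n = {zx_class t | t. typed t m n}" "Ident zx n = zx_class (Id n)"
  "Unit zx = 0" "TObj zx = (+)" "Brd zx m n = zx_class (Braid m n)" "Eval zx n = zx_class (Ev n)"
  "Coev zx n = zx_class (Cv n)"
  by (simp_all add: zx_def)

lemma Cmp_zx: "typed f m k \<Longrightarrow> typed g k n \<Longrightarrow> Cmp zx (zx_class g) (zx_class f) = zx_class (g \<bullet> f)"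
  unfolding zx_def dagger_compact_data.simps category_data.simps
proof (rule lift2_class)
  fix x y assume "typed f m k" "typed g k n" "x \<in> zx_class g" "y \<in> zx_class f"
  then show "zx_class (x \<bullet> y) = zx_class (g \<bullet> f)"
    by (intro zx_class_eq[symmetric] zx_eq.comp_cong) (auto simp: zx_class_def)
qed (rule in_zx_class; assumption)+

lemma TArr_zx: "typed f m n \<Longrightarrow> typed g m' n' \<Longrightarrow> TArr zx (zx_class f) (zx_class g) = zx_class (f \<otimes> g)"
  unfolding zx_def dagger_compact_data.simps category_data.simps
proof (rule lift2_class)
  fix x y assume "x \<in> zx_class f" "y \<in> zx_class g"
  then show "zx_class (x \<otimes> y) = zx_class (f \<otimes> g)"
    by (intro zx_class_eq[symmetric] zx_eq.tens_cong) (auto simp: zx_class_def)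
qed (rule in_zx_class; assumption)+

lemma Dag_zx: "typed f m n \<Longrightarrow> Dag zx (zx_class f) = zx_class (dag f)"
  unfolding zx_def dagger_compact_data.simps category_data.simps
proof (rule lift1_class)
  fix x assume "x \<in> zx_class f"
  then show "zx_class (dag x) = zx_class (dag f)"
    by (intro zx_class_eq[symmetric] zx_eq.dagger) (auto simp: zx_class_def)
qed (rule in_zx_class; assumption)

lemma typed_dag: "typed t m n \<Longrightarrow> typed (dag t) n m"
  by (simp add: typed_iff_ty)

lemma arr_term:
  assumes "Ty a = Some (m, n)"
  obtains t where "a = abs_arr t" "typed t m n"
  using assms that[of "rep_arr a"] Ty.abs_eq[of "rep_arr a"] by (simp add: abs_rep_arr typed_iff_ty)

lemma dagger_compact_zx: "dagger_compact zx"
proof -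
  interpret dagger_compact arr_cat by (rule dagger_compact_arr_cat)
  have typed: "typed (Id n) n n" "typed (Braid m n) (m + n) (n + m)" "typed (Ev n) (n + n) 0" "typed (Cv n) 0 (n + n)" for m n
    by (rule typed.intros)+
  interpret dagger_compact_image arr_cat zx class_of_arr
  proof
    fix f x y x' y' assume "f \<in> Hom zx x y" "f \<in> Hom zx x' y'"
    then obtain s t where "f = zx_class s" "typed s x y" "f = zx_class t" "typed t x' y'" by auto
    then have "zx_eq s t" "typed s x y" "typed t x' y'" using zx_class_eq_iff by blast+
    then show "x = x' \<and> y = y'" using zx_eq_ty by (fastforce simp: typed_iff_ty)
  next
    show "Hom zx m n = class_of_arr ` Hom arr_cat m n" for m n
    proof (intro set_eqI iffI)
      fix f assume "f \<in> Hom zx m n"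
      then obtain t where "f = zx_class t" "typed t m n" by auto
      then show "f \<in> class_of_arr ` Hom arr_cat m n"
        by (intro image_eqI[of _ _ "abs_arr t"]) (auto simp: class_of_arr Ty.abs_eq typed_iff_ty[symmetric])
    next
      fix f assume "f \<in> class_of_arr ` Hom arr_cat m n"
      then show "f \<in> Hom zx m n" by (auto elim!: arr_term simp: class_of_arr)
    qed
    show "Cmp zx (class_of_arr g) (class_of_arr f) = class_of_arr (Cmp arr_cat g f)"
      if f: "f \<in> Hom arr_cat x y" and g: "g \<in> Hom arr_cat y z" for f g x y z
    proof -
      obtain s where "f = abs_arr s" "typed s x y" using arr_term[of f x y] f by auto
      moreover obtain t where "g = abs_arr t" "typed t y z" using arr_term[of g y z] g by auto
      ultimately show ?thesis using typed.intros(10)[of s x y t z] by (simp add: class_of_arr Cmp_zx acomp.abs_eq)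
    qed
    show "TArr zx (class_of_arr f) (class_of_arr g) = class_of_arr (TArr arr_cat f g)"
      if f: "f \<in> Hom arr_cat x y" and g: "g \<in> Hom arr_cat x' y'" for f g x y x' y'
    proof -
      obtain s where "f = abs_arr s" "typed s x y" using arr_term[of f x y] f by auto
      moreover obtain t where "g = abs_arr t" "typed t x' y'" using arr_term[of g x' y'] g by auto
      ultimately show ?thesis using typed.intros(11)[of s x y t x' y'] by (simp add: class_of_arr TArr_zx atens.abs_eq)
    qed
    show "Dag zx (class_of_arr f) = class_of_arr (Dag arr_cat f)" if f: "f \<in> Hom arr_cat x y" for f x y
    proof -
      obtain s where "f = abs_arr s" "typed s x y"
        using arr_term[of f x y] f by auto
      then show ?thesis using typed_dag[of s x y] by (simp add: class_of_arr Dag_zx dg.abs_eq)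
    qed
  qed (simp_all add: typed[THEN class_of_arr] Idt.abs_eq Br.abs_eq Cap.abs_eq Cup.abs_eq)
  show ?thesis by (rule dagger_compact_D)
qed

section \<open>The quotient of the bicategory and the functor\<close>

lemma cell_class_Rel: "cell_class f = {g. Rel f g}"
  by (auto simp: cell_class_def Rel_def)

lemma Rel_refl: "zx_cell1 f \<Longrightarrow> Rel f f"
  using Rel_iso og_iso_refl cell1_open by blast

lemma cell_class_eq: "Rel f g \<Longrightarrow> cell_class f = cell_class g"
  unfolding cell_class_Rel using Rel_trans Rel_sym by blast

lemma cell_class_eq_iff: "zx_cell1 f \<Longrightarrow> zx_cell1 g \<Longrightarrow> cell_class f = cell_class g \<longleftrightarrow> Rel f g"
  using cell_class_eq Rel_refl unfolding cell_class_Rel by blast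

lemma norm_zx_simps [simp]:
  "Obj norm_zx = UNIV" "Hom norm_zx m n = {cell_class f | f. zx_cell1 f \<and> ins f = m \<and> outs f = n}"
  "Ident norm_zx n = cell_class (og_id n)"
  "Unit norm_zx = 0" "TObj norm_zx = (+)" "Brd norm_zx m n = cell_class (og_braid m n)"
  "Eval norm_zx n = cell_class (og_ev n)" "Coev norm_zx n = cell_class (og_coev n)"
  by (simp_all add: norm_zx_def)

lemma Cmp_norm_zx:
  assumes "zx_cell1 f" "zx_cell1 g" "outs f = ins g"
  shows "Cmp norm_zx (cell_class g) (cell_class f) = cell_class (og_comp g f)"
  unfolding norm_zx_def dagger_compact_data.simps category_data.simps
proof (rule lift2_class)
  fix x y assume "x \<in> cell_class g" "y \<in> cell_class f"
  then show "cell_class (og_comp x y) = cell_class (og_comp g f)"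
    using assms by (intro cell_class_eq[symmetric] Rel_comp) (auto simp: cell_class_Rel)
qed (use assms Rel_refl in \<open>auto simp: cell_class_Rel\<close>)

lemma TArr_norm_zx:
  assumes "zx_cell1 f" "zx_cell1 g"
  shows "TArr norm_zx (cell_class f) (cell_class g) = cell_class (og_tens f g)"
  unfolding norm_zx_def dagger_compact_data.simps category_data.simps
proof (rule lift2_class)
  fix x y assume "x \<in> cell_class f" "y \<in> cell_class g"
  then show "cell_class (og_tens x y) = cell_class (og_tens f g)"
    by (intro cell_class_eq[symmetric] Rel_tens) (auto simp: cell_class_Rel)
qed (use assms Rel_refl in \<open>auto simp: cell_class_Rel\<close>)

lemma Dag_norm_zx:
  assumes "zx_cell1 f"
  shows "Dag norm_zx (cell_class f) = cell_class (og_dag f)"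
  unfolding norm_zx_def dagger_compact_data.simps category_data.simps
proof (rule lift1_class)
  fix x assume "x \<in> cell_class f"
  then show "cell_class (og_dag x) = cell_class (og_dag f)"
    by (intro cell_class_eq[symmetric] Rel_dag) (auto simp: cell_class_Rel)
qed (use assms Rel_refl in \<open>auto simp: cell_class_Rel\<close>)

text \<open>On the class of a typed term the choice is immaterial by \<open>soundness\<close>, which
  is the content of \<open>E0_class\<close>.\<close>

definition E0 :: "zx_term set \<Rightarrow> ograph set" where
  "E0 X = cell_class (translate (SOME t. t \<in> X))"

lemma E0_class:
  assumes "typed t m n" shows "E0 (zx_class t) = cell_class (translate t)"
proof -
  have "(SOME s. s \<in> zx_class t) \<in> zx_class t" using in_zx_class[OF assms] by (rule someI)
  then have "Rel (translate t) (translate (SOME s. s \<in> zx_class t))"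
    using soundness by (simp add: zx_class_def zx_eq_iff_cong)
  then show ?thesis unfolding E0_def by (rule cell_class_eq[symmetric])
qed

lemma hom_norm_zx: "Hom norm_zx m n = {cell_class (translate t) | t. typed t m n}"
proof (intro set_eqI iffI)
  fix X assume "X \<in> Hom norm_zx m n"
  then obtain f where f: "X = cell_class f" "zx_cell1 f" "ins f = m" "outs f = n" by auto
  then obtain t where t: "typed t m n" "translate t \<cong> f" using cell1_full by blast
  then have "cell_class (translate t) = cell_class f" using cell_class_eq Rel_iso cell1_translate by blast
  then show "X \<in> {cell_class (translate t) | t. typed t m n}" using f t by blast
qed (use cell1_translate in \<open>auto simp: translate_ins translate_outs\<close>)

lemma hom_disjoint_norm_zx:
  assumes "f \<in> Hom norm_zx x y" "f \<in> Hom norm_zx x' y'"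
  shows "x = x' \<and> y = y'"
proof -
  obtain a b where "f = cell_class a" "zx_cell1 a" "ins a = x" "outs a = y"
    "f = cell_class b" "zx_cell1 b" "ins b = x'" "outs b = y'" using assms by auto
  moreover from this have "Rel a b" using cell_class_eq_iff by blast
  ultimately show ?thesis using Rel_cell1 by blast
qed

lemma E0_Dag: "typed t m n \<Longrightarrow> Dag norm_zx (cell_class (translate t)) = cell_class (translate (dag t))"
proof -
  assume t: "typed t m n"
  have "zx_cell1 (translate (dag t))" using t typed_dag cell1_translate by blast
  then have "Rel (og_dag (translate t)) (translate (dag t))"
    using Rel_sym[OF Rel_iso[OF _ og_iso_sym[OF dag_translate[OF t]]]] by blast
  then show ?thesis using Dag_norm_zx[OF cell1_translate[OF t]] cell_class_eq by simp
qed

lemma image_norm_zx: "dagger_compact_image zx norm_zx E0"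
proof -
  interpret dagger_compact zx by (rule dagger_compact_zx)
  have typed: "typed (Id n) n n" "typed (Braid m n) (m + n) (n + m)" "typed (Ev n) (n + n) 0" "typed (Cv n) 0 (n + n)" for m n
    by (rule typed.intros)+
  show ?thesis
  proof
    show "x = x' \<and> y = y'" if "f \<in> Hom norm_zx x y" "f \<in> Hom norm_zx x' y'" for f x y x' y'
      using that by (rule hom_disjoint_norm_zx)
    show "Hom norm_zx m n = E0 ` Hom zx m n" for m n
      unfolding hom_norm_zx zx_simps by (auto simp: E0_class intro!: image_eqI[where f = E0])
    show "Cmp norm_zx (E0 g) (E0 f) = E0 (Cmp zx g f)" if f: "f \<in> Hom zx x y" and g: "g \<in> Hom zx y z" for f g x y z
    proof -
      obtain s where "f = zx_class s" "typed s x y" using f by auto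
      moreover obtain t where "g = zx_class t" "typed t y z" using g by auto
      ultimately show ?thesis
        using typed.intros(10)[of s x y t z]
        by (simp add: Cmp_zx E0_class Cmp_norm_zx cell1_translate translate_ins translate_outs)
    qed
    show "TArr norm_zx (E0 f) (E0 g) = E0 (TArr zx f g)" if f: "f \<in> Hom zx x y" and g: "g \<in> Hom zx x' y'" for f g x y x' y'
    proof -
      obtain s where "f = zx_class s" "typed s x y" using f by auto
      moreover obtain t where "g = zx_class t" "typed t x' y'" using g by auto
      ultimately show ?thesis
        using typed.intros(11)[of s x y t x' y']
        by (simp add: TArr_zx E0_class TArr_norm_zx cell1_translate)
    qed
    show "Dag norm_zx (E0 f) = E0 (Dag zx f)" if f: "f \<in> Hom zx x y" for f x y
    proof -
      obtain s where "f = zx_class s" "typed s x y" using f by auto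
      then show ?thesis using typed_dag[of s x y] by (simp add: Dag_zx E0_class E0_Dag)
    qed
  qed (simp_all add: typed[THEN E0_class])
qed

lemma (in dagger_compact_image) functor_image: "dagger_compact_functor C D id \<Phi>"
  unfolding dagger_compact_functor_def functor_between_def
  using dagger_compact_axioms dagger_compact_D dagger_compact.axioms(1) dagger_compact_D category_laws_axioms
  by auto

lemma E0_functor: "dagger_compact_functor zx norm_zx id E0"
  by (rule dagger_compact_image.functor_image[OF image_norm_zx])

lemma E0_generators: "interprets_generators E0"
  unfolding interprets_generators_def
  using E0_class[OF typed.intros(5)] E0_class[OF typed.intros(6)] E0_class[OF typed.intros(7)]
    E0_class[OF typed.intros(8)] E0_class[OF typed.intros(9)]
  by simp

lemma functor_TArr:
  assumes "dagger_compact_functor C D Fo Fa" "f \<in> Hom C x y" "g \<in> Hom C x' y'"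
  shows "Fa (TArr C f g) = TArr D (Fa f) (Fa g)"
  using assms unfolding dagger_compact_functor_def by blast

text \<open>Every arrow is the class of a term, and a dagger compact functor is already fixed on
  identities, braidings, evaluations and coevaluations, so its values on the generators determine
  it.\<close>

lemma functor_unique:
  assumes E: "dagger_compact_functor zx norm_zx id E" "interprets_generators E"
  shows "typed t m n \<Longrightarrow> E (zx_class t) = E0 (zx_class t)"
proof (induction rule: typed.induct)
  case (10 f m k g n)
  have "functor_between zx norm_zx id E" "functor_between zx norm_zx id E0"
    using E(1) E0_functor by (auto simp: dagger_compact_functor_def)
  moreover have "zx_class f \<in> Hom zx m k" "zx_class g \<in> Hom zx k n" using 10 by auto
  ultimately have "E (Cmp zx (zx_class g) (zx_class f)) = Cmp norm_zx (E (zx_class g)) (E (zx_class f))"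
    "E0 (Cmp zx (zx_class g) (zx_class f)) = Cmp norm_zx (E0 (zx_class g)) (E0 (zx_class f))"
    by (blast dest: functor_betweenD(6))+
  then show ?case using 10 by (simp add: Cmp_zx)
next
  case (11 f m n g m' n')
  have "zx_class f \<in> Hom zx m n" "zx_class g \<in> Hom zx m' n'" using 11 by auto
  then have "E (TArr zx (zx_class f) (zx_class g)) = TArr norm_zx (E (zx_class f)) (E (zx_class g))"
    "E0 (TArr zx (zx_class f) (zx_class g)) = TArr norm_zx (E0 (zx_class f)) (E0 (zx_class g))"
    using functor_TArr[OF E(1)] functor_TArr[OF E0_functor] by blast+
  then show ?case using 11 by (simp add: TArr_zx)
qed (use E E0_functor E0_generators in
   \<open>auto simp: dagger_compact_functor_def functor_between_def interprets_generators_def\<close>)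

lemma E0_injective:
  assumes "f \<in> Hom zx x y" "g \<in> Hom zx x' y'" "E0 f = E0 g"
  shows "f = g"
proof -
  obtain s t where s: "f = zx_class s" "typed s x y" and t: "g = zx_class t" "typed t x' y'" using assms by auto
  have "cell_class (translate s) = cell_class (translate t)" using assms(3) s t by (simp add: E0_class)
  then have R: "Rel (translate s) (translate t)"
    using s t cell1_translate cell_class_eq_iff by blast
  then have "x' = x" "y' = y" using Rel_cell1[OF R] s t by (auto simp: translate_ins translate_outs)
  then have "zx_eq s t" using R s t Rel_translate_iff by blast
  then show ?thesis using s t zx_class_eq by simp
qed

theorem theorem5p4:
  "(\<exists>E. dagger_compact_functor zx norm_zx id E \<and> interprets_generators E) \<and>
   (\<forall>E E'. dagger_compact_functor zx norm_zx id E \<and> interprets_generators E \<and>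
           dagger_compact_functor zx norm_zx id E' \<and> interprets_generators E' \<longrightarrow>
           (\<forall>m n. \<forall>f\<in>Hom zx m n. E f = E' f)) \<and>
   (\<forall>E. dagger_compact_functor zx norm_zx id E \<and> interprets_generators E \<longrightarrow>
        equivalence_of_categories zx norm_zx id E)"
proof (intro conjI allI impI)
  show "\<exists>E. dagger_compact_functor zx norm_zx id E \<and> interprets_generators E"
    using E0_functor E0_generators by blast
next
  fix E E' m n assume "dagger_compact_functor zx norm_zx id E \<and> interprets_generators E \<and>
           dagger_compact_functor zx norm_zx id E' \<and> interprets_generators E'"
  then show "\<forall>f\<in>Hom zx m n. E f = E' f"
    using functor_unique[of E] functor_unique[of E'] by auto
next
  fix E assume E: "dagger_compact_functor zx norm_zx id E \<and> interprets_generators E"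
  \<comment> \<open>By uniqueness \<open>E\<close> agrees with \<open>E0\<close> on arrows and
    inherits injectivity and surjectivity from it.\<close>
  then have eq: "E f = E0 f" if "f \<in> Hom zx x y" for f x y
    using that functor_unique by auto
  show "equivalence_of_categories zx norm_zx id E"
  proof (rule equivalence_if_bijective[of zx norm_zx E])
    show "functor_between zx norm_zx id E" using E by (simp add: dagger_compact_functor_def)
    show "f = g" if "f \<in> Hom zx x y" "g \<in> Hom zx x' y'" "E f = E g" for f g x y x' y'
      using E0_injective[OF that(1,2)] eq[OF that(1)] eq[OF that(2)] that(3) by simp
    show "Hom norm_zx x y \<subseteq> E ` Hom zx x y" for x y
      using dagger_compact_image.hom[OF image_norm_zx, of x y] eq by (auto simp del: norm_zx_simps zx_simps)
  qed simp
qed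

end
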